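(* Let $D=[0,1]^d$ and let $\{\nu_m\}_{m=1}^\infty$ be a positive decreasing sequence with $\nu_1=1$. For $r>0$ define the class of covariance operators $$\mathcal{F}(r,\{\nu_m\})=\Big\{\mathcal{C}:\ \sup_{x\in D}k(x,x)\lesssim\mathrm{Tr}(\mathcal{C}),\ r(\mathcal{C})\le r,\ \sup_{x\in D}\int_{\{y\in D:\|x-y\|>m\,r(\mathcal{C})^{-1/d}\}}|k(x,y)|\,dy\lesssim\|\mathcal{C}\|\nu_m\ \ \forall m\in\mathbb{N}\Big\}.$$ Suppose $N>\log r>0$. The minimax risk for estimating the covariance operator over $\mathcal{F}(r,\{\nu_m\})$ under the operator norm, based on $N$ independent samples $u_1,\dots,u_N$ from $\mathrm{GP}(0,\mathcal{C})$, satisfies $$\inf_{\widehat{\mathcal{C}}}\ \sup_{\mathcal{C}\in\mathcal{F}(r,\{\nu_m\})}\frac{\mathbb{E}\|\widehat{\mathcal{C}}-\mathcal{C}\|}{\|\mathcal{C}\|}\gtrsim\min\left\{\varepsilon_*+\sqrt{\frac{\log r}{N}},\ \sqrt{\frac rN}\right\}.$$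
   Context: $\mathcal{C}$ ranges over nonzero trace-class covariance operators on $L^2(D)$, $(\mathcal{C}\psi)(\cdot)=\int_Dk(\cdot,y)\psi(y)\,dy$, where $k(x,y)=\mathbb{E}[u(x)u(y)]$ is the covariance function of a centered square-integrable Gaussian process $u\sim\mathrm{GP}(0,\mathcal{C})$ on $D$. $\|\cdot\|$ is the operator norm for operators and the Euclidean norm for vectors; $r(\mathcal{C})=\mathrm{Tr}(\mathcal{C})/\|\mathcal{C}\|$ is the effective dimension; $a\wedge b=\min\{a,b\}$, $\mathbb{N}=\{1,2,\dots\}$. The infimum is over kernel integral operators $\widehat{\mathcal{C}}$ whose kernel $\hat k$ is a measurable function of the data $u_1(\cdot),\dots,u_N(\cdot)$. The quantities $m_*$ and $\varepsilon_*$, depending on $\{\nu_m\},N,d$, are $$m_*=\min\Big\{m\in\mathbb{N}:\nu_m\le\sqrt{m^d/N}\Big\},\qquad \varepsilon_*=\max_{m\in\mathbb{N}}\Big\{\nu_m\wedge\sqrt{m^d/N}\Big\}.$$ Standing assumption: $m_*\ge2$ (equivalently $N\ge2$). $a\lesssim b$ (equivalently $b\gtrsim a$) means $a\le c\,b$ for some constant $c>0$; the dimension $d$ is treated as a constant. The constants implicit in the definition of $\mathcal{F}(r,\{\nu_m\})$ are fixed and sufficiently large (depending only on $d$), and the constant in the lower bound depends only on $d$. *)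

theory Defs
  imports "HOL-Probability.Probability"
begin

text \<open>
  The dimension is \<open>d = CARD('d)\<close> and \<open>D = cbox 0 1\<close> is the cube \<open>[0,1]^d\<close> in \<open>real ^ 'd\<close>.
  Elements of \<open>L\<^sup>2(D)\<close> are represented by Borel functions, identified almost everywhere; values
  of paths and kernels outside \<open>D\<close> are never used.
\<close>

definition cube :: "(real ^ 'd) set" where
  "cube = cbox 0 1"

definition cube_measure :: "(real ^ 'd) measure" where
  "cube_measure = restrict_space lborel cube"

definition L2 :: "(real ^ 'd \<Rightarrow> real) \<Rightarrow> bool" where
  "L2 f \<longleftrightarrow> f \<in> borel_measurable cube_measure \<and> integrable cube_measure (\<lambda>x. (f x)\<^sup>2)"

definition L2_inner :: "(real ^ 'd \<Rightarrow> real) \<Rightarrow> (real ^ 'd \<Rightarrow> real) \<Rightarrow> real" where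
  "L2_inner f g = (LINT x|cube_measure. f x * g x)"

definition L2_norm :: "(real ^ 'd \<Rightarrow> real) \<Rightarrow> real" where
  "L2_norm f = sqrt (L2_inner f f)"

definition orthonormal_basis :: "(nat \<Rightarrow> real ^ 'd \<Rightarrow> real) \<Rightarrow> bool" where
  "orthonormal_basis e \<longleftrightarrow>
     (\<forall>i. L2 (e i)) \<and>
     (\<forall>i j. L2_inner (e i) (e j) = (if i = j then 1 else 0)) \<and>
     (\<forall>f. L2 f \<longrightarrow>
        (\<lambda>n. L2_norm (\<lambda>x. f x - (\<Sum>i<n. L2_inner f (e i) * e i x))) \<longlonglongrightarrow> 0)"


subsection \<open>Operators on \<open>L\<^sup>2(D)\<close>\<close>

type_synonym 'd kernel = "real ^ 'd \<Rightarrow> real ^ 'd \<Rightarrow> real"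
type_synonym 'd operator = "(real ^ 'd \<Rightarrow> real) \<Rightarrow> (real ^ 'd \<Rightarrow> real)"

definition integral_op :: "('d::finite) kernel \<Rightarrow> 'd operator" where
  "integral_op k \<psi> x = (LINT y|cube_measure. k x y * \<psi> y)"

text \<open>The supremum is meaningful for bounded operators, the only ones it is applied to.\<close>

definition op_norm :: "('d::finite) operator \<Rightarrow> real" where
  "op_norm T = Sup {L2_norm (T \<psi>) |\<psi>. L2 \<psi> \<and> L2_norm \<psi> \<le> 1}"

definition nonzero_op :: "('d::finite) operator \<Rightarrow> bool" where
  "nonzero_op T \<longleftrightarrow> (\<exists>\<psi>. L2 \<psi> \<and> \<not> (AE x in cube_measure. T \<psi> x = 0))"

text \<open>
  Convergence of the diagonal sum in every orthonormal basis characterises trace-class operators;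
  the value of the sum is then the same in all bases. For the positive operators considered here
  this is the usual definition.
\<close>

definition has_trace :: "('d::finite) operator \<Rightarrow> real \<Rightarrow> bool" where
  "has_trace T t \<longleftrightarrow> (\<forall>e. orthonormal_basis e \<longrightarrow> (\<lambda>i. L2_inner (T (e i)) (e i)) sums t)"

definition trace_class :: "('d::finite) operator \<Rightarrow> bool" where
  "trace_class T \<longleftrightarrow> (\<exists>t. has_trace T t)"

definition trace_op :: "('d::finite) operator \<Rightarrow> real" where
  "trace_op T = (THE t. has_trace T t)"

definition effective_dim :: "('d::finite) operator \<Rightarrow> real" where
  "effective_dim T = trace_op T / op_norm T"

definition bounded_integral_kernel :: "('d::finite) kernel \<Rightarrow> bool" where
  "bounded_integral_kernel k \<longleftrightarrow>
     (\<lambda>(x, y). k x y) \<in> borel_measurable (cube_measure \<Otimes>\<^sub>M cube_measure) \<and>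
     (\<forall>\<psi>. L2 \<psi> \<longrightarrow>
        (AE x in cube_measure. integrable cube_measure (\<lambda>y. k x y * \<psi> y)) \<and>
        L2 (integral_op k \<psi>)) \<and>
     (\<exists>B. \<forall>\<psi>. L2 \<psi> \<longrightarrow> L2_norm (integral_op k \<psi>) \<le> B * L2_norm \<psi>)"


subsection \<open>Gaussian processes and their laws\<close>

text \<open>Degenerate normal variables (variance zero) count as Gaussian.\<close>

definition centered_gaussian :: "'w measure \<Rightarrow> ('w \<Rightarrow> real) \<Rightarrow> bool" where
  "centered_gaussian M X \<longleftrightarrow>
     X \<in> borel_measurable M \<and>
     ((AE \<omega> in M. X \<omega> = 0) \<or>
      (\<exists>\<sigma>>0. distributed M lborel X (normal_density 0 \<sigma>)))"

text \<open>
  A (jointly) measurable centered Gaussian process on \<open>D\<close> with square-integrable paths,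
  \<open>E \<parallel>u\<parallel>\<^sup>2 < \<infinity>\<close>, and covariance function \<open>k\<close>. Joint Gaussianity of the finite-dimensional
  marginals is expressed through their linear combinations.
\<close>

definition centered_gp ::
    "'w measure \<Rightarrow> ('w \<Rightarrow> real ^ 'd \<Rightarrow> real) \<Rightarrow> ('d::finite) kernel \<Rightarrow> bool" where
  "centered_gp M u k \<longleftrightarrow>
     prob_space M \<and>
     (\<lambda>(\<omega>, x). u \<omega> x) \<in> borel_measurable (M \<Otimes>\<^sub>M cube_measure) \<and>
     integrable (M \<Otimes>\<^sub>M cube_measure) (\<lambda>(\<omega>, x). (u \<omega> x)\<^sup>2) \<and>
     (\<forall>\<omega>\<in>space M. L2 (u \<omega>)) \<and>
     (\<forall>S a. finite S \<and> S \<subseteq> cube \<longrightarrow> centered_gaussian M (\<lambda>\<omega>. \<Sum>x\<in>S. a x * u \<omega> x)) \<and>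
     (\<forall>x\<in>cube. \<forall>y\<in>cube. k x y = (LINT \<omega>|M. u \<omega> x * u \<omega> y))"

text \<open>
  The observation space of one sample: square-integrable paths with the \<open>\<sigma>\<close>-algebra generated by
  the point evaluations at points of \<open>D\<close> and the functionals \<open>\<langle>\<cdot>, g\<rangle>\<close>, \<open>g \<in> L\<^sup>2(D)\<close>. (The point
  evaluations alone do not make the latter measurable, as \<open>D\<close> is uncountable.)
\<close>

definition path_space :: "(real ^ 'd \<Rightarrow> real) measure" where
  "path_space = sigma {f. L2 f}
     ({{f. L2 f \<and> f x \<in> B} |x B. x \<in> cube \<and> B \<in> sets borel} \<union>
      {{f. L2 f \<and> L2_inner f g \<in> B} |g B. L2 g \<and> B \<in> sets borel})"

text \<open>
  \<open>gp_law k P\<close>: \<open>P\<close> is the law on path space of a centered Gaussian process with covariance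
  function \<open>k\<close>. By Gaussianity and Fubini, \<open>k\<close> determines \<open>P\<close>. The sample space type
  \<open>nat \<Rightarrow> real\<close> is no restriction: up to a version, every jointly measurable Gaussian process can
  be built from countably many independent standard normal variables.
\<close>

definition gp_law :: "('d::finite) kernel \<Rightarrow> (real ^ 'd \<Rightarrow> real) measure \<Rightarrow> bool" where
  "gp_law k P \<longleftrightarrow>
     (\<exists>(M :: (nat \<Rightarrow> real) measure) u. centered_gp M u k \<and> P = distr M path_space u)"

definition covariance_function :: "('d::finite) kernel \<Rightarrow> bool" where
  "covariance_function k \<longleftrightarrow> (\<exists>P. gp_law k P)"


subsection \<open>The class of covariance operators\<close>

text \<open>
  Covariance operators are represented by their covariance functions. \<open>K1\<close> and \<open>K2\<close> are the
  constants implicit in the two \<open>\<lesssim>\<close> relations of the class.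
\<close>

definition covariance_class ::
    "real \<Rightarrow> real \<Rightarrow> real \<Rightarrow> (nat \<Rightarrow> real) \<Rightarrow> ('d::finite) kernel set" where
  "covariance_class K1 K2 r \<nu> =
     {k. covariance_function k \<and> nonzero_op (integral_op k) \<and> trace_class (integral_op k) \<and>
         (\<forall>x\<in>cube. k x x \<le> K1 * trace_op (integral_op k)) \<and>
         effective_dim (integral_op k) \<le> r \<and>
         (\<forall>m\<ge>1. \<forall>x\<in>cube.
            (LINT y:{y\<in>cube. norm (x - y) >
                 real m * effective_dim (integral_op k) powr (- 1 / real CARD('d))}|lborel.
               \<bar>k x y\<bar>)
            \<le> K2 * op_norm (integral_op k) * \<nu> m)}"


subsection \<open>Estimators and minimax risk\<close>

definition data_space :: "nat \<Rightarrow> (nat \<Rightarrow> real ^ 'd \<Rightarrow> real) measure" where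
  "data_space N = (\<Pi>\<^sub>M i\<in>{1..N}. path_space)"

text \<open>
  Kernel estimators. Besides the values \<open>\<kappa> u x y\<close>, the matrix coefficients of the associated random
  operator are required to be measurable in the data, so that (\<open>L\<^sup>2(D)\<close> being separable) the
  operator-norm error is a random variable. Joint measurability in \<open>(u, x, y)\<close> implies both
  conditions, but it would exclude the sample covariance \<open>N\<^sup>-\<^sup>1 \<Sum>\<^sub>i u\<^sub>i(x) u\<^sub>i(y)\<close>, since evaluation
  \<open>(f, x) \<mapsto> f x\<close> is not jointly measurable on path space.
\<close>

definition estimators :: "nat \<Rightarrow> ((nat \<Rightarrow> real ^ 'd \<Rightarrow> real) \<Rightarrow> 'd kernel) set" where
  "estimators N =
     {\<kappa>. (\<forall>u\<in>space (data_space N). bounded_integral_kernel (\<kappa> u)) \<and>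
         (\<forall>x\<in>cube. \<forall>y\<in>cube. (\<lambda>u. \<kappa> u x y) \<in> borel_measurable (data_space N)) \<and>
         (\<forall>f g. L2 f \<and> L2 g \<longrightarrow>
            (\<lambda>u. L2_inner (integral_op (\<kappa> u) f) g) \<in> borel_measurable (data_space N))}"

text \<open>The relative risk at \<open>k\<close> for \<open>N\<close> independent samples with law \<open>P\<close>.\<close>

definition relative_risk ::
    "nat \<Rightarrow> ((nat \<Rightarrow> real ^ 'd \<Rightarrow> real) \<Rightarrow> 'd kernel) \<Rightarrow> ('d::finite) kernel \<Rightarrow>
     (real ^ 'd \<Rightarrow> real) measure \<Rightarrow> ennreal" where
  "relative_risk N \<kappa> k P =
     (\<integral>\<^sup>+ u. ennreal (op_norm (\<lambda>\<psi> x. integral_op (\<kappa> u) \<psi> x - integral_op k \<psi> x))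
        \<partial>(\<Pi>\<^sub>M i\<in>{1..N}. P)) / ennreal (op_norm (integral_op k))"

definition minimax_risk :: "nat \<Rightarrow> ('d::finite) kernel set \<Rightarrow> ennreal" where
  "minimax_risk N F =
     (INF \<kappa>\<in>estimators N. SUP (k, P)\<in>{(k, P). k \<in> F \<and> gp_law k P}. relative_risk N \<kappa> k P)"


subsection \<open>The rate\<close>

definition m_star :: "(nat \<Rightarrow> real) \<Rightarrow> nat \<Rightarrow> nat \<Rightarrow> nat" where
  "m_star \<nu> N d = (LEAST m. m \<ge> 1 \<and> \<nu> m \<le> sqrt (real m ^ d / real N))"

text \<open>The supremum is a maximum when \<open>\<nu>\<close> is positive and decreasing.\<close>

definition eps_star :: "(nat \<Rightarrow> real) \<Rightarrow> nat \<Rightarrow> nat \<Rightarrow> real" where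
  "eps_star \<nu> N d = (SUP m\<in>{1..}. min (\<nu> m) (sqrt (real m ^ d / real N)))"

end

theory Submission
  imports Defs
begin

text \<open>
  All hypotheses are finite-dimensional. Inside the cube take \<open>n\<close> disjoint cells of a grid, let \<open>e\<^sub>i\<close> be
  their normalised indicators and consider \<open>u = \<Sum>\<^sub>i \<xi>\<^sub>i e\<^sub>i\<close> for a Gaussian vector \<open>\<xi> = (I + \<beta> w\<^sup>T) \<omega>\<close>,
  where \<open>\<omega>\<close> is standard normal and \<open>\<parallel>w\<parallel> = 1\<close>. Trace, operator norm and decay of the kernel are read off
  the matrix \<open>A = (I + \<beta> w\<^sup>T)(I + \<beta> w\<^sup>T)\<^sup>T\<close>.

  \<^item> For \<open>\<surd>(log r / N)\<close>, and for the parametric rate \<open>1 / \<surd>N\<close> that is needed when \<open>r\<close> is close to 1, one of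
  about \<open>r\<close> variances is inflated by \<open>a \<approx> \<surd>(log r / N)\<close>; the uniform mixture of these alternatives
  is close to the identity covariance.

  \<^item> For \<open>\<epsilon>\<^sub>*\<close> take \<open>2 q\<^sup>d\<close> cells, \<open>q\<^sup>d \<approx> min (m\<^sub>*\<^sup>d) r\<close>, let \<open>w\<close> be constant on one half and
  \<open>\<beta> \<in> {0, b}\<close> with \<open>b \<approx> 1 / \<surd>N\<close> arbitrary on the other half. Changing one entry of \<open>\<beta>\<close> cannot be
  detected from \<open>N\<close> samples, so Assouad's argument costs \<open>b q\<^bsup>d/2\<^esup>\<close>. The row sums of \<open>A - I\<close> are of order
  \<open>b q\<^bsup>d/2\<^esup> \<approx> \<surd>(q\<^sup>d / N) \<le> \<nu>\<^sub>m\<close> for \<open>m < m\<^sub>*\<close>, and the support of the kernel lies within distance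
  \<open>m\<^sub>* r(\<C>)\<^bsup>-1/d\<^esup>\<close> of the diagonal, which gives the decay condition for all \<open>m\<close>.

  The likelihood ratios follow from changes of variables in a single Gaussian coordinate.
\<close>


subsection \<open>Square-integrable functions on the cube\<close>

text \<open>Why shears: with \<open>w\<close> supported off \<beta>, the maps I + \<beta> w^T add
  up, have determinant 1 and fix w . \<omega>, so passing to a neighbour of \<beta> moves one
  Gaussian coordinate by a multiple of a form in the others. No density of a correlated vector is
  written down; every alternative is a push-forward of the same standard samples. Moreover A w
  equals \<beta> on the half where \<beta> lives: testing an estimator on the single vector
  \<open>w\<close> turns the operator norm into an l2 error in k = q^d unknown entries, of size b
  sqrt k. Spreading \<open>w\<close> evenly keeps the row sums equally small. The cells fill only a
  corner of the cube, of diameter at most 1/4, so that l r(C)^(-1/d) exceeds the diameter of the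
  support as soon as l >= q, and the decay condition then holds trivially. The price is a factor
  (8d)^d in the bound on the diagonal. Shears need 3 k <= r, hence r >= 3; smaller r is left to the
  parametric rate. Two obstacles come from the definitions: \<open>op_norm\<close> is a real
  \<open>Sup\<close>, so lower bounds need boundedness, and \<open>trace_op\<close> is a definite
  description, so an orthonormal basis must be constructed.\<close>

lemma space_cube_measure [simp]: "space cube_measure = cube"
  by (simp add: cube_measure_def space_restrict_space)

lemma cube_in_borel [measurable, simp]: "cube \<in> sets borel"
  by (simp add: cube_def)

lemma sets_cube_measure: "sets (cube_measure :: (real ^ 'd) measure) = sets (restrict_space borel cube)"
  by (simp add: cube_measure_def sets_restrict_space)

lemma emeasure_lborel_cube: "emeasure lborel (cube :: (real ^ 'd) set) = 1"
proof -
  have ne: "cbox (0 :: real ^ 'd) 1 \<noteq> {}"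
    using mem_box_cart(2)[of "0 :: real ^ 'd" 0 1] by auto
  have "measure lborel (cube :: (real ^ 'd) set) = 1"
    unfolding cube_def using content_cbox_cart[OF ne] by simp
  moreover have "emeasure lborel (cube :: (real ^ 'd) set) \<noteq> \<infinity>"
    unfolding cube_def using emeasure_lborel_cbox_finite[of "0 :: real ^ 'd" 1] by auto
  ultimately show ?thesis
    by (simp add: emeasure_eq_ennreal_measure top.not_eq_extremum)
qed

lemma emeasure_cube_measure:
  assumes "A \<in> sets borel" "A \<subseteq> cube"
  shows "emeasure cube_measure A = emeasure lborel A"
  using assms by (simp add: cube_measure_def emeasure_restrict_space)

lemma prob_space_cube_measure: "prob_space (cube_measure :: (real ^ 'd) measure)"
  by (rule prob_spaceI) (simp add: emeasure_cube_measure emeasure_lborel_cube)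

lemma borel_measurable_cube_measureI [measurable (raw)]:
  "f \<in> borel_measurable borel \<Longrightarrow> f \<in> borel_measurable (cube_measure :: (real ^ 'd) measure)"
  by (simp add: cube_measure_def measurable_restrict_space1)

lemma L2_borel_measurable: "L2 f \<Longrightarrow> f \<in> borel_measurable cube_measure"
  by (simp add: L2_def)

lemma L2_integrable_mult:
  assumes "L2 f" "L2 g"
  shows "integrable cube_measure (\<lambda>x. f x * g x)"
proof (rule Bochner_Integration.integrable_bound)
  show "integrable cube_measure (\<lambda>x. (f x)\<^sup>2 + (g x)\<^sup>2)"
    using assms by (auto simp: L2_def)
  show "(\<lambda>x. f x * g x) \<in> borel_measurable cube_measure"
    using assms by (auto simp: L2_def)
  have "\<bar>a * b\<bar> \<le> a\<^sup>2 + b\<^sup>2" for a b :: real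
  proof -
    have "2 * \<bar>a * b\<bar> \<le> a\<^sup>2 + b\<^sup>2"
      using sum_squares_bound[of "\<bar>a\<bar>" "\<bar>b\<bar>"] by (simp add: abs_mult mult.assoc)
    then show ?thesis using abs_ge_zero[of "a * b"] by linarith
  qed
  then show "AE x in cube_measure. norm (f x * g x) \<le> norm ((f x)\<^sup>2 + (g x)\<^sup>2)"
    by auto
qed

lemma L2_add [intro]:
  assumes "L2 f" "L2 g"
  shows "L2 (\<lambda>x. f x + g x)"
  unfolding L2_def
proof
  show "(\<lambda>x. f x + g x) \<in> borel_measurable cube_measure"
    using assms by (auto simp: L2_def)
  have "integrable cube_measure (\<lambda>x. (f x)\<^sup>2 + (g x)\<^sup>2 + 2 * (f x * g x))"
    using assms L2_integrable_mult[OF assms] by (auto simp: L2_def)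
  then show "integrable cube_measure (\<lambda>x. (f x + g x)\<^sup>2)"
    by (simp add: power2_sum algebra_simps)
qed

lemma L2_cmult [intro]: "L2 f \<Longrightarrow> L2 (\<lambda>x. c * f x)"
  by (auto simp: L2_def power_mult_distrib)

lemma L2_zero [simp, intro]: "L2 (\<lambda>x. 0)"
  by (simp add: L2_def)

lemma L2_diff [intro]: "L2 f \<Longrightarrow> L2 g \<Longrightarrow> L2 (\<lambda>x. f x - g x)"
  using L2_add[of f "\<lambda>x. - 1 * g x"] L2_cmult[of g "- 1"] by simp

lemma L2_sum [intro]: "(\<And>i. i \<in> I \<Longrightarrow> L2 (f i)) \<Longrightarrow> L2 (\<lambda>x. \<Sum>i\<in>I. f i x)"
  by (induction I rule: infinite_finite_induct) auto

lemma L2_bounded: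
  assumes "f \<in> borel_measurable cube_measure" "\<And>x. x \<in> cube \<Longrightarrow> \<bar>f x\<bar> \<le> C"
  shows "L2 f"
  unfolding L2_def
proof
  interpret prob_space "cube_measure :: (real ^ 'a) measure" by (rule prob_space_cube_measure)
  show "integrable cube_measure (\<lambda>x. (f x)\<^sup>2)"
  proof (rule integrable_const_bound[where B = "C\<^sup>2"])
    show "AE x in cube_measure. norm ((f x)\<^sup>2) \<le> C\<^sup>2"
      using assms(2) by (auto intro!: AE_I2 abs_le_square_iff[THEN iffD1] simp: order_trans[OF _ abs_ge_self])
  qed (use assms in measurable)
qed (use assms in auto)

lemma L2_inner_commute: "L2_inner f g = L2_inner g f"
  by (simp add: L2_inner_def mult.commute)

lemma L2_inner_cong:
  "(\<And>x. x \<in> cube \<Longrightarrow> f x = f' x) \<Longrightarrow> (\<And>x. x \<in> cube \<Longrightarrow> g x = g' x) \<Longrightarrow> L2_inner f g = L2_inner f' g'"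
  unfolding L2_inner_def by (intro Bochner_Integration.integral_cong) auto

lemma L2_norm_cong: "(\<And>x. x \<in> cube \<Longrightarrow> f x = g x) \<Longrightarrow> L2_norm f = L2_norm g"
  unfolding L2_norm_def using L2_inner_cong[of f g f g] by simp

lemma L2_inner_add_left:
  "L2 f \<Longrightarrow> L2 g \<Longrightarrow> L2 h \<Longrightarrow> L2_inner (\<lambda>x. f x + g x) h = L2_inner f h + L2_inner g h"
  unfolding L2_inner_def by (simp add: distrib_right L2_integrable_mult)

lemma L2_inner_diff_left:
  "L2 f \<Longrightarrow> L2 g \<Longrightarrow> L2 h \<Longrightarrow> L2_inner (\<lambda>x. f x - g x) h = L2_inner f h - L2_inner g h"
  unfolding L2_inner_def by (simp add: left_diff_distrib L2_integrable_mult)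

lemma L2_inner_cmult_left [simp]: "L2_inner (\<lambda>x. c * f x) h = c * L2_inner f h"
  unfolding L2_inner_def by (simp add: mult.assoc)

lemma L2_inner_cmult_right [simp]: "L2_inner h (\<lambda>x. c * f x) = c * L2_inner h f"
  by (metis L2_inner_commute L2_inner_cmult_left)

lemma L2_inner_zero_left [simp]: "L2_inner (\<lambda>x. 0) h = 0"
  unfolding L2_inner_def by simp

lemma L2_inner_sum_left:
  "(\<And>i. i \<in> I \<Longrightarrow> L2 (f i)) \<Longrightarrow> L2 h \<Longrightarrow> L2_inner (\<lambda>x. \<Sum>i\<in>I. f i x) h = (\<Sum>i\<in>I. L2_inner (f i) h)"
  by (induction I rule: infinite_finite_induct) (auto simp: L2_inner_add_left L2_sum)

lemma L2_inner_sum_right: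
  "(\<And>i. i \<in> I \<Longrightarrow> L2 (f i)) \<Longrightarrow> L2 h \<Longrightarrow> L2_inner h (\<lambda>x. \<Sum>i\<in>I. f i x) = (\<Sum>i\<in>I. L2_inner h (f i))"
  using L2_inner_sum_left[of I f h] by (simp add: L2_inner_commute)

lemma L2_inner_add_right:
  "L2 f \<Longrightarrow> L2 g \<Longrightarrow> L2 h \<Longrightarrow> L2_inner h (\<lambda>x. f x + g x) = L2_inner h f + L2_inner h g"
  using L2_inner_add_left[of f g h] by (simp add: L2_inner_commute)

lemma L2_inner_diff_right:
  "L2 f \<Longrightarrow> L2 g \<Longrightarrow> L2 h \<Longrightarrow> L2_inner h (\<lambda>x. f x - g x) = L2_inner h f - L2_inner h g"
  using L2_inner_diff_left[of f g h] by (simp add: L2_inner_commute)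

lemma L2_inner_self_nonneg: "0 \<le> L2_inner f f"
  unfolding L2_inner_def by (rule integral_nonneg_AE) auto

lemma L2_norm_nonneg [simp]: "0 \<le> L2_norm f"
  by (simp add: L2_norm_def L2_inner_self_nonneg)

lemma L2_norm_squared: "(L2_norm f)\<^sup>2 = L2_inner f f"
  by (simp add: L2_norm_def L2_inner_self_nonneg)

lemma L2_norm_cmult: "L2_norm (\<lambda>x. c * f x) = \<bar>c\<bar> * L2_norm f"
  unfolding L2_norm_def by (simp add: real_sqrt_mult flip: mult.assoc)

text \<open>Positivity of the quadratic form ||s f - t g||^2 in (s, t). Functions are identified
  only almost everywhere, so c = 0 does not give g = 0, and b = 0 is extracted from the form
  itself.\<close>

lemma L2_Cauchy_Schwarz:
  assumes "L2 f" "L2 g"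
  shows "\<bar>L2_inner f g\<bar> \<le> L2_norm f * L2_norm g"
proof -
  define a b c where "a = L2_inner f f" "b = L2_inner f g" "c = L2_inner g g"
  have q: "0 \<le> s\<^sup>2 * a - 2 * s * t * b + t\<^sup>2 * c" for s t
  proof -
    have "0 \<le> L2_inner (\<lambda>x. s * f x - t * g x) (\<lambda>x. s * f x - t * g x)"
      by (rule L2_inner_self_nonneg)
    also have "\<dots> = s\<^sup>2 * a - 2 * s * t * b + t\<^sup>2 * c"
      using assms L2_inner_commute[of g f]
      by (simp add: L2_inner_diff_left L2_inner_diff_right L2_cmult L2_diff a_b_c_def power2_eq_square algebra_simps)
    finally show ?thesis .
  qed
  have "b\<^sup>2 \<le> a * c"
  proof (cases "c = 0")
    case True
    have "b = 0"
    proof (rule ccontr)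
      assume "b \<noteq> 0"
      \<comment> \<open>With c = 0 the form is a - 2 t b, and this t makes it -1.\<close>
      with q[of 1 "(a + 1) / (2 * b)"] True show False by (simp add: field_simps)
    qed
    then show ?thesis using True by simp
  next
    case False
    then have "c > 0" using L2_inner_self_nonneg[of g] by (simp add: a_b_c_def)
    have "0 \<le> c * (a * c - b\<^sup>2)"
      \<comment> \<open>For s = c the form is minimal at t = b.\<close>
      using q[of c b] by (simp add: power2_eq_square algebra_simps)
    then show ?thesis using \<open>c > 0\<close> by (simp add: zero_le_mult_iff)
  qed
  then have "\<bar>b\<bar> \<le> sqrt (a * c)"
    by (metis real_sqrt_abs real_sqrt_le_iff)
  then show ?thesis
    by (simp add: L2_norm_def a_b_c_def real_sqrt_mult)
qed

lemma L2_norm_triangle: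
  assumes "L2 f" "L2 g"
  shows "L2_norm (\<lambda>x. f x + g x) \<le> L2_norm f + L2_norm g"
proof -
  have "(L2_norm (\<lambda>x. f x + g x))\<^sup>2 = (L2_norm f)\<^sup>2 + 2 * L2_inner f g + (L2_norm g)\<^sup>2"
    using assms L2_inner_commute[of g f]
    by (simp add: L2_norm_squared L2_inner_add_left L2_inner_add_right L2_add)
  also have "\<dots> \<le> (L2_norm f + L2_norm g)\<^sup>2"
    using L2_Cauchy_Schwarz[OF assms] by (simp add: power2_sum)
  finally show ?thesis
    by (rule power2_le_imp_le) simp
qed

lemma L2_norm_diff_triangle:
  assumes "L2 f" "L2 g" "L2 h"
  shows "L2_norm (\<lambda>x. f x - h x) \<le> L2_norm (\<lambda>x. f x - g x) + L2_norm (\<lambda>x. g x - h x)"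
  using L2_norm_triangle[of "\<lambda>x. f x - g x" "\<lambda>x. g x - h x"] assms by (simp add: L2_diff)

subsection \<open>Existence of an orthonormal basis\<close>

text \<open>A finite version of orthonormality, shared by the stages of Gram-Schmidt and by the
  finitely many cell functions, so that Bessel's inequality serves both.\<close>

definition orthonormal_upto :: "(nat \<Rightarrow> real ^ 'd \<Rightarrow> real) \<Rightarrow> nat \<Rightarrow> bool" where
  "orthonormal_upto e n \<longleftrightarrow> (\<forall>i<n. L2 (e i)) \<and>
     (\<forall>i<n. \<forall>j<n. L2_inner (e i) (e j) = (if i = j then 1 else 0))"

text \<open>The residual of the orthogonal projection onto the first \<open>n\<close> functions; the
  completeness clause of \<open>orthonormal_basis\<close> says that its norm tends to 0.\<close>

definition remainder :: "(nat \<Rightarrow> real ^ 'd \<Rightarrow> real) \<Rightarrow> nat \<Rightarrow> (real ^ 'd \<Rightarrow> real) \<Rightarrow> real ^ 'd \<Rightarrow> real" where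
  "remainder e n f x = f x - (\<Sum>i<n. L2_inner f (e i) * e i x)"

lemma remainder_cong: "(\<And>i. i < n \<Longrightarrow> e i = e' i) \<Longrightarrow> remainder e n f = remainder e' n f"
proof
  fix x
  assume "\<And>i. i < n \<Longrightarrow> e i = e' i"
  then have "(\<Sum>i<n. L2_inner f (e i) * e i x) = (\<Sum>i<n. L2_inner f (e' i) * e' i x)"
    by (intro sum.cong refl) simp
  then show "remainder e n f x = remainder e' n f x" by (simp add: remainder_def)
qed

lemma L2_remainder: "orthonormal_upto e n \<Longrightarrow> L2 f \<Longrightarrow> L2 (remainder e n f)"
  unfolding remainder_def[abs_def] orthonormal_upto_def by (intro L2_diff L2_sum L2_cmult) auto

lemma L2_inner_remainder_left:
  assumes "orthonormal_upto e n" "L2 f" "L2 g"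
  shows "L2_inner (remainder e n f) g = L2_inner f g - (\<Sum>i<n. L2_inner f (e i) * L2_inner (e i) g)"
proof -
  have e: "L2 (\<lambda>x. L2_inner f (e i) * e i x)" if "i \<in> {..<n}" for i
    using assms(1) that by (intro L2_cmult) (auto simp: orthonormal_upto_def)
  have "L2_inner (remainder e n f) g = L2_inner f g - L2_inner (\<lambda>x. \<Sum>i<n. L2_inner f (e i) * e i x) g"
    unfolding remainder_def[abs_def] using assms e by (intro L2_inner_diff_left L2_sum)
  also have "L2_inner (\<lambda>x. \<Sum>i<n. L2_inner f (e i) * e i x) g = (\<Sum>i<n. L2_inner f (e i) * L2_inner (e i) g)"
    using e assms(3) by (subst L2_inner_sum_left) auto
  finally show ?thesis .
qed

lemma remainder_orthogonal:
  assumes "orthonormal_upto e n" "L2 f" "j < n"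
  shows "L2_inner (remainder e n f) (e j) = 0"
proof -
  have "(\<Sum>i<n. L2_inner f (e i) * L2_inner (e i) (e j)) = (\<Sum>i<n. if i = j then L2_inner f (e j) else 0)"
    using assms by (intro sum.cong) (auto simp: orthonormal_upto_def)
  with assms show ?thesis
    by (subst L2_inner_remainder_left) (auto simp: orthonormal_upto_def)
qed

lemma L2_inner_remainder_self:
  assumes "orthonormal_upto e n" "L2 f"
  shows "L2_inner f (remainder e n f) = L2_inner f f - (\<Sum>i<n. (L2_inner f (e i))\<^sup>2)"
proof -
  have "L2_inner (remainder e n f) f = L2_inner f f - (\<Sum>i<n. (L2_inner f (e i))\<^sup>2)"
    unfolding L2_inner_remainder_left[OF assms assms(2)] power2_eq_square
    by (simp only: L2_inner_commute[of "e _" f])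
  then show ?thesis by (simp only: L2_inner_commute[of f "remainder e n f"])
qed

lemma L2_norm_remainder:
  assumes "orthonormal_upto e n" "L2 f"
  shows "(L2_norm (remainder e n f))\<^sup>2 = (L2_norm f)\<^sup>2 - (\<Sum>i<n. (L2_inner f (e i))\<^sup>2)"
proof -
  let ?r = "remainder e n f"
  have "L2_inner ?r ?r = L2_inner f ?r - (\<Sum>i<n. L2_inner f (e i) * L2_inner (e i) ?r)"
    using assms by (intro L2_inner_remainder_left L2_remainder)
  also have "(\<Sum>i<n. L2_inner f (e i) * L2_inner (e i) ?r) = 0"
    using remainder_orthogonal[OF assms] by (intro sum.neutral) (simp add: L2_inner_commute[of _ ?r])
  finally show ?thesis
    using L2_inner_remainder_self[OF assms] by (simp add: L2_norm_squared)
qed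

lemma Bessel_inequality:
  assumes "orthonormal_upto e n" "L2 f"
  shows "(\<Sum>i<n. (L2_inner f (e i))\<^sup>2) \<le> (L2_norm f)\<^sup>2"
  using L2_norm_remainder[OF assms] zero_le_power2[of "L2_norm (remainder e n f)"] by linarith

lemma L2_norm_remainder_le:
  assumes "orthonormal_upto e n" "L2 f"
  shows "L2_norm (remainder e n f) \<le> L2_norm f"
proof (rule power2_le_imp_le)
  show "(L2_norm (remainder e n f))\<^sup>2 \<le> (L2_norm f)\<^sup>2"
    using L2_norm_remainder[OF assms] sum_nonneg[of "{..<n}" "\<lambda>i. (L2_inner f (e i))\<^sup>2"] by simp
qed simp

lemma remainder_add:
  assumes "orthonormal_upto e n" "L2 f" "L2 g"
  shows "remainder e n (\<lambda>x. f x + g x) = (\<lambda>x. remainder e n f x + remainder e n g x)"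
  using assms by (auto simp: remainder_def fun_eq_iff L2_inner_add_left orthonormal_upto_def
      distrib_right sum.distrib)

lemma remainder_cmult: "remainder e n (\<lambda>x. c * f x) = (\<lambda>x. c * remainder e n f x)"
  by (simp add: remainder_def fun_eq_iff sum_distrib_left right_diff_distrib mult.assoc)

lemma L2_norm_remainder_add:
  assumes "orthonormal_upto e n" "L2 f" "L2 g"
  shows "L2_norm (remainder e n (\<lambda>x. f x + g x)) \<le> L2_norm (remainder e n f) + L2_norm (remainder e n g)"
  unfolding remainder_add[OF assms] using assms by (intro L2_norm_triangle L2_remainder)

lemma L2_norm_remainder_sum_eq_0:
  fixes m :: nat
  assumes "orthonormal_upto e n" "\<And>i. i < m \<Longrightarrow> L2 (G i) \<and> L2_norm (remainder e n (G i)) = 0"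
  shows "L2_norm (remainder e n (\<lambda>x. \<Sum>i<m. c i * G i x)) = 0"
  using assms(2)
proof (induct m)
  case 0
  have "remainder e n (\<lambda>x. 0) = (\<lambda>x. 0)" by (simp add: remainder_def fun_eq_iff)
  then show ?case by (simp add: L2_norm_def)
next
  case (Suc m)
    have "L2_norm (remainder e n (\<lambda>x. \<Sum>i<Suc m. c i * G i x))
      \<le> L2_norm (remainder e n (\<lambda>x. \<Sum>i<m. c i * G i x)) + L2_norm (remainder e n (\<lambda>x. c m * G m x))"
    using Suc(2) by (simp, intro L2_norm_remainder_add assms(1) L2_sum L2_cmult) auto
  also have "\<dots> = 0"
    using Suc by (simp add: remainder_cmult L2_norm_cmult)
  finally show ?case by (meson L2_norm_nonneg antisym)
qed

section \<open>Separability of L2: the closed span of countably many indicators\<close>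

text \<open>Membership in the closed linear span of \<open>G\<close>, up to null sets.\<close>

definition approximable :: "(nat \<Rightarrow> real ^ 'd \<Rightarrow> real) \<Rightarrow> (real ^ 'd \<Rightarrow> real) \<Rightarrow> bool" where
  "approximable G f \<longleftrightarrow> (\<forall>\<epsilon>>0. \<exists>n c. L2_norm (\<lambda>x. f x - (\<Sum>i<n. c i * G i x)) < \<epsilon>)"

lemma approximable_generator: "approximable G (G j)"
proof -
  have "L2_norm (\<lambda>x. G j x - (\<Sum>i<Suc j. (if i = j then 1 else 0) * G i x)) = 0"
    by (simp add: L2_norm_def)
  then show ?thesis unfolding approximable_def
    by (intro allI impI exI[of _ "Suc j"] exI[of _ "\<lambda>i. if i = j then 1 else 0"]) simp
qed

lemma approximable_add:
  assumes G: "\<And>i. L2 (G i)" and f: "L2 f" "approximable G f" and g: "L2 g" "approximable G g"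
  shows "approximable G (\<lambda>x. f x + g x)"
  unfolding approximable_def
proof (intro allI impI)
  fix \<epsilon> :: real assume "\<epsilon> > 0"
  then obtain n c m c' where
    n: "L2_norm (\<lambda>x. f x - (\<Sum>i<n. c i * G i x)) < \<epsilon> / 2" and
    m: "L2_norm (\<lambda>x. g x - (\<Sum>i<m. c' i * G i x)) < \<epsilon> / 2"
    using f g half_gt_zero unfolding approximable_def by blast
  \<comment> \<open>The two combinations may differ in length; both are padded with zeros to
    \<open>max n m\<close> terms.\<close>
  define b where "b i = (if i < n then c i else 0) + (if i < m then c' i else 0)" for i
  have ext: "(\<Sum>i<k. a i * G i x) = (\<Sum>i<max n m. (if i < k then a i else 0) * G i x)"
    if "k \<le> max n m" for k x and a :: "nat \<Rightarrow> real"
    using that by (intro sum.mono_neutral_cong_left) auto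
  have "(\<Sum>i<max n m. b i * G i x) = (\<Sum>i<n. c i * G i x) + (\<Sum>i<m. c' i * G i x)" for x
    unfolding ext[of n c x, OF max.cobounded1] ext[of m c' x, OF max.cobounded2]
    by (simp add: b_def distrib_right sum.distrib)
  then have "L2_norm (\<lambda>x. f x + g x - (\<Sum>i<max n m. b i * G i x))
     = L2_norm (\<lambda>x. (f x - (\<Sum>i<n. c i * G i x)) + (g x - (\<Sum>i<m. c' i * G i x)))"
    by (intro L2_norm_cong) simp
  also have "\<dots> \<le> L2_norm (\<lambda>x. f x - (\<Sum>i<n. c i * G i x)) + L2_norm (\<lambda>x. g x - (\<Sum>i<m. c' i * G i x))"
    using G f g by (intro L2_norm_triangle L2_diff L2_sum L2_cmult)
  also have "\<dots> < \<epsilon>" using n m by simp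
  finally show "\<exists>n c. L2_norm (\<lambda>x. f x + g x - (\<Sum>i<n. c i * G i x)) < \<epsilon>" by blast
qed

lemma approximable_cmult:
  assumes "approximable G f"
  shows "approximable G (\<lambda>x. a * f x)"
  unfolding approximable_def
proof (intro allI impI)
  fix \<epsilon> :: real assume \<epsilon>: "\<epsilon> > 0"
  \<comment> \<open>The summand 1 in the denominator covers \<open>a = 0\<close>.\<close>
  then have "\<epsilon> / (\<bar>a\<bar> + 1) > 0" by simp
  then obtain n c where n: "L2_norm (\<lambda>x. f x - (\<Sum>i<n. c i * G i x)) < \<epsilon> / (\<bar>a\<bar> + 1)"
    using assms unfolding approximable_def by blast
  have "L2_norm (\<lambda>x. a * f x - (\<Sum>i<n. (a * c i) * G i x)) = \<bar>a\<bar> * L2_norm (\<lambda>x. f x - (\<Sum>i<n. c i * G i x))"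
    by (subst L2_norm_cmult[symmetric]) (simp add: right_diff_distrib sum_distrib_left mult.assoc)
  also have "\<dots> \<le> (\<bar>a\<bar> + 1) * L2_norm (\<lambda>x. f x - (\<Sum>i<n. c i * G i x))"
    by (intro mult_right_mono) auto
  also have "\<dots> < \<epsilon>" using n by (simp add: field_simps)
  finally show "\<exists>n c. L2_norm (\<lambda>x. a * f x - (\<Sum>i<n. c i * G i x)) < \<epsilon>"
    by (intro exI[of _ n] exI[of _ "\<lambda>i. a * c i"]) (simp add: mult.assoc)
qed

lemma approximable_limit:
  assumes G: "\<And>i. L2 (G i)" and f: "L2 f"
    and h: "\<And>i. L2 (h i)" "\<And>i. approximable G (h i)"
    and lim: "(\<lambda>i. L2_norm (\<lambda>x. f x - h i x)) \<longlonglongrightarrow> 0"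
  shows "approximable G f"
  unfolding approximable_def
proof (intro allI impI)
  fix \<epsilon> :: real assume \<epsilon>: "\<epsilon> > 0"
  then obtain i where i: "L2_norm (\<lambda>x. f x - h i x) < \<epsilon> / 2"
    using LIMSEQ_D[OF lim, of "\<epsilon> / 2"] by auto
  obtain n c where n: "L2_norm (\<lambda>x. h i x - (\<Sum>i<n. c i * G i x)) < \<epsilon> / 2"
    using h(2)[of i] half_gt_zero[OF \<epsilon>] unfolding approximable_def by blast
  have "L2_norm (\<lambda>x. f x - (\<Sum>i<n. c i * G i x))
      \<le> L2_norm (\<lambda>x. f x - h i x) + L2_norm (\<lambda>x. h i x - (\<Sum>i<n. c i * G i x))"
    using G f h by (intro L2_norm_diff_triangle L2_sum L2_cmult)
  then show "\<exists>n c. L2_norm (\<lambda>x. f x - (\<Sum>i<n. c i * G i x)) < \<epsilon>"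
    using i n by (intro exI[of _ n] exI[of _ c]) simp
qed

lemma L2_norm_dominated_convergence:
  fixes f :: "real ^ 'd \<Rightarrow> real"
  assumes w: "L2 w" and f: "f \<in> borel_measurable cube_measure"
    and h: "\<And>i. h i \<in> borel_measurable cube_measure"
    and bound: "\<And>i x. x \<in> cube \<Longrightarrow> \<bar>f x - h i x\<bar> \<le> w x"
    and lim: "\<And>x. x \<in> cube \<Longrightarrow> (\<lambda>i. h i x) \<longlonglongrightarrow> f x"
  shows "(\<lambda>i. L2_norm (\<lambda>x. f x - h i x)) \<longlonglongrightarrow> 0"
proof -
  have "(\<lambda>i. LINT x|cube_measure. (f x - h i x) * (f x - h i x)) \<longlonglongrightarrow> (LINT x|(cube_measure :: (real ^ 'd) measure). 0)"
  proof (rule integral_dominated_convergence[where w = "\<lambda>x. (w x)\<^sup>2"])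
    show "integrable cube_measure (\<lambda>x. (w x)\<^sup>2)" using w by (simp add: L2_def)
    show "AE x in cube_measure. (\<lambda>i. (f x - h i x) * (f x - h i x)) \<longlonglongrightarrow> 0"
    proof (rule AE_I2)
      fix x :: "real ^ 'd" assume "x \<in> space cube_measure"
      then have "(\<lambda>i. f x - h i x) \<longlonglongrightarrow> f x - f x" using lim by (intro tendsto_intros) simp
      from tendsto_mult[OF this this] show "(\<lambda>i. (f x - h i x) * (f x - h i x)) \<longlonglongrightarrow> 0" by simp
    qed
    show "AE x in cube_measure. norm ((f x - h i x) * (f x - h i x)) \<le> (w x)\<^sup>2" for i
    proof (rule AE_I2)
      fix x :: "real ^ 'd" assume "x \<in> space cube_measure"
      then have "\<bar>f x - h i x\<bar> \<le> w x" using bound by simp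
      then show "norm ((f x - h i x) * (f x - h i x)) \<le> (w x)\<^sup>2"
        using abs_le_square_iff[of "f x - h i x" "w x"] by (simp add: power2_eq_square)
    qed
  qed (use f h in auto)
  then have "(\<lambda>i. sqrt (L2_inner (\<lambda>x. f x - h i x) (\<lambda>x. f x - h i x))) \<longlonglongrightarrow> sqrt 0"
    unfolding L2_inner_def by (intro tendsto_real_sqrt) simp
  then show ?thesis by (simp add: L2_norm_def)
qed

text \<open>A countable base closed under finite intersections: countability yields a sequence of
  generators of L2, stability under intersection permits a Dynkin argument, and \<open>UNIV\<close>,
  the empty intersection, provides the complements there.\<close>

lemma borel_countable_Int_stable_generator:
  obtains S :: "nat \<Rightarrow> ('a :: second_countable_topology) set"
  where "Int_stable (range S)" "sets borel = sigma_sets UNIV (range S)" "UNIV \<in> range S"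
    "\<And>i. S i \<in> sets borel"
proof -
  obtain B :: "'a set set" where B: "countable B" "topological_basis B"
    using ex_countable_basis by blast
  define F where "F = Inter ` {A. finite A \<and> A \<subseteq> B}"
  have F: "countable F"
    unfolding F_def using B by (intro countable_image countable_Collect_finite_subset)
  have UNIV: "UNIV \<in> F" unfolding F_def by (auto intro!: image_eqI[of _ _ "{}"])
  have op: "open b" if "b \<in> F" for b
    using that B(2) by (auto simp: F_def topological_basis_open subset_iff intro!: open_Inter)
  have BF: "B \<subseteq> F"
  proof
    fix b assume "b \<in> B" then show "b \<in> F" by (auto simp: F_def intro!: image_eqI[of _ _ "{b}"])
  qed
  have "topological_basis F"
    unfolding topological_basis_def
  proof (intro conjI allI impI ballI)
    fix U :: "'a set" assume "open U"
    then obtain B' where "B' \<subseteq> B" "\<Union>B' = U" using B(2) unfolding topological_basis_def by blast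
    then show "\<exists>B'\<subseteq>F. \<Union>B' = U" using BF by blast
  qed (rule op)
  with F have borel: "sets (borel :: 'a measure) = sigma_sets UNIV F"
    by (subst borel_eq_countable_basis) auto
  have ran: "range (from_nat_into F) = F"
    using UNIV F by (intro range_from_nat_into) auto
  have "Int_stable F"
  proof (rule Int_stableI)
    fix a b assume "a \<in> F" "b \<in> F"
    then obtain A A' where A: "finite A" "A \<subseteq> B" "a = \<Inter>A" "finite A'" "A' \<subseteq> B" "b = \<Inter>A'"
      by (auto simp: F_def)
    then show "a \<inter> b \<in> F" by (auto simp: F_def intro!: image_eqI[of _ _ "A \<union> A'"])
  qed
  with that[of "from_nat_into F"] borel ran UNIV op show ?thesis
    by (metis borel_open rangeI)
qed

lemma L2_indicator: "A \<in> sets borel \<Longrightarrow> L2 (indicator A :: real ^ 'd \<Rightarrow> real)"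
  by (rule L2_bounded[where C = 1]) (auto simp: indicator_def)

text \<open>The sets whose indicator lies in the closed span form a Dynkin system: complements
  subtract from the generator \<open>UNIV\<close>, and countable disjoint unions are L2 limits of
  partial sums by dominated convergence.\<close>

lemma approximable_indicator:
  fixes S :: "nat \<Rightarrow> (real ^ 'd) set"
  assumes S: "Int_stable (range S)" "sets borel = sigma_sets UNIV (range S)" "UNIV \<in> range S"
    and A: "A \<in> sets borel"
  shows "approximable (\<lambda>i. indicator (S i)) (indicator A)"
proof -
  let ?G = "\<lambda>i. indicator (S i) :: real ^ 'd \<Rightarrow> real"
  have SB: "S i \<in> sets borel" for i unfolding S(2) by (rule sigma_sets.Basic) simp
  note GL = L2_indicator[OF SB]
  have A': "A \<in> sigma_sets UNIV (range S)" using A S(2) by simp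
  have "range S \<subseteq> Pow UNIV" by simp
  from S(1) this A' show ?thesis
  proof (induction rule: sigma_sets_induct_disjoint)
    case (basic A)
    then obtain i where "A = S i" by auto
    then show ?case using approximable_generator[of ?G i] by simp
  next
    case empty
    show ?case using approximable_cmult[OF approximable_generator, of ?G 0 0] by simp
  next
    case (compl A)
    obtain j where j: "S j = UNIV" using S(3) by (metis imageE)
    have AB: "A \<in> sets borel" using compl S(2) by simp
    have "approximable ?G (\<lambda>x. ?G j x + - 1 * indicator A x)"
      using compl GL AB SB by (intro approximable_add approximable_cmult approximable_generator L2_cmult L2_indicator)
    also have "(\<lambda>x. ?G j x + - 1 * indicator A x) = indicator (UNIV - A)"
      by (auto simp: j fun_eq_iff indicator_def)
    finally show ?case .
  next
    case (union A)
    have AB: "A i \<in> sets borel" for i using union(2) S(2) by auto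
    have UB: "(\<Union>i. A i) \<in> sets borel" using AB by auto
    define h where "h n x = (\<Sum>i<n. indicator (A i) x :: real)" for n x
    have h: "h n x = indicator (\<Union>i<n. A i) x" for n x
      unfolding h_def using union(1) by (subst indicator_UN_disjoint)
        (auto simp: disjoint_family_on_def)
    have hL: "L2 (h n)" for n unfolding h_def by (intro L2_sum L2_indicator AB)
    have "approximable ?G (h n)" for n
    proof (induction n)
      case 0
      show ?case using approximable_cmult[OF approximable_generator, of ?G 0 0] by (simp add: h_def[abs_def])
    next
      case (Suc n)
      have "approximable ?G (\<lambda>x. h n x + indicator (A n) x)"
        using GL hL AB SB union(3) Suc by (intro approximable_add L2_indicator)
      then show ?case by (simp add: h_def[abs_def])
    qed
    moreover have "(\<lambda>n. L2_norm (\<lambda>x. indicator (\<Union>i. A i) x - h n x)) \<longlonglongrightarrow> 0"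
    proof (rule L2_norm_dominated_convergence)
      show "L2 (indicator UNIV :: real ^ 'd \<Rightarrow> real)" by (rule L2_indicator) simp
      show "indicator (\<Union>i. A i) \<in> borel_measurable cube_measure" using UB by measurable
      show "h i \<in> borel_measurable cube_measure" for i using hL by (rule L2_borel_measurable)
      show "\<bar>indicator (\<Union>i. A i) x - h i x\<bar> \<le> indicator UNIV x" for i x
        by (auto simp: h indicator_def)
      show "(\<lambda>n. h n x) \<longlonglongrightarrow> indicator (\<Union>i. A i) x" for x
        unfolding h by (rule LIMSEQ_indicator_UN)
    qed
    ultimately show ?case
      using approximable_limit[of ?G "indicator (\<Union>i. A i)" h] GL L2_indicator[OF UB] hL by blast
  qed
qed

text \<open>From indicators to nonnegative functions by monotone approximation, then to differences
  of positive and negative parts.\<close>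

lemma L2_dense_sequence:
  obtains G :: "nat \<Rightarrow> real ^ 'd \<Rightarrow> real"
  where "\<And>i. L2 (G i)" "\<And>f. L2 f \<Longrightarrow> approximable G f"
proof -
  obtain S :: "nat \<Rightarrow> (real ^ 'd) set" where
    S: "Int_stable (range S)" "sets borel = sigma_sets UNIV (range S)" "UNIV \<in> range S" "\<And>i. S i \<in> sets borel"
    using borel_countable_Int_stable_generator by blast
  define G where "G i = (indicator (S i) :: real ^ 'd \<Rightarrow> real)" for i
  have GL: "L2 (G i)" for i unfolding G_def by (rule L2_indicator) (rule S)
  \<comment> \<open>Square integrability stays inside the induction formula: the induction supplies
    measurable functions only, and each piece inherits it by being dominated by the whole.\<close>
  have nonneg: "L2 f \<longrightarrow> approximable G f" if "f \<in> borel_measurable cube_measure" "\<And>x. 0 \<le> f x" for f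
    using that
  proof (induction rule: borel_measurable_induct_real)
    case (set A)
    then obtain A' where A': "A' \<in> sets borel" "A = cube \<inter> A'"
      by (auto simp: sets_cube_measure sets_restrict_space)
    have "approximable G (indicator A')"
      unfolding G_def[abs_def] using S A' by (intro approximable_indicator) auto
    \<comment> \<open>A measurable subset of the cube is the trace of a Borel set of the whole
      space; L2 norms do not see the difference.\<close>
    moreover have "L2_norm (\<lambda>x. indicator A' x - g x) = L2_norm (\<lambda>x. indicator A x - g x)" for g
      using A' by (intro L2_norm_cong) (auto simp: indicator_def)
    ultimately show ?case by (simp add: approximable_def)
  next
    case (mult u c)
    show ?case
    proof
      assume L: "L2 (\<lambda>x. c * u x)"
      show "approximable G (\<lambda>x. c * u x)"
      proof (cases "c = 0")
        case True
        then show ?thesis using approximable_cmult[OF approximable_generator, of G 0 0] by simp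
      next
        case False
        then have "L2 u" using L2_cmult[OF L, of "1 / c"] by simp
        then show ?thesis using mult by (intro approximable_cmult) simp
      qed
    qed
  next
    case (add u v)
    show ?case
    proof
      assume L: "L2 (\<lambda>x. v x + u x)"
      have int: "integrable cube_measure (\<lambda>x. (v x + u x)\<^sup>2)" using L by (simp add: L2_def)
      have "L2 u" "L2 v"
        unfolding L2_def using add
        by (auto intro!: Bochner_Integration.integrable_bound[OF int] power_mono AE_I2)
      then show "approximable G (\<lambda>x. v x + u x)" using add GL by (intro approximable_add) auto
    qed
  next
    case (seq U)
    show ?case
    proof
      assume f: "L2 f"
      have le: "U i x \<le> f x" if "x \<in> cube" for i x
        using seq(3,4) that by (intro incseq_le[of "\<lambda>i. U i x"]) (auto simp: mono_def le_fun_def)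
      have int: "integrable cube_measure (\<lambda>x. (f x)\<^sup>2)" using f by (simp add: L2_def)
      have UL: "L2 (U i)" for i
        unfolding L2_def using seq le
        by (auto intro!: Bochner_Integration.integrable_bound[OF int] AE_I2 power_mono)
      have "(\<lambda>i. L2_norm (\<lambda>x. f x - U i x)) \<longlonglongrightarrow> 0"
      proof (rule L2_norm_dominated_convergence[OF f])
        show "f \<in> borel_measurable cube_measure" using f by (rule L2_borel_measurable)
        show "\<bar>f x - U i x\<bar> \<le> f x" if "x \<in> cube" for i x
          using le[OF that, of i] seq(2)[of i x] by simp
      qed (use seq in auto)
      with f GL UL seq(5) show "approximable G f"
        by (intro approximable_limit[of G f U]) auto
    qed
  qed
  have "approximable G f" if f: "L2 f" for f
  proof -
    have m[measurable]: "f \<in> borel_measurable cube_measure" using f by (rule L2_borel_measurable)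
    have int: "integrable cube_measure (\<lambda>x. (f x)\<^sup>2)" using f by (simp add: L2_def)
    have pL: "L2 (\<lambda>x. max 0 (f x))" "L2 (\<lambda>x. max 0 (- f x))"
      unfolding L2_def
      by (auto intro!: Bochner_Integration.integrable_bound[OF int] AE_I2 simp: max_def)
    have "approximable G (\<lambda>x. max 0 (f x) + - 1 * max 0 (- f x))"
      using nonneg[of "\<lambda>x. max 0 (f x)"] nonneg[of "\<lambda>x. max 0 (- f x)"] pL GL
      by (intro approximable_add approximable_cmult L2_cmult) auto
    also have "(\<lambda>x. max 0 (f x) + - 1 * max 0 (- f x)) = f" by (auto simp: max_def)
    finally show ?thesis .
  qed
  with GL that show ?thesis by blast
qed

lemma remainder_Suc_eq_0:
  assumes "orthonormal_upto e (Suc n)" "L2 f" "L2_norm (remainder e n f) = 0"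
  shows "L2_norm (remainder e (Suc n) f) = 0"
proof -
  have n: "orthonormal_upto e n" using assms(1) by (auto simp: orthonormal_upto_def)
  have "(L2_norm (remainder e (Suc n) f))\<^sup>2 \<le> (L2_norm (remainder e n f))\<^sup>2"
    by (simp add: L2_norm_remainder[OF assms(1,2)] L2_norm_remainder[OF n assms(2)])
  then show ?thesis using assms(3) by simp
qed

lemma L2_norm_remainder_eq_0_dense:
  assumes e: "orthonormal_upto e n" and G: "\<And>i. L2 (G i)" "\<And>i. L2_norm (remainder e n (G i)) = 0"
    and f: "L2 f" "approximable G f"
  shows "L2_norm (remainder e n f) = 0"
proof -
  have "L2_norm (remainder e n f) < \<epsilon>" if "\<epsilon> > 0" for \<epsilon>
  proof -
    obtain m c where m: "L2_norm (\<lambda>x. f x - (\<Sum>i<m. c i * G i x)) < \<epsilon>"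
      using f(2) \<open>\<epsilon> > 0\<close> unfolding approximable_def by blast
    let ?g = "\<lambda>x. \<Sum>i<m. c i * G i x"
    have gL: "L2 ?g" by (intro L2_sum L2_cmult G)
    have "L2_norm (remainder e n f) = L2_norm (remainder e n (\<lambda>x. (f x - ?g x) + ?g x))" by simp
    also have "\<dots> \<le> L2_norm (remainder e n (\<lambda>x. f x - ?g x)) + L2_norm (remainder e n ?g)"
      using e f gL by (intro L2_norm_remainder_add L2_diff)
    also have "L2_norm (remainder e n ?g) = 0"
      using e G by (intro L2_norm_remainder_sum_eq_0) auto
    also have "L2_norm (remainder e n (\<lambda>x. f x - ?g x)) + 0 \<le> L2_norm (\<lambda>x. f x - ?g x)"
      using L2_norm_remainder_le[OF e L2_diff[OF f(1) gL]] by simp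
    finally show ?thesis using m by simp
  qed
  then have "\<not> 0 < L2_norm (remainder e n f)" by (meson less_irrefl)
  then show ?thesis using L2_norm_nonneg[of "remainder e n f"] by linarith
qed

text \<open>
  Gram--Schmidt along a dense sequence, skipping the members that already lie in the span; the
  orthonormal systems of every size guarantee that a next member always exists.
\<close>

lemma ex_orthonormal_basis_if_infinite_dim:
  assumes inf: "\<And>m. \<exists>\<phi> :: nat \<Rightarrow> real ^ 'd \<Rightarrow> real. orthonormal_upto \<phi> m"
  shows "\<exists>e :: nat \<Rightarrow> real ^ 'd \<Rightarrow> real. orthonormal_basis e"
proof -
  obtain G :: "nat \<Rightarrow> real ^ 'd \<Rightarrow> real"
    where G: "\<And>i. L2 (G i)" and dense: "\<And>f. L2 f \<Longrightarrow> approximable G f"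
    using L2_dense_sequence by blast
  \<comment> \<open>\<open>g\<close> is the normalised residual of the first generator that is not
    yet in the span of \<open>e 0\<close>, ..., \<open>e (n - 1)\<close>.\<close>
  define P where "P e n g \<longleftrightarrow> (\<exists>k. L2_norm (remainder e n (G k)) \<noteq> 0 \<and>
      (\<forall>j<k. L2_norm (remainder e n (G j)) = 0) \<and>
      g = (\<lambda>x. 1 / L2_norm (remainder e n (G k)) * remainder e n (G k) x))"
    for e :: "nat \<Rightarrow> real ^ 'd \<Rightarrow> real" and n g
  have new: "L2 g" "L2_inner g g = 1" "\<And>i. i < n \<Longrightarrow> L2_inner g (e i) = 0"
    if on: "orthonormal_upto e n" and P: "P e n g" for e n g
  proof -
    obtain k where k: "L2_norm (remainder e n (G k)) \<noteq> 0"
      "g = (\<lambda>x. 1 / L2_norm (remainder e n (G k)) * remainder e n (G k) x)"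
      using P unfolding P_def by blast
    show "L2 g" unfolding k(2) by (intro L2_cmult L2_remainder on G)
    show "L2_inner g g = 1"
      unfolding k(2) L2_inner_cmult_left L2_inner_cmult_right L2_norm_squared[symmetric]
      using k(1) by (simp add: power2_eq_square)
    show "L2_inner g (e i) = 0" if "i < n" for i
      unfolding k(2) L2_inner_cmult_left using remainder_orthogonal[OF on G that] by simp
  qed
  have step: "orthonormal_upto e (Suc n)" if "orthonormal_upto e n" "P e n (e n)" for e n
  proof -
    have "L2_inner (e i) (e n) = 0" if "i < n" for i
      using new(3)[OF \<open>orthonormal_upto e n\<close> \<open>P e n (e n)\<close> that] by (subst L2_inner_commute)
    then show ?thesis
      using new[OF that] that(1) by (auto simp: orthonormal_upto_def less_Suc_eq)
  qed
  have upto: "orthonormal_upto e n" if "\<And>y. y < n \<Longrightarrow> P e y (e y)" for e n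
    using that
  proof (induct n)
    case (Suc n)
    then show ?case by (intro step) simp_all
  qed (simp add: orthonormal_upto_def)
  have "\<exists>e. \<forall>n. P e n (e n)"
  \<comment> \<open>Recursion on the stage: \<open>P e n\<close> looks at \<open>e\<close> only
    below \<open>n\<close>, because the remainder does.\<close>
  proof (rule dependent_wellorder_choice)
    fix r :: "real ^ 'd \<Rightarrow> real" and e e' :: "nat \<Rightarrow> real ^ 'd \<Rightarrow> real" and n
    assume "\<And>y. y < n \<Longrightarrow> e y = e' y"
    then have "remainder e n f = remainder e' n f" for f by (rule remainder_cong)
    then show "P e n r = P e' n r" by (simp add: P_def)
  next
    fix n and e :: "nat \<Rightarrow> real ^ 'd \<Rightarrow> real"
    assume "\<And>y. y < n \<Longrightarrow> P e y (e y)"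
    then have e: "orthonormal_upto e n" by (rule upto)
    have "\<exists>k. L2_norm (remainder e n (G k)) \<noteq> 0"
    proof (rule ccontr)
      assume "\<nexists>k. L2_norm (remainder e n (G k)) \<noteq> 0"
      then have z: "L2_norm (remainder e n f) = 0" if "L2 f" for f
        using L2_norm_remainder_eq_0_dense[OF e G _ that dense[OF that]] by blast
      \<comment> \<open>Dimension count: if the n functions captured all of L2, the squared norms of
        n + 1 orthonormal functions would be sums of squared coefficients against them, and Bessel
        would bound the total by n.\<close>
      obtain \<phi> :: "nat \<Rightarrow> real ^ 'd \<Rightarrow> real" where \<phi>: "orthonormal_upto \<phi> (Suc n)" using inf by blast
      have "real (Suc n) = (\<Sum>i<Suc n. (L2_norm (\<phi> i))\<^sup>2)"
        using \<phi> by (simp add: L2_norm_squared orthonormal_upto_def)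
      also have "\<dots> = (\<Sum>i<Suc n. \<Sum>l<n. (L2_inner (\<phi> i) (e l))\<^sup>2)"
      proof (intro sum.cong refl)
        fix i assume "i \<in> {..<Suc n}"
        then have "L2 (\<phi> i)" using \<phi> by (auto simp: orthonormal_upto_def)
        from L2_norm_remainder[OF e this] z[OF this]
        show "(L2_norm (\<phi> i))\<^sup>2 = (\<Sum>l<n. (L2_inner (\<phi> i) (e l))\<^sup>2)" by simp
      qed
      also have "\<dots> = (\<Sum>l<n. \<Sum>i<Suc n. (L2_inner (e l) (\<phi> i))\<^sup>2)"
        by (subst sum.swap) (simp only: L2_inner_commute)
      also have "\<dots> \<le> (\<Sum>l<n. (L2_norm (e l))\<^sup>2)"
        using e by (intro sum_mono Bessel_inequality \<phi>) (auto simp: orthonormal_upto_def)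
      also have "\<dots> = real n" using e by (simp add: L2_norm_squared orthonormal_upto_def)
      finally show False by simp
    qed
    then obtain k where "L2_norm (remainder e n (G k)) \<noteq> 0" "\<forall>j<k. L2_norm (remainder e n (G j)) = 0"
      using exists_least_iff[of "\<lambda>k. L2_norm (remainder e n (G k)) \<noteq> 0"] by blast
    then show "\<exists>r. P e n r" unfolding P_def by blast
  qed
  then obtain e where e: "\<And>n. P e n (e n)" by blast
  have on: "orthonormal_upto e n" for n using e by (rule upto)
  \<comment> \<open>After \<open>n\<close> stages the first \<open>n\<close> generators are
    exhausted; this turns density of the span of \<open>G\<close> into completeness of
    \<open>e\<close>.\<close>
  have zero: "L2_norm (remainder e n (G j)) = 0" if "j < n" for j n
    using that
  proof (induct n arbitrary: j)
    case (Suc n)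
    obtain k where k: "L2_norm (remainder e n (G k)) \<noteq> 0" "\<And>j. j < k \<Longrightarrow> L2_norm (remainder e n (G j)) = 0"
      "e n = (\<lambda>x. 1 / L2_norm (remainder e n (G k)) * remainder e n (G k) x)"
      using e[of n] unfolding P_def by blast
    have "k \<ge> n" using Suc(1) k(1) by (meson not_le_imp_less)
    show ?case
    proof (cases "j < n \<or> j < k")
      case True
      then show ?thesis using Suc(1) k(2) on G by (intro remainder_Suc_eq_0) auto
    next
      \<comment> \<open>What remains is the generator \<open>G n\<close> itself, the one chosen at
        stage \<open>n\<close>, so its residual is removed by \<open>e n\<close>.\<close>
      case False
      then have jk: "j = n" "k = n" using Suc(2) \<open>k \<ge> n\<close> by auto
      let ?r = "remainder e n (G n)"
      have "L2_inner (G n) ?r = L2_inner ?r ?r"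
        using L2_inner_remainder_self[OF on G, of n n] L2_norm_remainder[OF on G, of n n]
        by (simp add: L2_norm_squared)
      then have "L2_inner (G n) (e n) = L2_norm ?r"
        using k(1) unfolding k(3) jk L2_inner_cmult_right
        by (simp add: L2_norm_squared[symmetric] power2_eq_square)
      then have "(L2_norm (remainder e (Suc n) (G n)))\<^sup>2 = 0"
        using L2_norm_remainder[OF on G, of "Suc n" n] L2_norm_remainder[OF on G, of n n] by simp
      then show ?thesis using jk by simp
    qed
  qed simp
  have "(\<lambda>n. L2_norm (remainder e n f)) \<longlonglongrightarrow> 0" if f: "L2 f" for f
  proof (rule LIMSEQ_I)
    fix \<epsilon> :: real assume "\<epsilon> > 0"
    then obtain m c where m: "L2_norm (\<lambda>x. f x - (\<Sum>i<m. c i * G i x)) < \<epsilon>"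
      using dense[OF f] unfolding approximable_def by blast
    let ?g = "\<lambda>x. \<Sum>i<m. c i * G i x"
    have gL: "L2 ?g" by (intro L2_sum L2_cmult G)
    have "L2_norm (remainder e n f) < \<epsilon>" if "n \<ge> m" for n
    proof -
      have "L2_norm (remainder e n f) = L2_norm (remainder e n (\<lambda>x. (f x - ?g x) + ?g x))" by simp
      also have "\<dots> \<le> L2_norm (remainder e n (\<lambda>x. f x - ?g x)) + L2_norm (remainder e n ?g)"
        using on f gL by (intro L2_norm_remainder_add L2_diff)
      also have "L2_norm (remainder e n ?g) = 0"
        using on G zero \<open>n \<ge> m\<close> by (intro L2_norm_remainder_sum_eq_0) auto
      also have "L2_norm (remainder e n (\<lambda>x. f x - ?g x)) + 0 \<le> L2_norm (\<lambda>x. f x - ?g x)"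
        using L2_norm_remainder_le[OF on L2_diff[OF f gL], of n] by simp
      finally show ?thesis using m by simp
    qed
    then show "\<exists>no. \<forall>n\<ge>no. norm (L2_norm (remainder e n f) - 0) < \<epsilon>" by auto
  qed
  moreover have "L2 (e i)" "L2_inner (e i) (e j) = (if i = j then 1 else 0)" for i j
    using on[of "Suc (max i j)"] by (auto simp: orthonormal_upto_def)
  ultimately have "orthonormal_basis e"
    unfolding orthonormal_basis_def remainder_def[abs_def] by blast
  then show ?thesis by blast
qed

section \<open>Disjoint cells of equal volume and a grid realising them\<close>

text \<open>Equal volumes make the indicators divided by \<open>sqrt v\<close> orthonormal, so a
  kernel that is constant on products of cells acts on coordinates as its matrix.\<close>

locale cell_family =
  fixes B :: "nat \<Rightarrow> (real ^ 'd) set" and n :: nat and v :: real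
  assumes v_pos: "0 < v"
    and cell_borel: "i < n \<Longrightarrow> B i \<in> sets borel"
    and cell_subset: "i < n \<Longrightarrow> B i \<subseteq> cube"
    and cell_disjoint: "i < n \<Longrightarrow> j < n \<Longrightarrow> i \<noteq> j \<Longrightarrow> B i \<inter> B j = {}"
    and cell_volume: "i < n \<Longrightarrow> emeasure lborel (B i) = ennreal v"
begin

definition cell_fun :: "nat \<Rightarrow> real ^ 'd \<Rightarrow> real" where
  "cell_fun i x = indicator (B i) x / sqrt v"

lemma cell_fun_measurable: "i < n \<Longrightarrow> cell_fun i \<in> borel_measurable borel"
  unfolding cell_fun_def[abs_def] using cell_borel by measurable

lemma L2_cell_fun: "i < n \<Longrightarrow> L2 (cell_fun i)"
  unfolding cell_fun_def[abs_def] divide_inverse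
  using L2_cmult[OF L2_indicator[OF cell_borel], of i "inverse (sqrt v)"] by (simp add: mult.commute)

lemma cell_fun_mult:
  "i < n \<Longrightarrow> j < n \<Longrightarrow> cell_fun i x * cell_fun j x = (if i = j then indicator (B i) x / v else 0)"
  using v_pos cell_disjoint[of i j] by (auto simp: cell_fun_def indicator_def)

lemma measure_cell: "i < n \<Longrightarrow> measure cube_measure (B i) = v"
  using emeasure_cube_measure[OF cell_borel cell_subset] cell_volume[of i] v_pos
  by (simp add: measure_def)

lemma cell_sets: "i < n \<Longrightarrow> B i \<in> sets cube_measure"
  using cell_borel[of i] cell_subset[of i] by (auto simp: sets_cube_measure sets_restrict_space)

lemma L2_inner_cell_fun: "i < n \<Longrightarrow> j < n \<Longrightarrow> L2_inner (cell_fun i) (cell_fun j) = (if i = j then 1 else 0)"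
  using v_pos cell_sets[of i] measure_cell[of i] cell_subset[of i]
  unfolding L2_inner_def by (auto simp: cell_fun_mult Int_absorb2)

lemma orthonormal_upto_cell_fun: "orthonormal_upto cell_fun n"
  by (simp add: orthonormal_upto_def L2_cell_fun L2_inner_cell_fun)

end

text \<open>A grid with \<open>q\<close> cells per axis in the corner cube of side
  \<open>1 / L\<close>, of which the first \<open>n\<close> in some enumeration are kept;
  \<open>L\<close> controls the diameter of the whole family. Cells are open boxes, hence disjoint
  without boundary conventions. Both distance bounds go through the l1 norm, whence the factor
  \<open>CARD('d)\<close>.\<close>

lemma ex_grid_cells:
  fixes q L n :: nat
  assumes q: "1 \<le> q" and L: "1 \<le> L" and n: "n \<le> q ^ CARD('d::finite)"
  obtains B :: "nat \<Rightarrow> (real ^ 'd) set"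
  where "cell_family B n ((1 / (real L * real q)) ^ CARD('d))"
    "\<And>i x y. i < n \<Longrightarrow> x \<in> B i \<Longrightarrow> y \<in> B i \<Longrightarrow> norm (x - y) \<le> real CARD('d) / (real L * real q)"
    "\<And>i j x y. i < n \<Longrightarrow> j < n \<Longrightarrow> x \<in> B i \<Longrightarrow> y \<in> B j \<Longrightarrow> norm (x - y) \<le> real CARD('d) / real L"
proof -
  define h where "h = 1 / (real L * real q)"
  have h: "h > 0" "real q * h = 1 / real L" using q L by (auto simp: h_def)
  let ?F = "PiE UNIV (\<lambda>_. {..<q}) :: ('d \<Rightarrow> nat) set"
  have fin: "finite ?F" by (intro finite_PiE) auto
  have card: "card ?F = q ^ CARD('d)" by (simp add: card_PiE)
  obtain g where g: "bij_betw g {0..<q ^ CARD('d)} ?F"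
    using ex_bij_betw_nat_finite[OF fin] card by auto
  define B where "B i = box (\<chi> c. real (g i c) * h) (\<chi> c. (real (g i c) + 1) * h)" for i
  have mem: "x \<in> B i \<longleftrightarrow> (\<forall>c. real (g i c) * h < x $ c \<and> x $ c < (real (g i c) + 1) * h)" for x i
    by (simp add: B_def mem_box_cart)
  have gq: "g i c < q" if "i < n" for i c
  proof -
    have "g i \<in> ?F" using bij_betwE[OF g] that n by auto
    then show ?thesis by auto
  qed
  have range: "0 < x $ c \<and> x $ c < 1 / real L" if "x \<in> B i" "i < n" for x i c
  proof -
    have "real (g i c) + 1 \<le> real q" using gq[OF that(2), of c] by linarith
    then have "(real (g i c) + 1) * h \<le> 1 / real L"
      using h by (metis mult_right_mono less_imp_le)
    moreover have "0 \<le> real (g i c) * h" using h by simp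
    moreover have "real (g i c) * h < x $ c" "x $ c < (real (g i c) + 1) * h"
      using that(1) mem by auto
    ultimately show ?thesis by linarith
  qed
  have l1: "norm z \<le> real CARD('d) * b" if "\<And>c. \<bar>z $ c\<bar> \<le> b" for z :: "real ^ 'd" and b
    using norm_le_l1_cart[of z] sum_bounded_above[of UNIV "\<lambda>c. \<bar>z $ c\<bar>" b] that by simp
  have 1: "cell_family B n (h ^ CARD('d))"
  proof
    show "0 < h ^ CARD('d)" using h by simp
    show "B i \<in> sets borel" for i by (simp add: B_def)
    show "B i \<subseteq> cube" if "i < n" for i
    proof
      fix x assume "x \<in> B i"
      then have "0 < x $ c \<and> x $ c < 1 / real L" for c using range that by blast
      moreover have "1 / real L \<le> 1" using L by simp
      ultimately have "0 \<le> x $ c \<and> x $ c \<le> 1" for c by (meson less_imp_le order_trans)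
      then show "x \<in> cube" by (simp add: cube_def mem_box_cart)
    qed
    show "B i \<inter> B j = {}" if ij: "i < n" "j < n" "i \<noteq> j" for i j
    proof -
      have "g i \<noteq> g j"
        using ij n bij_betw_imp_inj_on[OF g] by (auto dest!: inj_onD)
      then obtain c where c: "g i c \<noteq> g j c" by auto
      have False if "x \<in> B i" "x \<in> B j" for x
      proof -
        have a: "real (g i c) * h < x $ c" "x $ c < (real (g i c) + 1) * h"
          "real (g j c) * h < x $ c" "x $ c < (real (g j c) + 1) * h"
          using that mem by auto
        \<comment> \<open>Overlapping open intervals of the one-dimensional grid have equal integer
          positions.\<close>
        then have "real (g i c) * h < (real (g j c) + 1) * h" "real (g j c) * h < (real (g i c) + 1) * h"
          by linarith+
        then have "real (g i c) < real (g j c) + 1" "real (g j c) < real (g i c) + 1"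
          using h by (simp_all only: mult_less_cancel_right_pos)
        then show False using c by linarith
      qed
      then show ?thesis by blast
    qed
    show "emeasure lborel (B i) = ennreal (h ^ CARD('d))" for i
    proof -
      have ip: "((\<chi> c. (real (g i c) + 1) * h) - (\<chi> c. real (g i c) * h)) \<bullet> b = h"
        if "b \<in> Basis" for b :: "real ^ 'd"
        using that by (auto simp: Basis_vec_def inner_axis algebra_simps)
      then have le: "(\<chi> c. real (g i c) * h) \<bullet> b \<le> (\<chi> c. (real (g i c) + 1) * h) \<bullet> b"
        if "b \<in> Basis" for b :: "real ^ 'd"
        using that h by (metis inner_diff_left diff_ge_0_iff_ge less_imp_le)
      have "emeasure lborel (B i) = (\<Prod>b\<in>(Basis :: (real ^ 'd) set). h)"
        unfolding B_def using emeasure_lborel_box[OF le] ip by (simp cong: prod.cong)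
      then show ?thesis by simp
    qed
  qed
  have 2: "norm (x - y) \<le> real CARD('d) * h" if "x \<in> B i" "y \<in> B i" for i x y
  proof (rule l1)
    fix c
    have "real (g i c) * h < x $ c" "x $ c < (real (g i c) + 1) * h"
      "real (g i c) * h < y $ c" "y $ c < (real (g i c) + 1) * h"
      using that mem by auto
    then show "\<bar>(x - y) $ c\<bar> \<le> h" by (simp add: algebra_simps abs_le_iff)
  qed
  have 3: "norm (x - y) \<le> real CARD('d) * (1 / real L)"
    if "i < n" "j < n" "x \<in> B i" "y \<in> B j" for i j x y
  proof (rule l1)
    fix c
    show "\<bar>(x - y) $ c\<bar> \<le> 1 / real L"
      using range[OF that(3,1), of c] range[OF that(4,2), of c] by (simp add: abs_le_iff)
  qed
  show ?thesis
    using that[of B] 1 2 3 by (simp add: h_def)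
qed

text \<open>Without a basis \<^const>\<open>trace_op\<close>, a definite description, would not determine anything.\<close>

lemma ex_orthonormal_basis: "\<exists>e :: nat \<Rightarrow> real ^ 'd::finite \<Rightarrow> real. orthonormal_basis e"
proof (rule ex_orthonormal_basis_if_infinite_dim)
  fix m :: nat
  have m: "m \<le> max 1 m ^ CARD('d)"
    using self_le_power[of "max 1 m" "CARD('d)"] by simp
  show "\<exists>\<phi> :: nat \<Rightarrow> real ^ 'd \<Rightarrow> real. orthonormal_upto \<phi> m"
  proof (rule ex_grid_cells[where 'd = 'd, of "max 1 m" 1 m])
    fix B :: "nat \<Rightarrow> (real ^ 'd) set"
    assume "cell_family B m ((1 / (real 1 * real (max 1 m))) ^ CARD('d))"
    then show ?thesis by (blast dest: cell_family.orthonormal_upto_cell_fun)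
  qed (use m in simp_all)
qed

subsection \<open>Operators with a kernel that is constant on cells\<close>

lemma L2_norm_eq_0_AE:
  assumes "AE x in cube_measure. f x = 0"
  shows "L2_norm f = 0"
proof -
  have "AE x in cube_measure. f x * f x = 0" using assms by eventually_elim simp
  then have "(LINT x|cube_measure. f x * f x) = 0" by (rule integral_eq_zero_AE)
  then show ?thesis by (simp add: L2_norm_def L2_inner_def)
qed

lemma op_norm_le:
  assumes "\<And>\<psi>. L2 \<psi> \<Longrightarrow> L2_norm \<psi> \<le> 1 \<Longrightarrow> L2_norm (T \<psi>) \<le> R"
  shows "op_norm T \<le> R"
  unfolding op_norm_def
proof (rule cSup_least)
  have "L2_norm (\<lambda>x :: real ^ 'a. 0) \<le> 1" by (simp add: L2_norm_def)
  then have "L2_norm (T (\<lambda>x. 0)) \<in> {L2_norm (T \<psi>) |\<psi>. L2 \<psi> \<and> L2_norm \<psi> \<le> 1}" by blast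
  then show "{L2_norm (T \<psi>) |\<psi>. L2 \<psi> \<and> L2_norm \<psi> \<le> 1} \<noteq> {}" by blast
qed (use assms in blast)

text \<open>The first assumption keeps the set bounded above; the \<open>Sup\<close> of an unbounded
  set of reals carries no information. \<open>R\<close> may be negative, so the proof passes to its
  absolute value.\<close>

lemma op_norm_ge:
  assumes "\<And>\<psi>. L2 \<psi> \<Longrightarrow> L2_norm (T \<psi>) \<le> R * L2_norm \<psi>" and "L2 \<psi>" "L2_norm \<psi> \<le> 1"
  shows "L2_norm (T \<psi>) \<le> op_norm T"
  unfolding op_norm_def
proof (rule cSup_upper)
  show "L2_norm (T \<psi>) \<in> {L2_norm (T \<psi>) |\<psi>. L2 \<psi> \<and> L2_norm \<psi> \<le> 1}" using assms by blast
  show "bdd_above {L2_norm (T \<psi>) |\<psi>. L2 \<psi> \<and> L2_norm \<psi> \<le> 1}"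
  proof (rule bdd_aboveI)
    fix z assume "z \<in> {L2_norm (T \<psi>) |\<psi>. L2 \<psi> \<and> L2_norm \<psi> \<le> 1}"
    then obtain \<psi> where \<psi>: "z = L2_norm (T \<psi>)" "L2 \<psi>" "L2_norm \<psi> \<le> 1" by blast
    then have "z \<le> R * L2_norm \<psi>" using assms(1) by blast
    also have "\<dots> \<le> \<bar>R\<bar> * L2_norm \<psi>" by (intro mult_right_mono) auto
    also have "\<dots> \<le> \<bar>R\<bar> * 1" using \<psi> by (intro mult_left_mono) auto
    finally show "z \<le> \<bar>R\<bar>" by simp
  qed
qed

lemma op_norm_ge_inner:
  assumes "\<And>\<psi>. L2 \<psi> \<Longrightarrow> L2_norm (T \<psi>) \<le> R * L2_norm \<psi>" and "L2 f" "L2_norm f \<le> 1"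
    and "L2 (T f)" "L2 g" "L2_norm g \<le> 1"
  shows "\<bar>L2_inner (T f) g\<bar> \<le> op_norm T"
proof -
  have "\<bar>L2_inner (T f) g\<bar> \<le> L2_norm (T f) * L2_norm g" using assms by (intro L2_Cauchy_Schwarz)
  also have "\<dots> \<le> L2_norm (T f) * 1" using assms by (intro mult_left_mono) auto
  also have "\<dots> \<le> op_norm T" using op_norm_ge[OF assms(1-3)] by simp
  finally show ?thesis .
qed

lemma orthonormal_basis_upto: "orthonormal_basis e \<Longrightarrow> orthonormal_upto e n"
  by (simp add: orthonormal_basis_def orthonormal_upto_def)

text \<open>Stated for two functions because the trace of a finite-rank kernel is a sum of such
  series over pairs of cells.\<close>

lemma Parseval:
  assumes e: "orthonormal_basis e" and g: "L2 g" and h: "L2 h"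
  shows "(\<lambda>l. L2_inner g (e l) * L2_inner (e l) h) sums L2_inner g h"
  unfolding sums_def
proof -
  have "(\<lambda>n. L2_norm (remainder e n g)) \<longlonglongrightarrow> 0"
    using e g unfolding orthonormal_basis_def remainder_def[abs_def] by blast
  from tendsto_mult[OF this tendsto_const[of "L2_norm h"]]
  have lim: "(\<lambda>n. L2_norm (remainder e n g) * L2_norm h) \<longlonglongrightarrow> 0" by simp
  have "(\<lambda>n. L2_inner (remainder e n g) h) \<longlonglongrightarrow> 0"
  proof (rule Lim_null_comparison[OF _ lim])
    show "\<forall>\<^sub>F n in sequentially. norm (L2_inner (remainder e n g) h) \<le> L2_norm (remainder e n g) * L2_norm h"
      using L2_Cauchy_Schwarz[OF L2_remainder[OF orthonormal_basis_upto[OF e] g] h] by simp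
  qed
  then have "(\<lambda>n. L2_inner g h - L2_inner (remainder e n g) h) \<longlonglongrightarrow> L2_inner g h - 0"
    by (intro tendsto_diff tendsto_const)
  then show "(\<lambda>n. \<Sum>l<n. L2_inner g (e l) * L2_inner (e l) h) \<longlonglongrightarrow> L2_inner g h"
    by (simp add: L2_inner_remainder_left[OF orthonormal_basis_upto[OF e] g h])
qed

lemma has_trace_imp_trace_op:
  assumes "has_trace T t"
  shows "trace_op T = t"
  unfolding trace_op_def
proof (rule the_equality)
  fix s assume "has_trace T s"
  with assms ex_orthonormal_basis show "s = t"
    unfolding has_trace_def by (meson sums_unique2)
qed fact

text \<open>Reduces comparisons with the bandwidth r(C)^(-1/d) of the class to inequalities between
  d-th powers.\<close>

lemma le_powr_neg_inverse:
  fixes d :: nat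
  assumes "0 < d" "0 \<le> \<delta>" "0 < t" "\<delta> ^ d * t \<le> 1"
  shows "\<delta> \<le> t powr (- 1 / real d)"
proof (rule power_le_imp_le_base)
  have "(t powr (- 1 / real d)) ^ d = t powr -1"
  proof -
    have "(t powr (- 1 / real d)) ^ d = (t powr (- 1 / real d)) powr real d"
      using assms(3) by (simp add: powr_realpow)
    also have "\<dots> = t powr -1" using assms(1) by (simp only: powr_powr) simp
    finally show ?thesis .
  qed
  then show "\<delta> ^ Suc (d - 1) \<le> (t powr (- 1 / real d)) ^ Suc (d - 1)"
    using assms by (simp add: powr_minus field_simps)
qed simp

section \<open>From matrices to operators: norm, trace and membership in the class\<close>

context cell_family
begin

definition cell_kernel :: "(nat \<Rightarrow> nat \<Rightarrow> real) \<Rightarrow> real ^ 'd \<Rightarrow> real ^ 'd \<Rightarrow> real" where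
  "cell_kernel A x y = (\<Sum>i<n. \<Sum>j<n. A i j * cell_fun i x * cell_fun j y)"

definition cell_apply :: "(nat \<Rightarrow> nat \<Rightarrow> real) \<Rightarrow> (real ^ 'd \<Rightarrow> real) \<Rightarrow> nat \<Rightarrow> real" where
  "cell_apply A \<psi> i = (\<Sum>j<n. A i j * L2_inner (cell_fun j) \<psi>)"

lemma integral_op_cell_kernel:
  assumes "L2 \<psi>"
  shows "integral_op (cell_kernel A) \<psi> = (\<lambda>x. \<Sum>i<n. cell_apply A \<psi> i * cell_fun i x)"
proof
  fix x
  have int: "integrable cube_measure (\<lambda>y. cell_fun j y * \<psi> y)" if "j < n" for j
    using L2_integrable_mult[OF L2_cell_fun[OF that] assms] .
  have "integral_op (cell_kernel A) \<psi> x =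
      (LINT y|cube_measure. (\<Sum>i<n. \<Sum>j<n. A i j * cell_fun i x * (cell_fun j y * \<psi> y)))"
    unfolding integral_op_def cell_kernel_def by (simp add: sum_distrib_right mult.assoc)
  also have "\<dots> = (\<Sum>i<n. \<Sum>j<n. A i j * cell_fun i x * L2_inner (cell_fun j) \<psi>)"
    unfolding L2_inner_def using int
    by (subst Bochner_Integration.integral_sum)
      (auto intro!: sum.cong Bochner_Integration.integrable_sum simp: Bochner_Integration.integral_sum)
  also have "\<dots> = (\<Sum>i<n. cell_apply A \<psi> i * cell_fun i x)"
    unfolding cell_apply_def sum_distrib_right by (simp add: mult_ac)
  finally show "integral_op (cell_kernel A) \<psi> x = (\<Sum>i<n. cell_apply A \<psi> i * cell_fun i x)" .
qed

lemma L2_cell_sum: "L2 (\<lambda>x. \<Sum>i<n. c i * cell_fun i x)"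
  by (intro L2_sum L2_cmult L2_cell_fun) simp

lemma L2_integral_op_cell_kernel: "L2 \<psi> \<Longrightarrow> L2 (integral_op (cell_kernel A) \<psi>)"
  by (simp add: integral_op_cell_kernel L2_cell_sum)

lemma L2_inner_cell_sum:
  assumes "L2 g"
  shows "L2_inner (\<lambda>x. \<Sum>i<n. c i * cell_fun i x) g = (\<Sum>i<n. c i * L2_inner (cell_fun i) g)"
  using assms by (subst L2_inner_sum_left) (auto intro: L2_cell_fun)

lemma L2_inner_cell_fun_sum:
  assumes "j < n"
  shows "L2_inner (cell_fun j) (\<lambda>x. \<Sum>i<n. c i * cell_fun i x) = c j"
proof -
  have "L2_inner (cell_fun j) (\<lambda>x. \<Sum>i<n. c i * cell_fun i x) = (\<Sum>i<n. c i * L2_inner (cell_fun i) (cell_fun j))"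
    using assms by (subst L2_inner_commute) (simp add: L2_inner_cell_sum L2_cell_fun)
  also have "\<dots> = (\<Sum>i<n. if i = j then c j else 0)"
    using assms by (intro sum.cong) (auto simp: L2_inner_cell_fun)
  finally show ?thesis using assms by simp
qed

lemma L2_inner_cell_sums:
  "L2_inner (\<lambda>x. \<Sum>i<n. c i * cell_fun i x) (\<lambda>x. \<Sum>i<n. b i * cell_fun i x) = (\<Sum>i<n. c i * b i)"
  by (simp add: L2_inner_cell_sum[OF L2_cell_sum] L2_inner_cell_fun_sum)

lemma L2_norm_cell_sum: "(L2_norm (\<lambda>x. \<Sum>i<n. c i * cell_fun i x))\<^sup>2 = (\<Sum>i<n. (c i)\<^sup>2)"
  unfolding L2_norm_squared L2_inner_cell_sums by (simp add: power2_eq_square)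

lemma L2_norm_cell_fun: "i < n \<Longrightarrow> L2_norm (cell_fun i) = 1"
  by (simp add: L2_norm_def L2_inner_cell_fun)

text \<open>Schur's test: Cauchy--Schwarz with the weights \<open>\<bar>A i j\<bar>\<close> in each row.\<close>

lemma L2_norm_cell_kernel_le:
  assumes sym: "\<forall>i<n. \<forall>j<n. A i j = A j i"
    and rows: "\<And>i. i < n \<Longrightarrow> (\<Sum>j<n. \<bar>A i j\<bar>) \<le> R" and R: "0 \<le> R" and \<psi>: "L2 \<psi>"
  shows "L2_norm (integral_op (cell_kernel A) \<psi>) \<le> R * L2_norm \<psi>"
proof (rule power2_le_imp_le)
  let ?c = "\<lambda>j. L2_inner (cell_fun j) \<psi>"
  have "(L2_norm (integral_op (cell_kernel A) \<psi>))\<^sup>2 = (\<Sum>i<n. (\<Sum>j<n. A i j * ?c j)\<^sup>2)"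
    by (simp add: integral_op_cell_kernel[OF \<psi>] L2_norm_cell_sum cell_apply_def)
  also have "\<dots> \<le> (\<Sum>i<n. R * (\<Sum>j<n. \<bar>A i j\<bar> * (?c j)\<^sup>2))"
  proof (rule sum_mono)
    fix i assume "i \<in> {..<n}"
    then have i: "i < n" by simp
    have "\<bar>\<Sum>j<n. A i j * ?c j\<bar> \<le> (\<Sum>j<n. \<bar>A i j * ?c j\<bar>)" by (rule sum_abs)
    also have "\<dots> = (\<Sum>j<n. sqrt \<bar>A i j\<bar> * (sqrt \<bar>A i j\<bar> * \<bar>?c j\<bar>))"
      by (simp add: abs_mult flip: mult.assoc)
    finally have "(\<Sum>j<n. A i j * ?c j)\<^sup>2 \<le> (\<Sum>j<n. sqrt \<bar>A i j\<bar> * (sqrt \<bar>A i j\<bar> * \<bar>?c j\<bar>))\<^sup>2"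
      using power_mono[of "\<bar>\<Sum>j<n. A i j * ?c j\<bar>" _ 2] by simp
    also have "\<dots> \<le> (\<Sum>j<n. (sqrt \<bar>A i j\<bar>)\<^sup>2) * (\<Sum>j<n. (sqrt \<bar>A i j\<bar> * \<bar>?c j\<bar>)\<^sup>2)"
      by (rule Cauchy_Schwarz_ineq_sum)
    also have "\<dots> = (\<Sum>j<n. \<bar>A i j\<bar>) * (\<Sum>j<n. \<bar>A i j\<bar> * (?c j)\<^sup>2)"
      by (simp add: power_mult_distrib)
    also have "\<dots> \<le> R * (\<Sum>j<n. \<bar>A i j\<bar> * (?c j)\<^sup>2)"
      by (intro mult_right_mono rows i sum_nonneg) simp
    finally show "(\<Sum>j<n. A i j * ?c j)\<^sup>2 \<le> R * (\<Sum>j<n. \<bar>A i j\<bar> * (?c j)\<^sup>2)" .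
  qed
  also have "\<dots> = R * (\<Sum>j<n. (\<Sum>i<n. \<bar>A j i\<bar>) * (?c j)\<^sup>2)"
    unfolding sum_distrib_left[symmetric]
    by (subst sum.swap) (auto simp: sum_distrib_right sym intro!: arg_cong[where f = "\<lambda>z. R * z"] sum.cong)
  also have "\<dots> \<le> R * (\<Sum>j<n. R * (?c j)\<^sup>2)"
    by (intro mult_left_mono R sum_mono mult_right_mono rows) auto
  also have "\<dots> = R\<^sup>2 * (\<Sum>j<n. (L2_inner \<psi> (cell_fun j))\<^sup>2)"
    by (simp add: sum_distrib_left power2_eq_square mult.assoc L2_inner_commute[of \<psi>])
  also have "\<dots> \<le> R\<^sup>2 * (L2_norm \<psi>)\<^sup>2"
    by (intro mult_left_mono Bessel_inequality orthonormal_upto_cell_fun \<psi>) simp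
  finally show "(L2_norm (integral_op (cell_kernel A) \<psi>))\<^sup>2 \<le> (R * L2_norm \<psi>)\<^sup>2"
    by (simp add: power_mult_distrib)
qed (use R in simp)

lemma op_norm_cell_kernel_le:
  assumes "\<forall>i<n. \<forall>j<n. A i j = A j i"
    and "\<And>i. i < n \<Longrightarrow> (\<Sum>j<n. \<bar>A i j\<bar>) \<le> R" and "0 \<le> R"
  shows "op_norm (integral_op (cell_kernel A)) \<le> R"
proof (rule op_norm_le)
  fix \<psi> :: "real ^ 'd \<Rightarrow> real" assume \<psi>: "L2 \<psi>" "L2_norm \<psi> \<le> 1"
  have "L2_norm (integral_op (cell_kernel A) \<psi>) \<le> R * L2_norm \<psi>"
    using assms \<psi> by (intro L2_norm_cell_kernel_le)
  also have "\<dots> \<le> R * 1" using \<psi> assms by (intro mult_left_mono)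
  finally show "L2_norm (integral_op (cell_kernel A) \<psi>) \<le> R" by simp
qed

lemma L2_norm_cell_kernel_bounded:
  assumes sym: "\<forall>i<n. \<forall>j<n. A i j = A j i"
  obtains R where "\<And>\<psi>. L2 \<psi> \<Longrightarrow> L2_norm (integral_op (cell_kernel A) \<psi>) \<le> R * L2_norm \<psi>"
proof -
  have "(\<Sum>j<n. \<bar>A i j\<bar>) \<le> (\<Sum>i<n. \<Sum>j<n. \<bar>A i j\<bar>)" if "i < n" for i
    using that by (intro member_le_sum) (auto intro: sum_nonneg)
  then show ?thesis
    by (intro that[of "\<Sum>i<n. \<Sum>j<n. \<bar>A i j\<bar>"] L2_norm_cell_kernel_le sym sum_nonneg) auto
qed

lemma L2_inner_integral_op_cell_kernel:
  assumes "L2 \<psi>" "L2 g"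
  shows "L2_inner (integral_op (cell_kernel A) \<psi>) g
    = (\<Sum>i<n. \<Sum>j<n. A i j * (L2_inner (cell_fun j) \<psi> * L2_inner (cell_fun i) g))"
  unfolding integral_op_cell_kernel[OF assms(1)] L2_inner_cell_sum[OF assms(2)]
  by (simp add: cell_apply_def sum_distrib_right mult.assoc)

lemma L2_inner_integral_op_cell_sums:
  "L2_inner (integral_op (cell_kernel A) (\<lambda>x. \<Sum>i<n. c i * cell_fun i x)) (\<lambda>x. \<Sum>i<n. b i * cell_fun i x)
    = (\<Sum>i<n. \<Sum>j<n. A i j * (c j * b i))"
  by (simp add: L2_inner_integral_op_cell_kernel[OF L2_cell_sum L2_cell_sum] L2_inner_cell_fun_sum)

text \<open>Rayleigh quotient at the unit vector of one cell.\<close>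

lemma op_norm_cell_kernel_ge:
  assumes sym: "\<forall>i<n. \<forall>j<n. A i j = A j i" and i: "i < n"
  shows "\<bar>A i i\<bar> \<le> op_norm (integral_op (cell_kernel A))"
proof -
  obtain R where R: "\<And>\<psi>. L2 \<psi> \<Longrightarrow> L2_norm (integral_op (cell_kernel A) \<psi>) \<le> R * L2_norm \<psi>"
    using L2_norm_cell_kernel_bounded[OF sym] by metis
  have "L2_inner (integral_op (cell_kernel A) (cell_fun i)) (cell_fun i)
      = (\<Sum>k<n. \<Sum>j<n. if j = i then if k = i then A i i else 0 else 0)"
    unfolding L2_inner_integral_op_cell_kernel[OF L2_cell_fun[OF i] L2_cell_fun[OF i]]
    using i by (intro sum.cong) (auto simp: L2_inner_cell_fun)
  also have "\<dots> = A i i" using i by (simp add: sum.delta)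
  finally show ?thesis
    using op_norm_ge_inner[OF R L2_cell_fun[OF i] _ L2_integral_op_cell_kernel[OF L2_cell_fun[OF i]]
        L2_cell_fun[OF i]] i
    by (simp add: L2_norm_cell_fun)
qed

text \<open>Parseval for each of the finitely many rank-one pieces, hence the same sum in every
  basis, as \<open>has_trace\<close> demands.\<close>

lemma has_trace_cell_kernel: "has_trace (integral_op (cell_kernel A)) (\<Sum>i<n. A i i)"
  unfolding has_trace_def
proof (intro allI impI)
  fix e :: "nat \<Rightarrow> real ^ 'd \<Rightarrow> real" assume e: "orthonormal_basis e"
  have eL: "L2 (e l)" for l using e by (simp add: orthonormal_basis_def)
  have "(\<lambda>l. \<Sum>i<n. \<Sum>j<n. A i j * (L2_inner (cell_fun j) (e l) * L2_inner (e l) (cell_fun i)))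
      sums (\<Sum>i<n. \<Sum>j<n. A i j * L2_inner (cell_fun j) (cell_fun i))"
    by (intro sums_sum sums_mult Parseval e L2_cell_fun) auto
  moreover have "(\<Sum>i<n. \<Sum>j<n. A i j * L2_inner (cell_fun j) (cell_fun i)) = (\<Sum>i<n. \<Sum>j<n. if j = i then A i i else 0)"
    by (intro sum.cong) (auto simp: L2_inner_cell_fun)
  ultimately show "(\<lambda>l. L2_inner (integral_op (cell_kernel A) (e l)) (e l)) sums (\<Sum>i<n. A i i)"
    by (simp add: L2_inner_integral_op_cell_kernel[OF eL eL] L2_inner_commute[of "e _" "cell_fun _"])
qed

lemma cell_kernel_in_cell:
  assumes "i < n" "x \<in> B i"
  shows "cell_kernel A x y = (\<Sum>j<n. A i j * indicator (B j) y / v)"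
proof -
  have "cell_fun k x = (if k = i then 1 / sqrt v else 0)" if "k < n" for k
    using that assms cell_disjoint[of i k] by (auto simp: cell_fun_def indicator_def)
  then have "cell_kernel A x y = (\<Sum>k<n. if k = i then \<Sum>j<n. A i j * (1 / sqrt v) * cell_fun j y else 0)"
    unfolding cell_kernel_def by (intro sum.cong) (auto intro!: sum.neutral)
  also have "\<dots> = (\<Sum>j<n. A i j * (1 / sqrt v) * cell_fun j y)" using assms by simp
  also have "\<dots> = (\<Sum>j<n. A i j * indicator (B j) y / v)"
    using v_pos by (intro sum.cong) (auto simp: cell_fun_def)
  finally show ?thesis .
qed

lemma cell_kernel_outside: "(\<And>i. i < n \<Longrightarrow> x \<notin> B i) \<Longrightarrow> cell_kernel A x y = 0"
  by (simp add: cell_kernel_def cell_fun_def)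

lemma cell_kernel_diag:
  assumes "i < n" "x \<in> B i"
  shows "cell_kernel A x x = A i i / v"
proof -
  have "cell_kernel A x x = (\<Sum>j<n. if j = i then A i i / v else 0)"
    unfolding cell_kernel_in_cell[OF assms] using assms cell_disjoint[of i]
    by (intro sum.cong) (auto simp: indicator_def)
  then show ?thesis using assms by simp
qed

text \<open>Reduces the class to inequalities on the matrix. As the norm is at least 1, the
  effective dimension is at most the trace, so the geometric conditions may be stated with the
  trace. \<open>\<delta>\<close> bounds a single cell, whose diagonal block then never meets the
  region of integration; for each \<open>m\<close>, either the off-diagonal row sum \<open>s\<close>
  is small or all cells lie within \<open>m\<close> bandwidths of each other.\<close>

lemma cell_kernel_in_covariance_class:
  assumes cov: "covariance_function (cell_kernel A)"
    and sym: "\<forall>i<n. \<forall>j<n. A i j = A j i"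
    and norm1: "1 \<le> op_norm (integral_op (cell_kernel A))"
    and K: "0 \<le> K1" "0 \<le> K2" and \<nu>: "\<And>m. 1 \<le> m \<Longrightarrow> 0 < \<nu> m"
    and tr: "0 < (\<Sum>i<n. A i i)"
    and diag: "\<And>i. i < n \<Longrightarrow> A i i / v \<le> K1 * (\<Sum>i<n. A i i)"
    and eff: "(\<Sum>i<n. A i i) \<le> r * op_norm (integral_op (cell_kernel A))"
    and diam: "0 \<le> \<delta>" "\<And>i x y. i < n \<Longrightarrow> x \<in> B i \<Longrightarrow> y \<in> B i \<Longrightarrow> norm (x - y) \<le> \<delta>"
      "\<delta> ^ CARD('d) * (\<Sum>i<n. A i i) \<le> 1"
    and total: "0 \<le> \<Delta>" "\<And>i j x y. i < n \<Longrightarrow> j < n \<Longrightarrow> x \<in> B i \<Longrightarrow> y \<in> B j \<Longrightarrow> norm (x - y) \<le> \<Delta>"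
    and off: "\<And>i. i < n \<Longrightarrow> (\<Sum>j\<in>{..<n} - {i}. \<bar>A i j\<bar>) \<le> s"
    and decay: "\<And>m. 1 \<le> m \<Longrightarrow> s \<le> K2 * \<nu> m \<or> (\<Delta> / real m) ^ CARD('d) * (\<Sum>i<n. A i i) \<le> 1"
  shows "cell_kernel A \<in> covariance_class K1 K2 r \<nu>"
proof -
  let ?T = "integral_op (cell_kernel A)" and ?t = "\<Sum>i<n. A i i"
  define \<rho> where "\<rho> = effective_dim ?T powr (- 1 / real CARD('d))"
  note ht = has_trace_cell_kernel[of A]
  note tr_eq = has_trace_imp_trace_op[OF ht]
  have ed: "effective_dim ?T = ?t / op_norm ?T" by (simp add: effective_dim_def tr_eq)
  have ed_pos: "0 < effective_dim ?T" using tr norm1 by (simp add: ed)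
  have ed_le: "effective_dim ?T \<le> ?t" using tr norm1 by (simp add: ed field_simps)
  have \<rho>_ge: "z \<le> \<rho>" if "0 \<le> z" "z ^ CARD('d) * ?t \<le> 1" for z
    unfolding \<rho>_def
  proof (rule le_powr_neg_inverse)
    have "z ^ CARD('d) * effective_dim ?T \<le> z ^ CARD('d) * ?t"
      using that ed_le by (intro mult_left_mono) auto
    then show "z ^ CARD('d) * effective_dim ?T \<le> 1" using that by linarith
  qed (use that ed_pos in auto)
  have \<rho>0: "0 < \<rho>" using ed_pos by (simp add: \<rho>_def)
  have nonzero: "nonzero_op ?T"
    unfolding nonzero_op_def
  proof (rule ccontr)
    assume "\<nexists>\<psi>. L2 \<psi> \<and> \<not> (AE x in cube_measure. ?T \<psi> x = 0)"
    then have "L2_norm (?T \<psi>) = 0" if "L2 \<psi>" for \<psi> using that L2_norm_eq_0_AE by blast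
    then have "op_norm ?T \<le> 0" by (intro op_norm_le) simp
    with norm1 show False by simp
  qed
  have diag': "cell_kernel A x x \<le> K1 * trace_op ?T" if "x \<in> cube" for x
  proof (cases "\<exists>i<n. x \<in> B i")
    case True
    then show ?thesis using cell_kernel_diag diag by (auto simp: tr_eq)
  next
    case False
    then have "cell_kernel A x x = 0" by (intro cell_kernel_outside) auto
    then show ?thesis using K tr by (simp add: tr_eq)
  qed
  have decay': "(LINT y:{y\<in>cube. norm (x - y) > real m * \<rho>}|lborel. \<bar>cell_kernel A x y\<bar>)
      \<le> K2 * op_norm ?T * \<nu> m" if m: "1 \<le> m" for m x
  proof -
    let ?S = "{y\<in>cube. norm (x - y) > real m * \<rho>}"
    have rhs: "K2 * \<nu> m \<le> K2 * op_norm ?T * \<nu> m"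
      using mult_left_mono[OF norm1, of "K2 * \<nu> m"] K \<nu>[OF m] by (simp add: mult_ac)
    have rhs0: "0 \<le> K2 * op_norm ?T * \<nu> m" using norm1 K \<nu>[OF m] by simp
    have z: ?thesis if "\<And>y. y \<in> ?S \<Longrightarrow> cell_kernel A x y = 0"
    proof -
      have "(LINT y:?S|lborel. \<bar>cell_kernel A x y\<bar>) = (LINT y|(lborel :: (real ^ 'd) measure). 0)"
        unfolding set_lebesgue_integral_def using that
        by (intro Bochner_Integration.integral_cong) (auto simp: indicator_def)
      then show ?thesis using rhs0 by simp
    qed
    show ?thesis
    proof (cases "\<exists>i<n. x \<in> B i")
      case False
      then show ?thesis by (intro z cell_kernel_outside) auto
    next
      case True
      then obtain i where i: "i < n" "x \<in> B i" by blast
      \<comment> \<open>Cell diameters do not exceed the bandwidth, so already for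
        \<open>m = 1\<close> the cell of \<open>x\<close> is excluded and only off-diagonal entries
        count.\<close>
      have notin: "y \<notin> B i" if "y \<in> ?S" for y
      proof
        assume "y \<in> B i"
        then have "norm (x - y) \<le> \<rho>" using diam(2)[OF i] \<rho>_ge[OF diam(1,3)] by fastforce
        also have "\<dots> \<le> real m * \<rho>" using m \<rho>0 by simp
        finally show False using that by simp
      qed
      consider "s \<le> K2 * \<nu> m" | "(\<Delta> / real m) ^ CARD('d) * ?t \<le> 1" using decay[OF m] by blast
      then show ?thesis
      proof cases
        case 1
        \<comment> \<open>On cell \<open>j\<close> the kernel is \<open>A i j / v\<close> and the
          cell has volume \<open>v\<close>, so the integral of this majorant is the off-diagonal row
          sum.\<close>
        let ?g = "\<lambda>y. \<Sum>j\<in>{..<n} - {i}. \<bar>A i j\<bar> / v * indicator (B j) y"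
        have meas: "measure lborel (B j) = v" "emeasure lborel (B j) < \<infinity>" "B j \<in> sets lborel" if "j < n" for j
          using cell_volume[OF that] cell_borel[OF that] v_pos by (auto simp: measure_def)
        have "(LINT y:?S|lborel. \<bar>cell_kernel A x y\<bar>) \<le> (LINT y|lborel. ?g y)"
          unfolding set_lebesgue_integral_def
        proof (rule integral_mono')
          show "integrable lborel ?g" using meas
            by (intro Bochner_Integration.integrable_sum integrable_mult_right integrable_real_indicator) auto
          show "indicat_real ?S y *\<^sub>R \<bar>cell_kernel A x y\<bar> \<le> ?g y" for y
          proof (cases "y \<in> ?S")
            case True
            have "cell_kernel A x y = (\<Sum>j\<in>{..<n} - {i}. A i j * indicator (B j) y / v)"
              unfolding cell_kernel_in_cell[OF i] using notin[OF True]
              by (intro sum.mono_neutral_right) auto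
            also have "\<bar>\<dots>\<bar> \<le> (\<Sum>j\<in>{..<n} - {i}. \<bar>A i j * indicator (B j) y / v\<bar>)" by (rule sum_abs)
            also have "\<dots> = ?g y" using v_pos by (intro sum.cong) (auto simp: abs_mult)
            finally show ?thesis using True by simp
          next
            case False
            then show ?thesis using v_pos by (auto intro!: sum_nonneg)
          qed
          show "0 \<le> ?g y" for y using v_pos by (auto intro!: sum_nonneg)
        qed
        also have "\<dots> = (\<Sum>j\<in>{..<n} - {i}. \<bar>A i j\<bar>)"
          using meas v_pos by (subst Bochner_Integration.integral_sum) (auto intro!: sum.cong)
        also have "\<dots> \<le> K2 * op_norm ?T * \<nu> m" using off[OF i(1)] 1 rhs by linarith
        finally show ?thesis .
      next
        case 2
        then have "\<Delta> / real m \<le> \<rho>" using total(1) by (intro \<rho>_ge) auto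
        then have \<Delta>: "\<Delta> \<le> real m * \<rho>" using m by (simp add: field_simps)
        show ?thesis
        proof (rule z)
          fix y assume y: "y \<in> ?S"
          have "y \<notin> B j" if "j < n" for j
            using total(2)[OF i(1) that i(2), of y] \<Delta> y by auto
          then show "cell_kernel A x y = 0" unfolding cell_kernel_in_cell[OF i] by (simp add: indicator_def)
        qed
      qed
    qed
  qed
  show ?thesis
    unfolding covariance_class_def
    using cov nonzero ht diag' eff norm1 decay' unfolding \<rho>_def
    by (auto simp: trace_class_def ed divide_le_eq)
qed

end

subsection \<open>Gaussian vectors\<close>

definition std_normal :: "real measure" where
  "std_normal = density lborel (\<lambda>x. ennreal (std_normal_density x))"

definition std_gauss :: "nat \<Rightarrow> (nat \<Rightarrow> real) measure" where
  "std_gauss n = (\<Pi>\<^sub>M i\<in>{..<n}. std_normal)"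

lemma prob_space_std_normal: "prob_space std_normal"
  unfolding std_normal_def by (rule prob_space_normal_density) simp

lemma sets_std_normal [measurable_cong, simp]: "sets std_normal = sets borel"
  by (simp add: std_normal_def)

lemma space_std_normal [simp]: "space std_normal = UNIV"
  by (simp add: std_normal_def)

interpretation std_normal: prob_space std_normal
  by (rule prob_space_std_normal)

interpretation std_normals: product_prob_space "\<lambda>_ :: nat. std_normal" UNIV
  by standard

lemma sets_std_gauss [measurable_cong]: "sets (std_gauss n) = sets (\<Pi>\<^sub>M i\<in>{..<n}. borel)"
  unfolding std_gauss_def by (intro sets_PiM_cong) auto

lemma space_std_gauss: "space (std_gauss n) = {..<n} \<rightarrow>\<^sub>E UNIV"
  by (simp add: std_gauss_def space_PiM)

lemma prob_space_std_gauss: "prob_space (std_gauss n)"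
  unfolding std_gauss_def by (intro prob_space_PiM prob_space_std_normal)

lemma std_gauss_component_measurable [measurable]: "i < n \<Longrightarrow> (\<lambda>\<omega>. \<omega> i) \<in> borel_measurable (std_gauss n)"
  by (simp add: measurable_cong_sets[OF sets_std_gauss refl] measurable_component_singleton)

lemma std_gauss_sum_measurable [measurable]: "(\<lambda>\<omega>. \<Sum>i<n. c i * \<omega> i) \<in> borel_measurable (std_gauss n)"
  by (intro borel_measurable_sum borel_measurable_times std_gauss_component_measurable) auto

lemma distr_std_gauss_component:
  assumes "i < n"
  shows "distr (std_gauss n) borel (\<lambda>\<omega>. \<omega> i) = std_normal"
proof -
  have "distr (std_gauss n) borel (\<lambda>\<omega>. \<omega> i) = distr (std_gauss n) std_normal (\<lambda>\<omega>. \<omega> i)"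
    by (rule distr_cong) simp_all
  also have "\<dots> = std_normal"
    unfolding std_gauss_def using assms by (intro distr_PiM_component prob_space_std_normal) simp
  finally show ?thesis .
qed

lemma distributed_std_gauss_component:
  "i < n \<Longrightarrow> distributed (std_gauss n) lborel (\<lambda>\<omega>. \<omega> i) std_normal_density"
  using distr_std_gauss_component[of i n] unfolding distributed_def
  by (auto simp: std_normal_def cong: distr_cong)

lemma indep_vars_std_gauss:
  assumes "0 < n"
  shows "prob_space.indep_vars (std_gauss n) (\<lambda>_. borel) (\<lambda>i \<omega>. \<omega> i) {..<n}"
proof -
  interpret prob_space "std_gauss n" by (rule prob_space_std_gauss)
  have "distr (std_gauss n) (\<Pi>\<^sub>M i\<in>{..<n}. borel) (\<lambda>x. \<lambda>i\<in>{..<n}. x i) = distr (std_gauss n) (std_gauss n) (\<lambda>x. x)"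
    by (intro distr_cong refl) (auto simp: sets_std_gauss space_std_gauss)
  also have "\<dots> = (\<Pi>\<^sub>M i\<in>{..<n}. std_normal)" by (simp add: std_gauss_def)
  also have "\<dots> = (\<Pi>\<^sub>M i\<in>{..<n}. distr (std_gauss n) borel (\<lambda>\<omega>. \<omega> i))"
    by (intro PiM_cong) (auto simp: distr_std_gauss_component)
  finally show ?thesis
    using assms by (subst indep_vars_iff_distr_eq_PiM') auto
qed

lemma sum_squares_pos: "i < n \<Longrightarrow> c i \<noteq> 0 \<Longrightarrow> 0 < (\<Sum>i<n. (c i)\<^sup>2)" for c :: "nat \<Rightarrow> real"
  by (rule sum_pos2[where i = i]) auto

text \<open>Coordinates with zero coefficient are dropped first, since a normal density needs a
  positive standard deviation. The fully degenerate form is left to the first alternative of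
  \<open>centered_gaussian\<close>.\<close>

lemma distributed_std_gauss_sum:
  assumes "\<exists>i<n. c i \<noteq> 0"
  shows "distributed (std_gauss n) lborel (\<lambda>\<omega>. \<Sum>i<n. c i * \<omega> i) (normal_density 0 (sqrt (\<Sum>i<n. (c i)\<^sup>2)))"
proof -
  interpret prob_space "std_gauss n" by (rule prob_space_std_gauss)
  let ?I = "{i. i < n \<and> c i \<noteq> 0}"
  have "indep_vars (\<lambda>_. borel) (\<lambda>i \<omega>. \<omega> i) ?I"
    using assms by (intro indep_vars_subset[OF indep_vars_std_gauss]) auto
  then have ind: "indep_vars (\<lambda>_. borel) (\<lambda>i \<omega>. c i * \<omega> i) ?I"
    by (rule indep_vars_compose2) auto
  have "distributed (std_gauss n) lborel (\<lambda>\<omega>. \<Sum>i\<in>?I. c i * \<omega> i)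
      (normal_density (\<Sum>i\<in>?I. 0) (sqrt (\<Sum>i\<in>?I. \<bar>c i\<bar>\<^sup>2)))"
  proof (rule sum_indep_normal[OF _ _ ind])
    show "distributed (std_gauss n) lborel (\<lambda>\<omega>. c i * \<omega> i) (normal_density 0 \<bar>c i\<bar>)" if "i \<in> ?I" for i
      using normal_density_affine[OF distributed_std_gauss_component, where \<alpha> = "c i" and \<beta> = 0] that
      by auto
  qed (use assms in auto)
  moreover have "(\<Sum>i\<in>?I. c i * \<omega> i) = (\<Sum>i<n. c i * \<omega> i)" "(\<Sum>i\<in>?I. (c i)\<^sup>2) = (\<Sum>i<n. (c i)\<^sup>2)" for \<omega>
    by (auto intro!: sum.mono_neutral_left)
  ultimately show ?thesis by simp
qed

lemma std_gauss_sum_square: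
  "integrable (std_gauss n) (\<lambda>\<omega>. (\<Sum>i<n. c i * \<omega> i)\<^sup>2)"
  "(LINT \<omega>|std_gauss n. (\<Sum>i<n. c i * \<omega> i)\<^sup>2) = (\<Sum>i<n. (c i)\<^sup>2)"
proof -
  interpret prob_space "std_gauss n" by (rule prob_space_std_gauss)
  have "integrable (std_gauss n) (\<lambda>\<omega>. (\<Sum>i<n. c i * \<omega> i)\<^sup>2) \<and>
    (LINT \<omega>|std_gauss n. (\<Sum>i<n. c i * \<omega> i)\<^sup>2) = (\<Sum>i<n. (c i)\<^sup>2)"
  proof (cases "\<exists>i<n. c i \<noteq> 0")
    case True
    let ?s = "sqrt (\<Sum>i<n. (c i)\<^sup>2)"
    have pos: "0 < (\<Sum>i<n. (c i)\<^sup>2)"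
      using True sum_squares_pos by blast
    note D = distributed_std_gauss_sum[OF True]
    have "integrable lborel (\<lambda>x. normal_density 0 ?s x * x\<^sup>2)"
      using integrable_normal_moment[of ?s 0 2] pos by simp
    then have "integrable (std_gauss n) (\<lambda>\<omega>. (\<Sum>i<n. c i * \<omega> i)\<^sup>2)"
      using distributed_integrable[OF D, of "\<lambda>x. x\<^sup>2"] by (simp add: normal_density_nonneg)
    moreover have "(LINT x|lborel. normal_density 0 ?s x * x\<^sup>2) = ?s\<^sup>2"
      using integral_normal_moment_even[of ?s 0 1] pos by (simp add: eval_nat_numeral)
    then have "(LINT \<omega>|std_gauss n. (\<Sum>i<n. c i * \<omega> i)\<^sup>2) = ?s\<^sup>2"
      using distributed_integral[OF D, of "\<lambda>x. x\<^sup>2"] by (simp add: normal_density_nonneg)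
    ultimately show ?thesis using pos by simp
  qed simp
  then show "integrable (std_gauss n) (\<lambda>\<omega>. (\<Sum>i<n. c i * \<omega> i)\<^sup>2)"
    "(LINT \<omega>|std_gauss n. (\<Sum>i<n. c i * \<omega> i)\<^sup>2) = (\<Sum>i<n. (c i)\<^sup>2)" by auto
qed

text \<open>Polarisation, so that only variances of linear forms have to be computed.\<close>

lemma std_gauss_sum_mult:
  "(LINT \<omega>|std_gauss n. (\<Sum>i<n. c i * \<omega> i) * (\<Sum>i<n. b i * \<omega> i)) = (\<Sum>i<n. c i * b i)"
proof -
  have pol: "(\<Sum>i<n. c i * \<omega> i) * (\<Sum>i<n. b i * \<omega> i) =
      ((\<Sum>i<n. (c i + b i) * \<omega> i)\<^sup>2 - (\<Sum>i<n. (c i - b i) * \<omega> i)\<^sup>2) / 4" for \<omega>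
    by (simp add: distrib_right left_diff_distrib sum.distrib sum_subtractf power2_eq_square algebra_simps)
  have "(LINT \<omega>|std_gauss n. (\<Sum>i<n. c i * \<omega> i) * (\<Sum>i<n. b i * \<omega> i)) =
     ((\<Sum>i<n. (c i + b i)\<^sup>2) - (\<Sum>i<n. (c i - b i)\<^sup>2)) / 4"
    unfolding pol by (simp add: std_gauss_sum_square)
  also have "\<dots> = (\<Sum>i<n. c i * b i)"
    unfolding sum_subtractf[symmetric] sum_divide_distrib
    by (intro sum.cong) (auto simp: power2_eq_square algebra_simps)
  finally show ?thesis .
qed

text \<open>
  The linear map \<open>I + \<beta> w\<^sup>T\<close>. With \<open>\<parallel>w\<parallel> = 1\<close> it turns a standard Gaussian vector into
  one with covariance \<open>I + \<beta> w\<^sup>T + w \<beta>\<^sup>T + \<beta> \<beta>\<^sup>T\<close>.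
\<close>

definition tilt :: "nat \<Rightarrow> (nat \<Rightarrow> real) \<Rightarrow> (nat \<Rightarrow> real) \<Rightarrow> (nat \<Rightarrow> real) \<Rightarrow> nat \<Rightarrow> real" where
  "tilt n \<beta> w \<omega> = (\<lambda>i\<in>{..<n}. \<omega> i + \<beta> i * (\<Sum>j<n. w j * \<omega> j))"

definition tilt_cov :: "(nat \<Rightarrow> real) \<Rightarrow> (nat \<Rightarrow> real) \<Rightarrow> nat \<Rightarrow> nat \<Rightarrow> real" where
  "tilt_cov \<beta> w i j = (if i = j then 1 else 0) + \<beta> i * w j + w i * \<beta> j + \<beta> i * \<beta> j"

text \<open>The transposed map I + w \<beta>^T, which carries functionals of the tilted vector to
  functionals of the standard one.\<close>

definition tilt_adjoint :: "nat \<Rightarrow> (nat \<Rightarrow> real) \<Rightarrow> (nat \<Rightarrow> real) \<Rightarrow> (nat \<Rightarrow> real) \<Rightarrow> nat \<Rightarrow> real" where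
  "tilt_adjoint n \<beta> w a j = a j + w j * (\<Sum>i<n. a i * \<beta> i)"

lemma tilt_cov_commute: "tilt_cov \<beta> w i j = tilt_cov \<beta> w j i"
  by (simp add: tilt_cov_def)

lemma tilt_measurable [measurable]: "tilt n \<beta> w \<in> measurable (std_gauss n) (std_gauss n)"
  unfolding measurable_cong_sets[OF refl sets_std_gauss] tilt_def[abs_def]
  by (intro measurable_restrict borel_measurable_add borel_measurable_times std_gauss_sum_measurable
      std_gauss_component_measurable) auto

lemma sum_tilt: "(\<Sum>i<n. a i * tilt n \<beta> w \<omega> i) = (\<Sum>j<n. tilt_adjoint n \<beta> w a j * \<omega> j)"
proof -
  have "(\<Sum>i<n. a i * tilt n \<beta> w \<omega> i) = (\<Sum>i<n. a i * \<omega> i) + (\<Sum>i<n. a i * \<beta> i) * (\<Sum>j<n. w j * \<omega> j)"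
    by (simp add: tilt_def distrib_left sum.distrib sum_distrib_right mult.assoc)
  also have "(\<Sum>i<n. a i * \<beta> i) * (\<Sum>j<n. w j * \<omega> j) = (\<Sum>j<n. w j * (\<Sum>i<n. a i * \<beta> i) * \<omega> j)"
    unfolding sum_distrib_left[of "\<Sum>i<n. a i * \<beta> i"] by (intro sum.cong) auto
  finally show ?thesis by (simp add: tilt_adjoint_def distrib_right sum.distrib)
qed

text \<open>The covariance of two functionals of the tilted vector; \<open>w\<close> being a unit
  vector gives the term \<beta> \<beta>^T the coefficient 1.\<close>

lemma sum_tilt_adjoint_mult:
  assumes w: "(\<Sum>j<n. (w j)\<^sup>2) = 1"
  shows "(\<Sum>j<n. tilt_adjoint n \<beta> w a j * tilt_adjoint n \<beta> w b j) = (\<Sum>i<n. \<Sum>j<n. tilt_cov \<beta> w i j * (a i * b j))"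
proof -
  define s t where "s = (\<Sum>i<n. a i * \<beta> i)" and "t = (\<Sum>i<n. b i * \<beta> i)"
  have "(\<Sum>j<n. tilt_adjoint n \<beta> w a j * tilt_adjoint n \<beta> w b j) =
     (\<Sum>j<n. a j * b j) + t * (\<Sum>j<n. a j * w j) + s * (\<Sum>j<n. w j * b j) + s * t * (\<Sum>j<n. (w j)\<^sup>2)"
    unfolding tilt_adjoint_def s_def[symmetric] t_def[symmetric] sum_distrib_left sum.distrib[symmetric]
    by (intro sum.cong) (auto simp: algebra_simps power2_eq_square)
  also have "\<dots> = (\<Sum>j<n. a j * b j) + s * (\<Sum>j<n. w j * b j) + (\<Sum>j<n. a j * w j) * t + s * t"
    by (simp add: w)
  also have "(\<Sum>j<n. a j * b j) = (\<Sum>i<n. \<Sum>j<n. if i = j then a i * b j else 0)" by simp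
  also have "s * (\<Sum>j<n. w j * b j) = (\<Sum>i<n. \<Sum>j<n. a i * \<beta> i * (w j * b j))"
    by (simp add: s_def sum_product)
  also have "(\<Sum>j<n. a j * w j) * t = (\<Sum>i<n. \<Sum>j<n. a i * w i * (b j * \<beta> j))"
    by (simp add: t_def sum_product)
  also have "s * t = (\<Sum>i<n. \<Sum>j<n. a i * \<beta> i * (b j * \<beta> j))"
    by (simp add: s_def t_def sum_product)
  also have "(\<Sum>i<n. \<Sum>j<n. if i = j then a i * b j else 0) + (\<Sum>i<n. \<Sum>j<n. a i * \<beta> i * (w j * b j))
      + (\<Sum>i<n. \<Sum>j<n. a i * w i * (b j * \<beta> j)) + (\<Sum>i<n. \<Sum>j<n. a i * \<beta> i * (b j * \<beta> j))
     = (\<Sum>i<n. \<Sum>j<n. tilt_cov \<beta> w i j * (a i * b j))"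
    unfolding sum.distrib[symmetric] tilt_cov_def
    by (intro sum.cong) (auto simp: algebra_simps)
  finally show ?thesis .
qed

lemma centered_gaussian_std_gauss_sum: "centered_gaussian (std_gauss n) (\<lambda>\<omega>. \<Sum>i<n. c i * \<omega> i)"
proof (cases "\<exists>i<n. c i \<noteq> 0")
  case True
  have pos: "0 < (\<Sum>i<n. (c i)\<^sup>2)"
    using True sum_squares_pos by blast
  then show ?thesis
    using distributed_std_gauss_sum[OF True] unfolding centered_gaussian_def
    by (auto intro!: exI[of _ "sqrt (\<Sum>i<n. (c i)\<^sup>2)"])
qed (simp add: centered_gaussian_def)

context cell_family
begin

definition cell_path :: "(nat \<Rightarrow> real) \<Rightarrow> real ^ 'd \<Rightarrow> real" where
  "cell_path \<xi> x = (\<Sum>i<n. \<xi> i * cell_fun i x)"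

lemma L2_cell_path: "L2 (cell_path \<xi>)"
  unfolding cell_path_def[abs_def] by (rule L2_cell_sum)

text \<open>Point evaluations and inner products of a cell path are both linear in its coefficients,
  so both families of generators pull back to measurable sets.\<close>

lemma cell_path_measurable [measurable]: "cell_path \<in> measurable (std_gauss n) path_space"
  unfolding path_space_def
proof (rule measurable_measure_of)
  have m: "(\<lambda>\<xi>. \<Sum>i<n. c i * \<xi> i) -` S \<inter> space (std_gauss n) \<in> sets (std_gauss n)"
    if "S \<in> sets borel" for c S
    by (rule measurable_sets[OF std_gauss_sum_measurable that])
  fix A assume "A \<in> {{f. L2 f \<and> f x \<in> S} |(x :: real ^ 'd) S. x \<in> cube \<and> S \<in> sets borel} \<union>
      {{f. L2 f \<and> L2_inner f g \<in> S} |g S. L2 g \<and> S \<in> sets borel}"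
  then consider x S where "A = {f. L2 f \<and> f x \<in> S}" "S \<in> sets borel"
    | g S where "A = {f. L2 f \<and> L2_inner f g \<in> S}" "L2 g" "S \<in> sets borel" by blast
  then show "cell_path -` A \<inter> space (std_gauss n) \<in> sets (std_gauss n)"
  proof cases
    case 1
    have "cell_path -` A \<inter> space (std_gauss n) = (\<lambda>\<xi>. \<Sum>i<n. cell_fun i x * \<xi> i) -` S \<inter> space (std_gauss n)"
      using L2_cell_path by (auto simp: 1 cell_path_def mult.commute)
    then show ?thesis using m[OF 1(2)] by simp
  next
    case 2
    have "L2_inner (cell_path \<xi>) g = (\<Sum>i<n. L2_inner (cell_fun i) g * \<xi> i)" for \<xi>
      unfolding cell_path_def[abs_def] by (subst L2_inner_cell_sum[OF 2(2)]) (simp add: mult.commute)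
    then have "cell_path -` A \<inter> space (std_gauss n) =
        (\<lambda>\<xi>. \<Sum>i<n. L2_inner (cell_fun i) g * \<xi> i) -` S \<inter> space (std_gauss n)"
      using L2_cell_path by (auto simp: 2)
    then show ?thesis using m[OF 2(3)] by simp
  qed
qed (use L2_cell_path in auto)

lemma cell_path_tilt: "cell_path (tilt n \<beta> w \<omega>) x = (\<Sum>j<n. tilt_adjoint n \<beta> w (\<lambda>i. cell_fun i x) j * \<omega> j)"
  using sum_tilt[where a = "\<lambda>i. cell_fun i x"] by (simp add: cell_path_def mult.commute)

text \<open>At most one cell contains \<open>x\<close>. The bound does not depend on
  \<open>x\<close> and therefore gives an integrable majorant on the product space.\<close>

lemma cell_path_square_le: "(cell_path \<xi> x)\<^sup>2 \<le> (\<Sum>i<n. (\<xi> i)\<^sup>2) / v"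
proof -
  have "(cell_path \<xi> x)\<^sup>2 = (\<Sum>i<n. \<Sum>j<n. \<xi> i * \<xi> j * (cell_fun i x * cell_fun j x))"
    unfolding cell_path_def power2_eq_square sum_product by (intro sum.cong) (auto simp: mult_ac)
  also have "\<dots> = (\<Sum>i<n. \<Sum>j<n. if i = j then (\<xi> i)\<^sup>2 * indicator (B i) x / v else 0)"
    by (intro sum.cong) (auto simp: cell_fun_mult power2_eq_square)
  also have "\<dots> = (\<Sum>i<n. (\<xi> i)\<^sup>2 * indicator (B i) x / v)" by simp
  also have "\<dots> \<le> (\<Sum>i<n. (\<xi> i)\<^sup>2 / v)"
    using v_pos by (intro sum_mono divide_right_mono) (auto simp: indicator_def)
  finally show ?thesis by (simp add: sum_divide_distrib)
qed

lemma centered_gp_cell_path: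
  assumes w: "(\<Sum>j<n. (w j)\<^sup>2) = 1"
  shows "centered_gp (std_gauss n) (\<lambda>\<omega>. cell_path (tilt n \<beta> w \<omega>)) (cell_kernel (tilt_cov \<beta> w))"
  unfolding centered_gp_def
proof (intro conjI allI impI ballI)
  show "prob_space (std_gauss n)" by (rule prob_space_std_gauss)
  have [measurable]: "(\<lambda>p. tilt n \<beta> w (fst p) i) \<in> borel_measurable (std_gauss n \<Otimes>\<^sub>M (cube_measure :: (real ^ 'd) measure))"
    if "i < n" for i
    by (rule measurable_compose[OF measurable_compose[OF measurable_fst tilt_measurable]
          std_gauss_component_measurable[OF that]])
  have [measurable]: "(\<lambda>p. cell_fun i (snd p)) \<in> borel_measurable (std_gauss n \<Otimes>\<^sub>M cube_measure)" if "i < n" for i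
    by (rule measurable_compose[OF measurable_snd borel_measurable_cube_measureI[OF cell_fun_measurable[OF that]]])
  show m: "(\<lambda>(\<omega>, x). cell_path (tilt n \<beta> w \<omega>) x) \<in> borel_measurable (std_gauss n \<Otimes>\<^sub>M cube_measure)"
    unfolding cell_path_def case_prod_beta
    by (intro borel_measurable_sum borel_measurable_times) auto
  show "integrable (std_gauss n \<Otimes>\<^sub>M cube_measure) (\<lambda>(\<omega>, x). (cell_path (tilt n \<beta> w \<omega>) x)\<^sup>2)"
  proof (rule Bochner_Integration.integrable_bound)
    interpret C: prob_space "cube_measure :: (real ^ 'd) measure" by (rule prob_space_cube_measure)
    have d: "distr (std_gauss n \<Otimes>\<^sub>M (cube_measure :: (real ^ 'd) measure)) (std_gauss n) fst = std_gauss n"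
      by (rule C.distr_pair_fst)
    have tj: "tilt n \<beta> w \<omega> i = (\<Sum>j<n. tilt_adjoint n \<beta> w (\<lambda>k. if k = i then 1 else 0) j * \<omega> j)" if "i < n" for \<omega> i
      using sum_tilt[where a = "\<lambda>k. if k = i then 1 else 0" and n = n] that by (simp add: if_distrib[of "\<lambda>c. c * _"] cong: if_cong)
    have "integrable (std_gauss n) (\<lambda>\<omega>. (\<Sum>i<n. (tilt n \<beta> w \<omega> i)\<^sup>2) / v)"
      by (intro Bochner_Integration.integrable_divide Bochner_Integration.integrable_sum)
        (auto simp: tj std_gauss_sum_square)
    then have "integrable (distr (std_gauss n \<Otimes>\<^sub>M (cube_measure :: (real ^ 'd) measure)) (std_gauss n) fst)
        (\<lambda>\<omega>. (\<Sum>i<n. (tilt n \<beta> w \<omega> i)\<^sup>2) / v)" unfolding d .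
    then show "integrable (std_gauss n \<Otimes>\<^sub>M (cube_measure :: (real ^ 'd) measure))
        (\<lambda>p. (\<Sum>i<n. (tilt n \<beta> w (fst p) i)\<^sup>2) / v)"
      by (rule integrable_distr[rotated]) simp
    show "(\<lambda>(\<omega>, x). (cell_path (tilt n \<beta> w \<omega>) x)\<^sup>2) \<in> borel_measurable (std_gauss n \<Otimes>\<^sub>M cube_measure)"
      using borel_measurable_power[OF m, of 2] by (simp add: case_prod_beta)
    have "(cell_path \<xi> x)\<^sup>2 \<le> \<bar>(\<Sum>i<n. (\<xi> i)\<^sup>2) / v\<bar>" for \<xi> x
      by (rule order_trans[OF cell_path_square_le abs_ge_self])
    then show "AE p in std_gauss n \<Otimes>\<^sub>M cube_measure.
        norm (case p of (\<omega>, x) \<Rightarrow> (cell_path (tilt n \<beta> w \<omega>) x)\<^sup>2) \<le> norm ((\<Sum>i<n. (tilt n \<beta> w (fst p) i)\<^sup>2) / v)"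
      by (auto simp: case_prod_beta)
  qed
  show "L2 (cell_path (tilt n \<beta> w \<omega>))" for \<omega> by (rule L2_cell_path)
  show "cell_kernel (tilt_cov \<beta> w) x y =
      (LINT \<omega>|std_gauss n. cell_path (tilt n \<beta> w \<omega>) x * cell_path (tilt n \<beta> w \<omega>) y)" for x y
    unfolding cell_path_tilt std_gauss_sum_mult sum_tilt_adjoint_mult[OF w]
    by (simp add: cell_kernel_def mult.assoc)
next
  fix S :: "(real ^ 'd) set" and a :: "real ^ 'd \<Rightarrow> real"
  have "(\<Sum>x\<in>S. a x * cell_path (tilt n \<beta> w \<omega>) x) =
      (\<Sum>j<n. (\<Sum>x\<in>S. a x * tilt_adjoint n \<beta> w (\<lambda>i. cell_fun i x) j) * \<omega> j)" for \<omega>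
    unfolding cell_path_tilt sum_distrib_left sum_distrib_right by (subst sum.swap) (simp add: mult.assoc)
  then show "centered_gaussian (std_gauss n) (\<lambda>\<omega>. \<Sum>x\<in>S. a x * cell_path (tilt n \<beta> w \<omega>) x)"
    by (simp add: centered_gaussian_std_gauss_sum)
qed

lemma gp_law_cell_path:
  assumes "(\<Sum>j<n. (w j)\<^sup>2) = 1"
  shows "gp_law (cell_kernel (tilt_cov \<beta> w)) (distr (std_gauss n) path_space (\<lambda>\<omega>. cell_path (tilt n \<beta> w \<omega>)))"
  unfolding gp_law_def using centered_gp_cell_path[OF assms] by blast

end

subsection \<open>Likelihood ratios\<close>

lemma nn_integral_std_normal:
  "f \<in> borel_measurable borel \<Longrightarrow> (\<integral>\<^sup>+x. f x \<partial>std_normal) = (\<integral>\<^sup>+x. ennreal (std_normal_density x) * f x \<partial>lborel)"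
  unfolding std_normal_def by (subst nn_integral_density) auto

text \<open>The one-dimensional Cameron-Martin formula, for arbitrary nonnegative \<open>h\<close>
  so that no integrability has to be tracked.\<close>

lemma nn_integral_std_normal_shift:
  fixes h :: "real \<Rightarrow> ennreal"
  assumes [measurable]: "h \<in> borel_measurable borel"
  shows "(\<integral>\<^sup>+x. h (x + c) \<partial>std_normal) = (\<integral>\<^sup>+x. h x * ennreal (exp (c * x - c\<^sup>2 / 2)) \<partial>std_normal)"
proof -
  have d: "std_normal_density (x + c) * exp (c * (x + c) - c\<^sup>2 / 2) = std_normal_density x" for x
    by (simp add: std_normal_density_def power2_eq_square field_simps flip: exp_add)
  have "(\<integral>\<^sup>+x. h x * ennreal (exp (c * x - c\<^sup>2 / 2)) \<partial>std_normal)
      = (\<integral>\<^sup>+x. ennreal (std_normal_density x) * (h x * ennreal (exp (c * x - c\<^sup>2 / 2))) \<partial>lborel)"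
    by (rule nn_integral_std_normal) measurable
  also have "\<dots> = (\<integral>\<^sup>+x. ennreal (std_normal_density (c + 1 * x)) *
      (h (c + 1 * x) * ennreal (exp (c * (c + 1 * x) - c\<^sup>2 / 2))) \<partial>lborel)"
    by (subst nn_integral_real_affine[where c = 1 and t = c]) auto
  also have "\<dots> = (\<integral>\<^sup>+x. ennreal (std_normal_density x) * h (x + c) \<partial>lborel)"
    by (intro nn_integral_cong, subst d[symmetric])
      (simp add: ennreal_mult normal_density_nonneg add.commute mult_ac)
  also have "\<dots> = (\<integral>\<^sup>+x. h (x + c) \<partial>std_normal)"
    by (rule nn_integral_std_normal[symmetric]) measurable
  finally show ?thesis by simp
qed

lemma nn_integral_std_normal_scale:
  fixes h :: "real \<Rightarrow> ennreal"
  assumes [measurable]: "h \<in> borel_measurable borel" and \<sigma>: "0 < \<sigma>"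
  shows "(\<integral>\<^sup>+x. h (\<sigma> * x) \<partial>std_normal) =
    (\<integral>\<^sup>+x. h x * ennreal (exp (x\<^sup>2 / 2 - x\<^sup>2 / (2 * \<sigma>\<^sup>2)) / \<sigma>) \<partial>std_normal)"
proof -
  have d: "\<sigma> * (std_normal_density (\<sigma> * x) * (exp ((\<sigma> * x)\<^sup>2 / 2 - (\<sigma> * x)\<^sup>2 / (2 * \<sigma>\<^sup>2)) / \<sigma>)) = std_normal_density x" for x
    using \<sigma> by (simp add: std_normal_density_def power_mult_distrib field_simps flip: exp_add)
  have "(\<integral>\<^sup>+x. h x * ennreal (exp (x\<^sup>2 / 2 - x\<^sup>2 / (2 * \<sigma>\<^sup>2)) / \<sigma>) \<partial>std_normal)
      = (\<integral>\<^sup>+x. ennreal (std_normal_density x) * (h x * ennreal (exp (x\<^sup>2 / 2 - x\<^sup>2 / (2 * \<sigma>\<^sup>2)) / \<sigma>)) \<partial>lborel)"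
    by (rule nn_integral_std_normal) measurable
  also have "\<dots> = ennreal \<sigma> * (\<integral>\<^sup>+x. ennreal (std_normal_density (0 + \<sigma> * x)) *
      (h (0 + \<sigma> * x) * ennreal (exp ((0 + \<sigma> * x)\<^sup>2 / 2 - (0 + \<sigma> * x)\<^sup>2 / (2 * \<sigma>\<^sup>2)) / \<sigma>)) \<partial>lborel)"
    using \<sigma> by (subst nn_integral_real_affine[where c = \<sigma> and t = 0]) auto
  also have "\<dots> = (\<integral>\<^sup>+x. ennreal \<sigma> * (ennreal (std_normal_density (\<sigma> * x)) *
      (h (\<sigma> * x) * ennreal (exp ((\<sigma> * x)\<^sup>2 / 2 - (\<sigma> * x)\<^sup>2 / (2 * \<sigma>\<^sup>2)) / \<sigma>))) \<partial>lborel)"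
    by (subst nn_integral_cmult) auto
  also have "\<dots> = (\<integral>\<^sup>+x. ennreal (std_normal_density x) * h (\<sigma> * x) \<partial>lborel)"
  proof (intro nn_integral_cong)
    fix x
    let ?p = "std_normal_density (\<sigma> * x)" and ?q = "exp ((\<sigma> * x)\<^sup>2 / 2 - (\<sigma> * x)\<^sup>2 / (2 * \<sigma>\<^sup>2)) / \<sigma>"
    have "ennreal (\<sigma> * (?p * ?q)) = ennreal \<sigma> * (ennreal ?p * ennreal ?q)"
      using \<sigma> by (simp only: ennreal_mult normal_density_nonneg mult_nonneg_nonneg exp_ge_zero divide_nonneg_pos less_imp_le)
    then show "ennreal \<sigma> * (ennreal ?p * (h (\<sigma> * x) * ennreal ?q)) = ennreal (std_normal_density x) * h (\<sigma> * x)"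
      unfolding d by (simp only: mult_ac)
  qed
  also have "\<dots> = (\<integral>\<^sup>+x. h (\<sigma> * x) \<partial>std_normal)"
    by (rule nn_integral_std_normal[symmetric]) measurable
  finally show ?thesis by simp
qed

text \<open>Moment generating function of a chi-square variable with one degree of freedom; the
  second moments of both likelihood ratios reduce to it.\<close>

lemma nn_integral_std_normal_exp_square:
  assumes "t < 1 / 2"
  shows "(\<integral>\<^sup>+x. ennreal (exp (t * x\<^sup>2)) \<partial>std_normal) = ennreal (1 / sqrt (1 - 2 * t))"
proof -
  define s where "s = 1 / sqrt (1 - 2 * t)"
  have s: "0 < s" "s\<^sup>2 = 1 / (1 - 2 * t)" using assms by (auto simp: s_def power_divide)
  have d: "std_normal_density x * exp (t * x\<^sup>2) = s * normal_density 0 s x" for x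
  proof -
    have "s * normal_density 0 s x = exp (- x\<^sup>2 / (2 * s\<^sup>2)) / sqrt (2 * pi)"
      using s(1) by (simp add: normal_density_def real_sqrt_mult field_simps)
    also have "- x\<^sup>2 / (2 * s\<^sup>2) = - x\<^sup>2 / 2 + t * x\<^sup>2"
      using assms by (simp add: s(2) field_simps)
    finally show ?thesis by (simp add: std_normal_density_def flip: exp_add)
  qed
  have "(\<integral>\<^sup>+x. ennreal (exp (t * x\<^sup>2)) \<partial>std_normal) = (\<integral>\<^sup>+x. ennreal s * ennreal (normal_density 0 s x) \<partial>lborel)"
    using s(1) by (subst nn_integral_std_normal)
      (auto simp: normal_density_nonneg d simp flip: ennreal_mult)
  also have "\<dots> = ennreal s * (\<integral>\<^sup>+x. ennreal (normal_density 0 s x) \<partial>lborel)"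
    by (subst nn_integral_cmult) auto
  also have "(\<integral>\<^sup>+x. ennreal (normal_density 0 s x) \<partial>lborel) = 1"
    using s(1) by (subst nn_integral_eq_integral) (auto simp: normal_density_nonneg)
  finally show ?thesis by (simp add: s_def)
qed

text \<open>Since (1 - x)(1 + 2 x) = 1 + x (1 - 2 x) >= 1 on this range. An exponential bound is
  wanted because the N-th power for N samples only multiplies the exponent.\<close>

lemma inverse_sqrt_le_exp:
  fixes x :: real
  assumes "0 \<le> x" "x \<le> 1 / 2"
  shows "1 / sqrt (1 - x) \<le> exp x"
proof -
  have "1 \<le> (1 - x) * (1 + 2 * x)"
    using assms mult_nonneg_nonneg[of x "1 - 2 * x"] by (simp add: algebra_simps)
  also have "\<dots> \<le> (1 - x) * exp (2 * x)"
    using assms exp_ge_add_one_self[of "2 * x"] by (intro mult_left_mono) auto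
  finally have "sqrt 1 \<le> sqrt ((1 - x) * exp (2 * x))" by (rule real_sqrt_le_mono)
  also have "\<dots> = sqrt (1 - x) * exp x"
    by (simp add: real_sqrt_mult real_sqrt_unique exp_double)
  finally show ?thesis using assms by (simp add: field_simps)
qed

text \<open>Fubini with coordinate \<open>i\<close> innermost: once the other coordinates are
  frozen, \<open>y \<omega>\<close> is a constant and the one-dimensional formula applies. Shears
  use y = b (w . \<omega>), the diagonal alternatives a trivial \<open>y\<close>.\<close>

lemma nn_integral_std_gauss_coordinate:
  assumes i: "i < n" and F[measurable]: "F \<in> borel_measurable (std_gauss n)"
    and T[measurable]: "(\<lambda>\<omega>. (\<omega>)(i := T (y \<omega>) (\<omega> i))) \<in> measurable (std_gauss n) (std_gauss n)"
    and l[measurable]: "(\<lambda>\<omega>. l (y \<omega>) (\<omega> i)) \<in> borel_measurable (std_gauss n)"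
    and y: "\<And>\<omega> t. y ((\<omega>)(i := t)) = y \<omega>"
    and cov: "\<And>c h. h \<in> borel_measurable borel \<Longrightarrow>
      (\<integral>\<^sup>+x. h (T c x) \<partial>std_normal) = (\<integral>\<^sup>+x. h x * l c x \<partial>std_normal)"
  shows "(\<integral>\<^sup>+\<omega>. F ((\<omega>)(i := T (y \<omega>) (\<omega> i))) \<partial>std_gauss n) = (\<integral>\<^sup>+\<omega>. F \<omega> * l (y \<omega>) (\<omega> i) \<partial>std_gauss n)"
proof -
  let ?I = "{..<n} - {i}"
  have I: "{..<n} = insert i ?I" using i by auto
  have split: "integral\<^sup>N (std_gauss n) f = (\<integral>\<^sup>+x. (\<integral>\<^sup>+t. f (x(i := t)) \<partial>std_normal) \<partial>(\<Pi>\<^sub>M i\<in>?I. std_normal))"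
    if "f \<in> borel_measurable (std_gauss n)" for f
    using that unfolding std_gauss_def by (subst (asm) I, subst I, intro std_normals.product_nn_integral_insert) auto
  have "(\<integral>\<^sup>+\<omega>. F ((\<omega>)(i := T (y \<omega>) (\<omega> i))) \<partial>std_gauss n)
      = (\<integral>\<^sup>+x. (\<integral>\<^sup>+t. F (x(i := T (y x) t)) \<partial>std_normal) \<partial>(\<Pi>\<^sub>M i\<in>?I. std_normal))"
    by (subst split) (simp_all add: y)
  also have "\<dots> = (\<integral>\<^sup>+x. (\<integral>\<^sup>+t. F (x(i := t)) * l (y x) t \<partial>std_normal) \<partial>(\<Pi>\<^sub>M i\<in>?I. std_normal))"
  proof (rule nn_integral_cong)
    fix x assume x: "x \<in> space (\<Pi>\<^sub>M i\<in>?I. std_normal)"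
    have "(\<lambda>t. x(i := t)) \<in> measurable borel (\<Pi>\<^sub>M i\<in>insert i ?I. std_normal)"
      using x by (intro measurable_fun_upd[where J = ?I]) (auto simp: measurable_cong_sets[OF refl sets_std_normal])
    then have [measurable]: "(\<lambda>t. x(i := t)) \<in> measurable borel (std_gauss n)"
      unfolding std_gauss_def I[symmetric] .
    show "(\<integral>\<^sup>+t. F (x(i := T (y x) t)) \<partial>std_normal) = (\<integral>\<^sup>+t. F (x(i := t)) * l (y x) t \<partial>std_normal)"
      by (rule cov[of "\<lambda>t. F (x(i := t))"]) measurable
  qed
  also have "\<dots> = (\<integral>\<^sup>+\<omega>. F \<omega> * l (y \<omega>) (\<omega> i) \<partial>std_gauss n)"
    by (subst split) (simp_all add: y)
  finally show ?thesis .
qed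

lemma distr_eq_densityI:
  assumes T: "T \<in> measurable M M" and l: "l \<in> borel_measurable M"
    and eq: "\<And>F. F \<in> borel_measurable M \<Longrightarrow> (\<integral>\<^sup>+\<omega>. F (T \<omega>) \<partial>M) = (\<integral>\<^sup>+\<omega>. F \<omega> * l \<omega> \<partial>M)"
  shows "distr M M T = density M l"
proof (rule measure_eqI)
  fix A assume "A \<in> sets (distr M M T)"
  then have A: "A \<in> sets M" by simp
  have "emeasure (distr M M T) A = (\<integral>\<^sup>+\<omega>. indicator A \<omega> \<partial>distr M M T)" using A by simp
  also have "\<dots> = (\<integral>\<^sup>+\<omega>. indicator A (T \<omega>) \<partial>M)" using T A by (subst nn_integral_distr) auto
  also have "\<dots> = (\<integral>\<^sup>+\<omega>. indicator A \<omega> * l \<omega> \<partial>M)" using A by (intro eq) simp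
  also have "\<dots> = emeasure (density M l) A" using l A by (simp add: emeasure_density mult.commute)
  finally show "emeasure (distr M M T) A = emeasure (density M l) A" .
qed simp

definition spike :: "nat \<Rightarrow> real \<Rightarrow> nat \<Rightarrow> real" where
  "spike i b = (\<lambda>j. if j = i then b else 0)"

lemma sum_spike_mult: "i < n \<Longrightarrow> (\<Sum>j<n. spike i b j * f j) = b * f i"
proof -
  assume "i < n"
  have "(\<Sum>j<n. spike i b j * f j) = (\<Sum>j<n. if j = i then b * f i else 0)"
    by (intro sum.cong) (auto simp: spike_def)
  then show ?thesis using \<open>i < n\<close> by simp
qed

text \<open>The density of N(y, 1) with respect to N(0, 1) at coordinate \<open>i\<close>, with y =
  b (w . \<omega>) regarded as given: the likelihood ratio of one sheared sample when
  \<open>w i = 0\<close>.\<close>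

definition shift_lr :: "nat \<Rightarrow> nat \<Rightarrow> real \<Rightarrow> (nat \<Rightarrow> real) \<Rightarrow> (nat \<Rightarrow> real) \<Rightarrow> real" where
  "shift_lr n i b w \<omega> = exp (b * (\<Sum>j<n. w j * \<omega> j) * \<omega> i - (b * (\<Sum>j<n. w j * \<omega> j))\<^sup>2 / 2)"

text \<open>The density of N(0, \<sigma>^2) with respect to N(0, 1) at coordinate
  \<open>i\<close>.\<close>

definition scale_lr :: "nat \<Rightarrow> real \<Rightarrow> (nat \<Rightarrow> real) \<Rightarrow> real" where
  "scale_lr i \<sigma> \<omega> = exp ((\<omega> i)\<^sup>2 / 2 - (\<omega> i)\<^sup>2 / (2 * \<sigma>\<^sup>2)) / \<sigma>"

lemma shift_lr_measurable [measurable]: "i < n \<Longrightarrow> shift_lr n i b w \<in> borel_measurable (std_gauss n)"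
  unfolding shift_lr_def[abs_def] by measurable

lemma scale_lr_measurable [measurable]: "i < n \<Longrightarrow> scale_lr i \<sigma> \<in> borel_measurable (std_gauss n)"
  unfolding scale_lr_def[abs_def] by measurable

lemma shift_lr_nonneg: "0 \<le> shift_lr n i b w \<omega>"
  by (simp add: shift_lr_def)

lemma scale_lr_nonneg: "0 < \<sigma> \<Longrightarrow> 0 \<le> scale_lr i \<sigma> \<omega>"
  by (simp add: scale_lr_def)

lemma tilt_spike_shift:
  assumes "i < n" "\<omega> \<in> space (std_gauss n)"
  shows "tilt n (spike i b) w \<omega> = (\<omega>)(i := \<omega> i + b * (\<Sum>j<n. w j * \<omega> j))"
  using assms by (auto simp: tilt_def spike_def space_std_gauss fun_eq_iff PiE_def extensional_def)

lemma nn_integral_tilt_shift: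
  assumes i: "i < n" and w: "w i = 0" and F[measurable]: "F \<in> borel_measurable (std_gauss n)"
  shows "(\<integral>\<^sup>+\<omega>. F (tilt n (spike i b) w \<omega>) \<partial>std_gauss n) = (\<integral>\<^sup>+\<omega>. F \<omega> * ennreal (shift_lr n i b w \<omega>) \<partial>std_gauss n)"
proof -
  let ?y = "\<lambda>\<omega>. b * (\<Sum>j<n. w j * \<omega> j)"
  have "(\<integral>\<^sup>+\<omega>. F (tilt n (spike i b) w \<omega>) \<partial>std_gauss n) = (\<integral>\<^sup>+\<omega>. F ((\<omega>)(i := \<omega> i + ?y \<omega>)) \<partial>std_gauss n)"
    by (intro nn_integral_cong) (simp add: tilt_spike_shift[OF i])
  also have "\<dots> = (\<integral>\<^sup>+\<omega>. F \<omega> * ennreal (exp (?y \<omega> * \<omega> i - (?y \<omega>)\<^sup>2 / 2)) \<partial>std_gauss n)"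
  proof (rule nn_integral_std_gauss_coordinate[OF i F, where T = "\<lambda>c x. x + c" and y = ?y and
        l = "\<lambda>c x. ennreal (exp (c * x - c\<^sup>2 / 2))"])
    have "(\<lambda>\<omega>. tilt n (spike i b) w \<omega>) \<in> measurable (std_gauss n) (std_gauss n)" by measurable
    then show "(\<lambda>\<omega>. (\<omega>)(i := \<omega> i + ?y \<omega>)) \<in> measurable (std_gauss n) (std_gauss n)"
      by (subst measurable_cong[where g = "tilt n (spike i b) w"]) (auto simp: tilt_spike_shift[OF i])
    show "(\<lambda>\<omega>. ennreal (exp (?y \<omega> * \<omega> i - (?y \<omega>)\<^sup>2 / 2))) \<in> borel_measurable (std_gauss n)"
      using i by measurable
    have "(\<Sum>j<n. w j * ((\<omega>)(i := t)) j) = (\<Sum>j<n. w j * \<omega> j)" for \<omega> t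
      using w by (intro sum.cong) auto
    then show "?y ((\<omega>)(i := t)) = ?y \<omega>" for \<omega> t by simp
  qed (rule nn_integral_std_normal_shift)
  finally show ?thesis by (simp add: shift_lr_def)
qed

lemma nn_integral_tilt_scale:
  assumes i: "i < n" and \<alpha>: "0 < 1 + \<alpha>" and F[measurable]: "F \<in> borel_measurable (std_gauss n)"
  shows "(\<integral>\<^sup>+\<omega>. F (tilt n (spike i \<alpha>) (spike i 1) \<omega>) \<partial>std_gauss n) =
    (\<integral>\<^sup>+\<omega>. F \<omega> * ennreal (scale_lr i (1 + \<alpha>) \<omega>) \<partial>std_gauss n)"
proof -
  have eq: "tilt n (spike i \<alpha>) (spike i 1) \<omega> = (\<omega>)(i := (1 + \<alpha>) * \<omega> i)" if "\<omega> \<in> space (std_gauss n)" for \<omega>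
    using tilt_spike_shift[OF i that, of \<alpha> "spike i 1"] by (simp add: sum_spike_mult[OF i] distrib_right)
  have "(\<integral>\<^sup>+\<omega>. F (tilt n (spike i \<alpha>) (spike i 1) \<omega>) \<partial>std_gauss n) = (\<integral>\<^sup>+\<omega>. F ((\<omega>)(i := (1 + \<alpha>) * \<omega> i)) \<partial>std_gauss n)"
    by (intro nn_integral_cong) (simp add: eq)
  also have "\<dots> = (\<integral>\<^sup>+\<omega>. F \<omega> * ennreal (exp ((\<omega> i)\<^sup>2 / 2 - (\<omega> i)\<^sup>2 / (2 * (1 + \<alpha>)\<^sup>2)) / (1 + \<alpha>)) \<partial>std_gauss n)"
  proof (rule nn_integral_std_gauss_coordinate[OF i F, where T = "\<lambda>c x. (1 + \<alpha>) * x" and y = "\<lambda>\<omega>. ()" and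
        l = "\<lambda>c x. ennreal (exp (x\<^sup>2 / 2 - x\<^sup>2 / (2 * (1 + \<alpha>)\<^sup>2)) / (1 + \<alpha>))"])
    have "(\<lambda>\<omega>. tilt n (spike i \<alpha>) (spike i 1) \<omega>) \<in> measurable (std_gauss n) (std_gauss n)" by measurable
    then show "(\<lambda>\<omega>. (\<omega>)(i := (1 + \<alpha>) * \<omega> i)) \<in> measurable (std_gauss n) (std_gauss n)"
      by (subst measurable_cong[where g = "tilt n (spike i \<alpha>) (spike i 1)"]) (auto simp: eq)
    show "(\<lambda>\<omega>. ennreal (exp ((\<omega> i)\<^sup>2 / 2 - (\<omega> i)\<^sup>2 / (2 * (1 + \<alpha>)\<^sup>2)) / (1 + \<alpha>))) \<in> borel_measurable (std_gauss n)"
      using i by measurable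
  qed (use nn_integral_std_normal_scale[OF _ \<alpha>] in auto)
  finally show ?thesis by (simp add: scale_lr_def)
qed

lemma nn_integral_shift_lr_square:
  assumes i: "i < n" and w: "w i = 0" "(\<Sum>j<n. (w j)\<^sup>2) = 1" and b: "2 * b\<^sup>2 \<le> 1 / 2"
  shows "(\<integral>\<^sup>+\<omega>. ennreal ((shift_lr n i b w \<omega>)\<^sup>2) \<partial>std_gauss n) \<le> ennreal (exp (2 * b\<^sup>2))"
proof -
  let ?y = "\<lambda>\<omega>. \<Sum>j<n. w j * \<omega> j"
  have y: "?y (tilt n (spike i (2 * b)) w \<omega>) = ?y \<omega>" for \<omega>
  proof -
    have "(\<Sum>k<n. w k * spike i (2 * b) k) = 0"
      using sum_spike_mult[OF i, of "2 * b" w] w by (simp add: mult.commute)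
    then show ?thesis by (subst sum_tilt) (simp add: tilt_adjoint_def)
  qed
  \<comment> \<open>Completing the square: the squared ratio is exp(b^2 y^2) times the ratio of the
    doubled shear. The latter is absorbed by a change of variables that leaves y fixed, so only a
    chi-square moment of the standard normal y remains.\<close>
  have sq: "(shift_lr n i b w \<omega>)\<^sup>2 = exp (b\<^sup>2 * (?y \<omega>)\<^sup>2) * shift_lr n i (2 * b) w \<omega>" for \<omega>
    unfolding shift_lr_def by (simp add: power_mult_distrib algebra_simps flip: exp_add exp_double)
  have "\<exists>k<n. w k \<noteq> 0"
  proof (rule ccontr)
    assume "\<not> (\<exists>k<n. w k \<noteq> 0)"
    then have "(\<Sum>j<n. (w j)\<^sup>2) = 0" by (intro sum.neutral) auto
    with w show False by simp
  qed
  note D = distributed_std_gauss_sum[OF this, unfolded w(2) real_sqrt_one]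
  have "(\<integral>\<^sup>+\<omega>. ennreal ((shift_lr n i b w \<omega>)\<^sup>2) \<partial>std_gauss n)
      = (\<integral>\<^sup>+\<omega>. ennreal (exp (b\<^sup>2 * (?y \<omega>)\<^sup>2)) * ennreal (shift_lr n i (2 * b) w \<omega>) \<partial>std_gauss n)"
    by (simp add: sq ennreal_mult shift_lr_nonneg)
  also have "\<dots> = (\<integral>\<^sup>+\<omega>. ennreal (exp (b\<^sup>2 * (?y (tilt n (spike i (2 * b)) w \<omega>))\<^sup>2)) \<partial>std_gauss n)"
  proof -
    have "(\<lambda>\<omega>. ennreal (exp (b\<^sup>2 * (?y \<omega>)\<^sup>2))) \<in> borel_measurable (std_gauss n)" by measurable
    with i w(1) show ?thesis
      by (intro nn_integral_tilt_shift[where F = "\<lambda>\<omega>. ennreal (exp (b\<^sup>2 * (?y \<omega>)\<^sup>2))", symmetric])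
  qed
  also have "\<dots> = (\<integral>\<^sup>+\<omega>. ennreal (exp (b\<^sup>2 * (?y \<omega>)\<^sup>2)) \<partial>std_gauss n)"
    by (simp only: y)
  also have "\<dots> = (\<integral>\<^sup>+x. ennreal (std_normal_density x) * ennreal (exp (b\<^sup>2 * x\<^sup>2)) \<partial>lborel)"
    by (rule distributed_nn_integral[OF D, symmetric]) simp
  also have "\<dots> = (\<integral>\<^sup>+x. ennreal (exp (b\<^sup>2 * x\<^sup>2)) \<partial>std_normal)"
    by (rule nn_integral_std_normal[symmetric]) measurable
  also have "\<dots> = ennreal (1 / sqrt (1 - 2 * b\<^sup>2))"
    using b by (intro nn_integral_std_normal_exp_square) auto
  also have "\<dots> \<le> ennreal (exp (2 * b\<^sup>2))"
    using b by (intro ennreal_leI inverse_sqrt_le_exp) auto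
  finally show ?thesis .
qed

text \<open>With variance 1 + a the second moment is exactly 1 / sqrt(1 - a^2), a correction of
  second order in a; hence N samples tolerate a of order 1 / sqrt N.\<close>

lemma nn_integral_scale_lr_square:
  assumes i: "i < n" and a: "0 \<le> a" "a\<^sup>2 \<le> 1 / 2"
  shows "(\<integral>\<^sup>+\<omega>. ennreal ((scale_lr i (sqrt (1 + a)) \<omega>)\<^sup>2) \<partial>std_gauss n) \<le> ennreal (exp (a\<^sup>2))"
proof -
  have a1: "a < 1"
  proof (rule ccontr)
    assume "\<not> a < 1"
    then have "1\<^sup>2 \<le> a\<^sup>2" by (intro power_mono) auto
    with a show False by simp
  qed
  define t where "t = 1 - 1 / (1 + a)"
  have t: "t < 1 / 2" "1 - 2 * t = (1 - a) / (1 + a)" using a a1 by (auto simp: t_def field_simps)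
  have sq: "(scale_lr i (sqrt (1 + a)) \<omega>)\<^sup>2 = exp (t * (\<omega> i)\<^sup>2) * (1 / (1 + a))" for \<omega>
  proof -
    have "2 * ((\<omega> i)\<^sup>2 / 2 - (\<omega> i)\<^sup>2 / (2 * (1 + a))) = t * (\<omega> i)\<^sup>2"
      using a by (simp add: t_def field_simps)
    then have "(exp ((\<omega> i)\<^sup>2 / 2 - (\<omega> i)\<^sup>2 / (2 * (1 + a))))\<^sup>2 = exp (t * (\<omega> i)\<^sup>2)"
      by (simp only: exp_double[symmetric])
    then show ?thesis using a by (simp add: scale_lr_def power_divide)
  qed
  have "(\<integral>\<^sup>+\<omega>. ennreal ((scale_lr i (sqrt (1 + a)) \<omega>)\<^sup>2) \<partial>std_gauss n)
      = (\<integral>\<^sup>+\<omega>. ennreal (exp (t * (\<omega> i)\<^sup>2)) \<partial>std_gauss n) * ennreal (1 / (1 + a))"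
    unfolding sq using i a by (subst nn_integral_multc[symmetric]) (auto simp flip: ennreal_mult)
  also have "(\<integral>\<^sup>+\<omega>. ennreal (exp (t * (\<omega> i)\<^sup>2)) \<partial>std_gauss n) = (\<integral>\<^sup>+x. ennreal (std_normal_density x) * ennreal (exp (t * x\<^sup>2)) \<partial>lborel)"
    by (rule distributed_nn_integral[OF distributed_std_gauss_component[OF i], symmetric]) simp
  also have "\<dots> = (\<integral>\<^sup>+x. ennreal (exp (t * x\<^sup>2)) \<partial>std_normal)"
    by (rule nn_integral_std_normal[symmetric]) measurable
  also have "\<dots> = ennreal (1 / sqrt (1 - 2 * t))"
    using t by (intro nn_integral_std_normal_exp_square)
  also have "\<dots> * ennreal (1 / (1 + a)) = ennreal (1 / sqrt (1 - a\<^sup>2))"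
  proof -
    have "sqrt ((1 - a) / (1 + a)) * (1 + a) = sqrt (1 - a\<^sup>2)"
    proof (rule real_sqrt_unique[symmetric])
      have "(sqrt ((1 - a) / (1 + a)) * (1 + a))\<^sup>2 = (1 - a) / (1 + a) * (1 + a)\<^sup>2"
        using a a1 by (simp add: power_mult_distrib)
      also have "\<dots> = (1 - a) * (1 + a)" using a by (simp add: power2_eq_square)
      finally show "(sqrt ((1 - a) / (1 + a)) * (1 + a))\<^sup>2 = 1 - a\<^sup>2"
        by (simp add: power2_eq_square algebra_simps)
    qed (use a a1 in auto)
    then show ?thesis using a a1 by (simp add: t(2) flip: ennreal_mult)
  qed
  also have "\<dots> \<le> ennreal (exp (a\<^sup>2))"
    using a by (intro ennreal_leI inverse_sqrt_le_exp) auto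
  finally show ?thesis .
qed

section \<open>Likelihood ratios of independent samples and the two-point bound\<close>

lemma density_PiM:
  assumes I: "finite I" and M: "prob_space M" and l[measurable]: "l \<in> borel_measurable M" and P: "prob_space (density M l)"
  shows "density (\<Pi>\<^sub>M i\<in>I. M) (\<lambda>\<omega>. \<Prod>i\<in>I. l (\<omega> i)) = (\<Pi>\<^sub>M i\<in>I. density M l)"
proof -
  interpret M: product_prob_space "\<lambda>_. M" I by (simp add: product_prob_spaceI M)
  interpret P: product_prob_space "\<lambda>_. density M l" I by (simp add: product_prob_spaceI P)
  have lm[measurable]: "(\<lambda>\<omega>. \<Prod>i\<in>I. l (\<omega> i)) \<in> borel_measurable (\<Pi>\<^sub>M i\<in>I. M)"
    by measurable
  show ?thesis
  proof (rule P.PiM_eqI[OF I])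
    show "sets (density (\<Pi>\<^sub>M i\<in>I. M) (\<lambda>\<omega>. \<Prod>i\<in>I. l (\<omega> i))) = sets (\<Pi>\<^sub>M i\<in>I. density M l)"
      by (simp, intro sets_PiM_cong) auto
    fix A assume A: "\<And>i. i \<in> I \<Longrightarrow> A i \<in> sets (density M l)"
    have "emeasure (density (\<Pi>\<^sub>M i\<in>I. M) (\<lambda>\<omega>. \<Prod>i\<in>I. l (\<omega> i))) (Pi\<^sub>E I A)
        = (\<integral>\<^sup>+\<omega>. (\<Prod>i\<in>I. l (\<omega> i)) * indicator (Pi\<^sub>E I A) \<omega> \<partial>(\<Pi>\<^sub>M i\<in>I. M))"
      using A I by (subst emeasure_density) (auto intro!: sets_PiM_I_finite)
    also have "\<dots> = (\<integral>\<^sup>+\<omega>. (\<Prod>i\<in>I. l (\<omega> i) * indicator (A i) (\<omega> i)) \<partial>(\<Pi>\<^sub>M i\<in>I. M))"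
    proof (intro nn_integral_cong)
      fix \<omega> assume "\<omega> \<in> space (\<Pi>\<^sub>M i\<in>I. M)"
      then have "\<omega> \<in> extensional I" by (simp add: space_PiM PiE_def)
      then have "indicator (Pi\<^sub>E I A) \<omega> = (\<Prod>i\<in>I. indicator (A i) (\<omega> i) :: ennreal)"
        using I by (auto simp: indicator_def PiE_iff prod_zero_iff)
      then show "(\<Prod>i\<in>I. l (\<omega> i)) * indicator (Pi\<^sub>E I A) \<omega> = (\<Prod>i\<in>I. l (\<omega> i) * indicator (A i) (\<omega> i))"
        by (simp add: prod.distrib)
    qed
    also have "\<dots> = (\<Prod>i\<in>I. \<integral>\<^sup>+x. l x * indicator (A i) x \<partial>M)"
      using A l by (intro M.product_nn_integral_prod I) auto
    also have "\<dots> = (\<Prod>i\<in>I. emeasure (density M l) (A i))"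
      using A l by (intro prod.cong) (auto simp: emeasure_density)
    finally show "emeasure (density (\<Pi>\<^sub>M i\<in>I. M) (\<lambda>\<omega>. \<Prod>i\<in>I. l (\<omega> i))) (Pi\<^sub>E I A) = (\<Prod>i\<in>I. emeasure (density M l) (A i))" .
  qed
qed

text \<open>Likelihood ratios multiply over independent samples, so a change of variables for one
  sample becomes one for the whole data set.\<close>

lemma nn_integral_PiM_compose:
  assumes I: "finite I" and M: "prob_space M" and T[measurable]: "T \<in> measurable M M" and l[measurable]: "l \<in> borel_measurable M"
    and eq: "\<And>F. F \<in> borel_measurable M \<Longrightarrow> (\<integral>\<^sup>+\<omega>. F (T \<omega>) \<partial>M) = (\<integral>\<^sup>+\<omega>. F \<omega> * l \<omega> \<partial>M)"
    and F: "F \<in> borel_measurable (\<Pi>\<^sub>M i\<in>I. M)"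
  shows "(\<integral>\<^sup>+\<omega>. F (compose I T \<omega>) \<partial>(\<Pi>\<^sub>M i\<in>I. M)) = (\<integral>\<^sup>+\<omega>. F \<omega> * (\<Prod>i\<in>I. l (\<omega> i)) \<partial>(\<Pi>\<^sub>M i\<in>I. M))"
proof -
  have d: "distr M M T = density M l" by (rule distr_eq_densityI[OF T l eq])
  have P: "prob_space (density M l)" using prob_space.prob_space_distr[OF M T] d by simp
  have "compose I T \<in> measurable (\<Pi>\<^sub>M i\<in>I. M) (\<Pi>\<^sub>M i\<in>I. M)"
    unfolding compose_def by measurable
  then have "(\<integral>\<^sup>+\<omega>. F (compose I T \<omega>) \<partial>(\<Pi>\<^sub>M i\<in>I. M)) = (\<integral>\<^sup>+\<omega>. F \<omega> \<partial>distr (\<Pi>\<^sub>M i\<in>I. M) (\<Pi>\<^sub>M i\<in>I. M) (compose I T))"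
    using F by (simp add: nn_integral_distr)
  also have "distr (\<Pi>\<^sub>M i\<in>I. M) (\<Pi>\<^sub>M i\<in>I. M) (compose I T) = (\<Pi>\<^sub>M i\<in>I. distr M M T)"
    using M T by (intro distr_PiM_finite_prob_space' I)
  also have "\<dots> = density (\<Pi>\<^sub>M i\<in>I. M) (\<lambda>\<omega>. \<Prod>i\<in>I. l (\<omega> i))"
    unfolding d by (rule density_PiM[OF I M l P, symmetric])
  also have "(\<integral>\<^sup>+\<omega>. F \<omega> \<partial>\<dots>) = (\<integral>\<^sup>+\<omega>. (\<Prod>i\<in>I. l (\<omega> i)) * F \<omega> \<partial>(\<Pi>\<^sub>M i\<in>I. M))"
    using F by (intro nn_integral_density) measurable
  finally show ?thesis by (simp add: mult.commute)
qed

text \<open>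
  Le Cam's two point bound, from the pointwise estimate \<open>min 1 L \<ge> L - L\<^sup>2 / 4\<close> for the
  likelihood ratio \<open>L\<close>.
\<close>

lemma two_point_bound:
  fixes L A B :: "'a \<Rightarrow> real"
  assumes [measurable]: "L \<in> borel_measurable M" "A \<in> borel_measurable M" "B \<in> borel_measurable M"
    and nonneg: "\<And>\<omega>. 0 \<le> L \<omega>" "\<And>\<omega>. 0 \<le> A \<omega>" "\<And>\<omega>. 0 \<le> B \<omega>" and \<delta>: "0 \<le> \<delta>"
    and sep: "\<And>\<omega>. \<delta> \<le> A \<omega> + B \<omega>"
    and L1: "(\<integral>\<^sup>+\<omega>. ennreal (L \<omega>) \<partial>M) = 1" and L2: "(\<integral>\<^sup>+\<omega>. ennreal ((L \<omega>)\<^sup>2) \<partial>M) \<le> 3"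
  shows "ennreal (\<delta> / 4) \<le> (\<integral>\<^sup>+\<omega>. ennreal (A \<omega>) \<partial>M) + (\<integral>\<^sup>+\<omega>. ennreal (B \<omega>) * ennreal (L \<omega>) \<partial>M)"
    (is "_ \<le> ?X")
proof -
  \<comment> \<open>For L <= 1 the separation is weighted by L and A L <= A; for L > 1 the bounds L
    <= 1 + L^2 / 4 and B <= B L are used instead.\<close>
  have pt: "\<delta> * L \<omega> \<le> A \<omega> + B \<omega> * L \<omega> + \<delta> / 4 * (L \<omega>)\<^sup>2" for \<omega>
  proof (cases "L \<omega> \<le> 1")
    case True
    have "\<delta> * L \<omega> \<le> (A \<omega> + B \<omega>) * L \<omega>" by (intro mult_right_mono sep nonneg)
    also have "\<dots> \<le> A \<omega> + B \<omega> * L \<omega>" using mult_left_mono[OF True nonneg(2)[of \<omega>]] by (simp add: distrib_right)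
    finally show ?thesis using \<delta> by (simp add: add_increasing2)
  next
    case False
    have "B \<omega> \<le> B \<omega> * L \<omega>" using mult_left_mono[of 1 "L \<omega>" "B \<omega>"] nonneg(3)[of \<omega>] False by simp
    moreover have "\<delta> * L \<omega> \<le> \<delta> * (1 + (L \<omega>)\<^sup>2 / 4)"
      using zero_le_power2[of "L \<omega> / 2 - 1"] by (intro mult_left_mono \<delta>) (simp add: power2_eq_square algebra_simps)
    ultimately show ?thesis using sep[of \<omega>] by (simp add: algebra_simps)
  qed
  have "ennreal \<delta> = (\<integral>\<^sup>+\<omega>. ennreal \<delta> * ennreal (L \<omega>) \<partial>M)"
    by (subst nn_integral_cmult) (auto simp: L1)
  also have "\<dots> \<le> (\<integral>\<^sup>+\<omega>. ennreal (A \<omega>) + ennreal (B \<omega>) * ennreal (L \<omega>) + ennreal (\<delta> / 4) * ennreal ((L \<omega>)\<^sup>2) \<partial>M)"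
    using nonneg \<delta> pt
    by (intro nn_integral_mono) (simp flip: ennreal_mult ennreal_plus add: ennreal_leI)
  also have "\<dots> = ?X + ennreal (\<delta> / 4) * (\<integral>\<^sup>+\<omega>. ennreal ((L \<omega>)\<^sup>2) \<partial>M)"
    by (simp add: nn_integral_add nn_integral_cmult)
  also have "\<dots> \<le> ?X + ennreal (\<delta> / 4) * 3" by (intro add_left_mono mult_left_mono L2) auto
  also have "ennreal (\<delta> / 4) * 3 = ennreal (3 * \<delta> / 4)"
    using \<delta> by (metis ennreal_mult' ennreal_numeral mult.commute times_divide_eq_right zero_le_numeral divide_nonneg_nonneg)
  \<comment> \<open>A second moment of at most 3 leaves \<delta> / 4. The subtraction is legitimate
    once \<open>?X\<close> is known to be finite.\<close>
  finally have le: "ennreal \<delta> \<le> ?X + ennreal (3 * \<delta> / 4)" .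
  show ?thesis
  proof (cases ?X)
    case (real x)
    then have "\<delta> \<le> x + 3 * \<delta> / 4" using le \<delta> by (simp flip: ennreal_plus)
    then show ?thesis using real by (simp add: ennreal_leI)
  next
    case top
    show ?thesis unfolding top by simp
  qed
qed

subsection \<open>Bounds for the risk of an estimator\<close>

(* Prevents the index set {1..N} of the samples from being rewritten to {Suc 0..N}. *)
declare One_nat_def [simp del]

lemma ennreal_le_mult_divide:
  assumes "0 < a" "a \<le> b"
  shows "X \<le> ennreal b * (X / ennreal a)"
proof -
  have "X = X / ennreal a * ennreal a"
    using assms by (simp add: ennreal_divide_times mult_divide_eq_ennreal)
  also have "\<dots> \<le> X / ennreal a * ennreal b" using assms by (intro mult_left_mono ennreal_leI) auto
  finally show ?thesis by (simp add: mult.commute)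
qed

lemma sum_mult_spike: "i < n \<Longrightarrow> (\<Sum>j<n. f j * spike i b j) = b * f i"
  using sum_spike_mult[of i n b f] by (simp add: mult.commute)

lemma tilt_spike_zero: "i < n \<Longrightarrow> tilt n (spike j 0) w \<xi> i = \<xi> i"
  by (simp add: tilt_def spike_def)

abbreviation worst_risk ::
    "nat \<Rightarrow> ((nat \<Rightarrow> real ^ 'd \<Rightarrow> real) \<Rightarrow> 'd kernel) \<Rightarrow> ('d::finite) kernel set \<Rightarrow> ennreal" where
  "worst_risk N \<kappa> F \<equiv> (SUP (k, P)\<in>{(k, P). k \<in> F \<and> gp_law k P}. relative_risk N \<kappa> k P)"

abbreviation gauss_samples :: "nat \<Rightarrow> nat \<Rightarrow> (nat \<Rightarrow> nat \<Rightarrow> real) measure" where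
  "gauss_samples N n \<equiv> (\<Pi>\<^sub>M k\<in>{1..N}. std_gauss n)"

lemma prob_space_gauss_samples: "prob_space (gauss_samples N n)"
  by (intro prob_space_PiM prob_space_std_gauss)

lemma nn_integral_gauss_samples_prod:
  assumes "f \<in> borel_measurable (std_gauss n)"
  shows "(\<integral>\<^sup>+\<Omega>. (\<Prod>k\<in>{1..N}. f (\<Omega> k)) \<partial>gauss_samples N n) = (\<integral>\<^sup>+\<omega>. f \<omega> \<partial>std_gauss n) ^ N"
proof -
  interpret G: prob_space "std_gauss n" by (rule prob_space_std_gauss)
  interpret product_prob_space "\<lambda>_ :: nat. std_gauss n" UNIV by standard
  show ?thesis using assms by (subst product_nn_integral_prod) auto
qed

context cell_family
begin

text \<open>Realises all covariances on the same space of standard Gaussian samples.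
  \<open>compose\<close> restricts to the index set, as points of the product space
  \<open>data_space N\<close> must be extensional.\<close>

definition data_of :: "nat \<Rightarrow> (nat \<Rightarrow> real) \<Rightarrow> (nat \<Rightarrow> real) \<Rightarrow> (nat \<Rightarrow> nat \<Rightarrow> real) \<Rightarrow> nat \<Rightarrow> real ^ 'd \<Rightarrow> real" where
  "data_of N \<beta> w = compose {1..N} (\<lambda>\<omega>. cell_path (tilt n \<beta> w \<omega>))"

text \<open>Matrix coefficients are the only features of an estimator that the lower bounds use;
  their measurability in the data is part of \<open>estimators\<close>.\<close>

definition coeff_est :: "((nat \<Rightarrow> real ^ 'd \<Rightarrow> real) \<Rightarrow> real ^ 'd \<Rightarrow> real ^ 'd \<Rightarrow> real) \<Rightarrow>
    (nat \<Rightarrow> real) \<Rightarrow> (nat \<Rightarrow> real) \<Rightarrow> (nat \<Rightarrow> real ^ 'd \<Rightarrow> real) \<Rightarrow> real" where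
  "coeff_est \<kappa> c b u =
     L2_inner (integral_op (\<kappa> u) (\<lambda>x. \<Sum>i<n. c i * cell_fun i x)) (\<lambda>x. \<Sum>i<n. b i * cell_fun i x)"

lemma path_measurable [measurable]: "(\<lambda>\<omega>. cell_path (tilt n \<beta> w \<omega>)) \<in> measurable (std_gauss n) path_space"
  by (rule measurable_compose[OF tilt_measurable cell_path_measurable])

lemma data_of_measurable [measurable]: "data_of N \<beta> w \<in> measurable (gauss_samples N n) (data_space N)"
  unfolding data_of_def compose_def data_space_def by measurable

lemma coeff_est_measurable [measurable]:
  "\<kappa> \<in> estimators N \<Longrightarrow> coeff_est \<kappa> c b \<in> borel_measurable (data_space N)"
  unfolding coeff_est_def[abs_def] estimators_def using L2_cell_sum by blast

text \<open>\<open>G\<close> is a measurable lower bound for the loss: the transfer to Gaussian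
  samples is applied to \<open>G\<close>, and the operator norm of the error enters only through
  monotonicity of the integral. The bound \<open>R\<close> on the norm of the covariance turns
  relative into absolute risk.\<close>

lemma nn_integral_data_le_risk:
  assumes w: "(\<Sum>j<n. (w j)\<^sup>2) = 1"
    and G: "G \<in> borel_measurable (data_space N)"
    and le: "\<And>u. u \<in> space (data_space N) \<Longrightarrow>
      G u \<le> op_norm (\<lambda>\<psi> x. integral_op (\<kappa> u) \<psi> x - integral_op (cell_kernel (tilt_cov \<beta> w)) \<psi> x)"
    and norm: "0 < op_norm (integral_op (cell_kernel (tilt_cov \<beta> w)))"
      "op_norm (integral_op (cell_kernel (tilt_cov \<beta> w))) \<le> R"
    and F: "cell_kernel (tilt_cov \<beta> w) \<in> F"
  shows "(\<integral>\<^sup>+\<Omega>. ennreal (G (data_of N \<beta> w \<Omega>)) \<partial>gauss_samples N n)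
    \<le> ennreal R * worst_risk N \<kappa> F"
proof -
  let ?k = "cell_kernel (tilt_cov \<beta> w)" and ?f = "\<lambda>\<omega>. cell_path (tilt n \<beta> w \<omega>)"
  define P where "P = distr (std_gauss n) path_space ?f"
  have sets_P: "sets P = sets path_space" by (simp add: P_def)
  have fP: "?f \<in> measurable (std_gauss n) P"
    using path_measurable by (simp add: measurable_cong_sets[OF refl sets_P])
  have dP: "distr (std_gauss n) P ?f = P"
    unfolding P_def by (rule distr_cong) (simp_all add: P_def)
  have pP: "prob_space P" unfolding P_def by (intro prob_space.prob_space_distr prob_space_std_gauss path_measurable)
  have sets_PP: "sets (\<Pi>\<^sub>M i\<in>{1..N}. P) = sets (data_space N)"
    unfolding data_space_def by (intro sets_PiM_cong) (auto simp: sets_P)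
  have law: "distr (gauss_samples N n) (\<Pi>\<^sub>M i\<in>{1..N}. P) (data_of N \<beta> w) = (\<Pi>\<^sub>M i\<in>{1..N}. P)"
    unfolding data_of_def using fP pP
    by (subst distr_PiM_finite_prob_space') (auto simp: dP prob_space_std_gauss)
  have "(\<integral>\<^sup>+\<Omega>. ennreal (G (data_of N \<beta> w \<Omega>)) \<partial>gauss_samples N n) = (\<integral>\<^sup>+u. ennreal (G u) \<partial>(\<Pi>\<^sub>M i\<in>{1..N}. P))"
  proof (subst law[symmetric], subst nn_integral_distr)
    show "data_of N \<beta> w \<in> measurable (gauss_samples N n) (\<Pi>\<^sub>M i\<in>{1..N}. P)"
      unfolding measurable_cong_sets[OF refl sets_PP] by (rule data_of_measurable)
    have "G \<in> borel_measurable (\<Pi>\<^sub>M i\<in>{1..N}. P)"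
      unfolding measurable_cong_sets[OF sets_PP refl] by (rule G)
    then show "(\<lambda>u. ennreal (G u)) \<in> borel_measurable (distr (gauss_samples N n) (\<Pi>\<^sub>M i\<in>{1..N}. P) (data_of N \<beta> w))"
      by simp
  qed simp
  also have "\<dots> \<le> (\<integral>\<^sup>+u. ennreal (op_norm (\<lambda>\<psi> x. integral_op (\<kappa> u) \<psi> x - integral_op ?k \<psi> x)) \<partial>(\<Pi>\<^sub>M i\<in>{1..N}. P))"
    using le by (intro nn_integral_mono ennreal_leI) (auto simp: sets_eq_imp_space_eq[OF sets_PP])
  also have "\<dots> \<le> ennreal R * relative_risk N \<kappa> ?k P"
    unfolding relative_risk_def by (rule ennreal_le_mult_divide[OF norm])
  also have "\<dots> \<le> ennreal R * worst_risk N \<kappa> F"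
  proof (rule mult_left_mono)
    have "gp_law ?k P" unfolding P_def by (rule gp_law_cell_path[OF w])
    then show "relative_risk N \<kappa> ?k P \<le> worst_risk N \<kappa> F"
      using F by (intro SUP_upper2[of "(?k, P)"]) auto
  qed simp
  finally show ?thesis .
qed

text \<open>Testing on \<open>c\<close> and on a normalised sign vector supported in
  \<open>I\<close> gives an l1 error of matrix coefficients, a form that splits over coordinates as
  Assouad's argument requires. A singleton \<open>I\<close> serves the diagonal
  alternatives.\<close>

lemma coeff_error_le_op_norm:
  assumes \<kappa>: "\<kappa> \<in> estimators N" and u: "u \<in> space (data_space N)"
    and sym: "\<forall>i<n. \<forall>j<n. A i j = A j i"
    and c: "(\<Sum>i<n. (c i)\<^sup>2) \<le> 1" and I: "I \<subseteq> {..<n}" "I \<noteq> {}"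
  shows "(\<Sum>i\<in>I. \<bar>coeff_est \<kappa> c (spike i 1) u - (\<Sum>j<n. A i j * c j)\<bar>) / sqrt (card I)
    \<le> op_norm (\<lambda>\<psi> x. integral_op (\<kappa> u) \<psi> x - integral_op (cell_kernel A) \<psi> x)"
proof -
  let ?T = "\<lambda>\<psi> x. integral_op (\<kappa> u) \<psi> x - integral_op (cell_kernel A) \<psi> x"
  let ?e = "\<lambda>i. coeff_est \<kappa> c (spike i 1) u - (\<Sum>j<n. A i j * c j)"
  let ?f = "\<lambda>x. \<Sum>i<n. c i * cell_fun i x"
  have fin: "finite I" using I finite_subset by blast
  then have card: "0 < card I" using I by (simp add: card_gt_0_iff)
  \<comment> \<open>Coordinates with zero error get weight 0, so the norm of this vector is at most
    1 and possibly smaller.\<close>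
  define b where "b i = (if i \<in> I then sgn (?e i) / sqrt (card I) else 0)" for i
  let ?g = "\<lambda>x. \<Sum>i<n. b i * cell_fun i x"
  have bk: "bounded_integral_kernel (\<kappa> u)" using \<kappa> u by (auto simp: estimators_def)
  then obtain C where C: "\<And>\<psi>. L2 \<psi> \<Longrightarrow> L2_norm (integral_op (\<kappa> u) \<psi>) \<le> C * L2_norm \<psi>"
    unfolding bounded_integral_kernel_def by blast
  have L\<kappa>: "L2 (integral_op (\<kappa> u) \<psi>)" if "L2 \<psi>" for \<psi>
    using bk that unfolding bounded_integral_kernel_def by blast
  obtain R where R: "\<And>\<psi>. L2 \<psi> \<Longrightarrow> L2_norm (integral_op (cell_kernel A) \<psi>) \<le> R * L2_norm \<psi>"
    using L2_norm_cell_kernel_bounded[OF sym] by metis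
  have T: "L2_norm (?T \<psi>) \<le> (C + R) * L2_norm \<psi>" if \<psi>: "L2 \<psi>" for \<psi>
  proof -
    have "L2_norm (?T \<psi>) = L2_norm (\<lambda>x. integral_op (\<kappa> u) \<psi> x + - 1 * integral_op (cell_kernel A) \<psi> x)" by simp
    also have "\<dots> \<le> L2_norm (integral_op (\<kappa> u) \<psi>) + L2_norm (\<lambda>x. - 1 * integral_op (cell_kernel A) \<psi> x)"
      using L\<kappa>[OF \<psi>] L2_integral_op_cell_kernel[OF \<psi>] by (intro L2_norm_triangle L2_cmult) auto
    also have "\<dots> = L2_norm (integral_op (\<kappa> u) \<psi>) + L2_norm (integral_op (cell_kernel A) \<psi>)"
      by (subst L2_norm_cmult) simp
    also have "\<dots> \<le> (C + R) * L2_norm \<psi>" using C[OF \<psi>] R[OF \<psi>] by (simp add: distrib_right)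
    finally show ?thesis .
  qed
  have f1: "L2_norm ?f \<le> 1"
    by (rule power2_le_imp_le) (use c in \<open>simp_all add: L2_norm_cell_sum\<close>)
  have "(\<Sum>i<n. (b i)\<^sup>2) = (\<Sum>i\<in>I. (b i)\<^sup>2)"
    using I by (intro sum.mono_neutral_right) (auto simp: b_def)
  also have "\<dots> \<le> (\<Sum>i\<in>I. 1 / card I)"
    by (intro sum_mono) (auto simp: b_def power_divide sgn_if)
  also have "\<dots> = 1" using card by simp
  finally have b1: "(\<Sum>i<n. (b i)\<^sup>2) \<le> 1" .
  have g1: "L2_norm ?g \<le> 1"
    by (rule power2_le_imp_le) (use b1 in \<open>simp_all add: L2_norm_cell_sum\<close>)
  have lin: "coeff_est \<kappa> c b' u = (\<Sum>i<n. b' i * L2_inner (integral_op (\<kappa> u) ?f) (cell_fun i))" for b'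
    unfolding coeff_est_def using L\<kappa>[OF L2_cell_sum]
    by (subst L2_inner_sum_right) (auto intro: L2_cell_fun)
  have spike: "coeff_est \<kappa> c (spike i 1) u = L2_inner (integral_op (\<kappa> u) ?f) (cell_fun i)" if "i < n" for i
    unfolding lin sum_spike_mult[OF that] by simp
  have "L2_inner (?T ?f) ?g = coeff_est \<kappa> c b u - (\<Sum>i<n. \<Sum>j<n. A i j * (c j * b i))"
    unfolding coeff_est_def L2_inner_integral_op_cell_sums[symmetric]
    by (intro L2_inner_diff_left L\<kappa> L2_integral_op_cell_kernel L2_cell_sum)
  also have "\<dots> = (\<Sum>i<n. b i * ?e i)"
  proof -
    have "(\<Sum>i<n. b i * ?e i) = (\<Sum>i<n. b i * L2_inner (integral_op (\<kappa> u) ?f) (cell_fun i)) - (\<Sum>i<n. b i * (\<Sum>j<n. A i j * c j))"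
      by (simp add: spike right_diff_distrib sum_subtractf)
    moreover have "(\<Sum>i<n. \<Sum>j<n. A i j * (c j * b i)) = (\<Sum>i<n. b i * (\<Sum>j<n. A i j * c j))"
      by (simp add: sum_distrib_left mult_ac)
    ultimately show ?thesis by (simp only: lin)
  qed
  also have "\<dots> = (\<Sum>i\<in>I. b i * ?e i)"
    using I by (intro sum.mono_neutral_right) (auto simp: b_def)
  also have "\<dots> = (\<Sum>i\<in>I. \<bar>?e i\<bar>) / sqrt (card I)"
    unfolding sum_divide_distrib by (intro sum.cong) (auto simp: b_def sgn_if)
  finally have eq: "L2_inner (?T ?f) ?g = (\<Sum>i\<in>I. \<bar>?e i\<bar>) / sqrt (card I)" .
  have "L2_inner (?T ?f) ?g \<le> op_norm ?T"
    using op_norm_ge_inner[of ?T "C + R" ?f ?g, OF T L2_cell_sum f1 L2_diff[OF L\<kappa>[OF L2_cell_sum]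
          L2_integral_op_cell_kernel[OF L2_cell_sum]] L2_cell_sum g1] by linarith
  then show ?thesis unfolding eq .
qed

lemma cell_path_cong: "(\<And>i. i < n \<Longrightarrow> \<xi> i = \<xi>' i) \<Longrightarrow> cell_path \<xi> = cell_path \<xi>'"
  by (auto simp: cell_path_def fun_eq_iff intro!: sum.cong)

text \<open>Another covariance amounts to another Gaussian input, sample by sample, under the same
  data map; likelihood ratios are thus computed for vectors instead of paths.\<close>

lemma data_of_compose_tilt:
  assumes "\<And>\<omega> i. i < n \<Longrightarrow> tilt n \<beta>' w' \<omega> i = tilt n \<beta> w (T \<omega>) i"
  shows "data_of N \<beta>' w' \<Omega> = data_of N \<beta> w (compose {1..N} T \<Omega>)"
proof
  fix k
  have "cell_path (tilt n \<beta>' w' \<omega>) = cell_path (tilt n \<beta> w (T \<omega>))" for \<omega>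
    using assms by (intro cell_path_cong)
  then show "data_of N \<beta>' w' \<Omega> k = data_of N \<beta> w (compose {1..N} T \<Omega>) k"
    by (simp add: data_of_def compose_def)
qed

text \<open>
  Averaging the alternatives, one inflated variance each, over the \<open>n\<close> cells reduces the second moment
  of the likelihood ratio to \<open>1 + exp (N a\<^sup>2) / n\<close>; this is where the logarithm comes from.
\<close>

lemma minimax_scale_bound:
  assumes n: "0 < n" and N: "0 < N" and \<kappa>: "\<kappa> \<in> estimators N"
    and a: "0 \<le> a" "a\<^sup>2 \<le> 1 / 2" "exp (real N * a\<^sup>2) \<le> 2 * real n"
    and F: "cell_kernel (tilt_cov (spike 0 0) (spike 0 1)) \<in> F"
      "\<And>i. i < n \<Longrightarrow> cell_kernel (tilt_cov (spike i (sqrt (1 + a) - 1)) (spike i 1)) \<in> F"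
    and norm: "0 < op_norm (integral_op (cell_kernel (tilt_cov (spike 0 0) (spike 0 1))))"
      "op_norm (integral_op (cell_kernel (tilt_cov (spike 0 0) (spike 0 1)))) \<le> 2"
      "\<And>i. i < n \<Longrightarrow> 0 < op_norm (integral_op (cell_kernel (tilt_cov (spike i (sqrt (1 + a) - 1)) (spike i 1))))"
      "\<And>i. i < n \<Longrightarrow> op_norm (integral_op (cell_kernel (tilt_cov (spike i (sqrt (1 + a) - 1)) (spike i 1)))) \<le> 2"
  shows "ennreal (a / 16) \<le> worst_risk N \<kappa> F" (is "_ \<le> ?S")
proof -
  \<comment> \<open>Scaling a coordinate by 1 + \<alpha> makes its variance exactly 1 + a, which
    separates the hypotheses by a.\<close>
  define \<alpha> where "\<alpha> = sqrt (1 + a) - 1"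
  have \<alpha>: "0 < 1 + \<alpha>" "1 + \<alpha> = sqrt (1 + a)" using a by (auto simp: \<alpha>_def add_pos_nonneg)
  \<comment> \<open>\<open>spike 0 0\<close> with \<open>spike 0 1\<close> encodes the identity
    covariance, the null hypothesis, within the family of tilts.\<close>
  let ?M = "gauss_samples N n" and ?D = "data_of N (spike 0 0) (spike 0 1)"
  interpret M: prob_space ?M by (rule prob_space_gauss_samples)
  define h where "h i u = coeff_est \<kappa> (spike i 1) (spike i 1) u" for i u
  have hm[measurable]: "h i \<in> borel_measurable (data_space N)" for i
    unfolding h_def[abs_def] using \<kappa> by measurable
  define \<Lambda> where "\<Lambda> i \<Omega> = (\<Prod>k\<in>{1..N}. scale_lr i (1 + \<alpha>) (\<Omega> k))" for i and \<Omega> :: "nat \<Rightarrow> nat \<Rightarrow> real"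
  have \<Lambda>0: "0 \<le> \<Lambda> i \<Omega>" for i \<Omega> unfolding \<Lambda>_def using \<alpha> by (intro prod_nonneg scale_lr_nonneg ballI)
  have \<Lambda>m[measurable]: "\<Lambda> i \<in> borel_measurable ?M" if "i < n" for i
    unfolding \<Lambda>_def[abs_def] using that by measurable
  have \<Lambda>e: "(\<lambda>\<Omega>. ennreal (\<Lambda> i \<Omega>)) \<in> borel_measurable ?M" if "i < n" for i
    using \<Lambda>m[OF that] by measurable
  have \<Lambda>\<Lambda>e: "(\<lambda>\<Omega>. ennreal (\<Lambda> i \<Omega> * \<Lambda> j \<Omega>)) \<in> borel_measurable ?M" if "i < n" "j < n" for i j
    using \<Lambda>m[OF that(1)] \<Lambda>m[OF that(2)] by measurable
  let ?T = "\<lambda>i. tilt n (spike i \<alpha>) (spike i 1)"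
  have change: "(\<integral>\<^sup>+\<Omega>. H (compose {1..N} (?T i) \<Omega>) \<partial>?M) = (\<integral>\<^sup>+\<Omega>. H \<Omega> * ennreal (\<Lambda> i \<Omega>) \<partial>?M)"
    if i: "i < n" and H: "H \<in> borel_measurable ?M" for i H
  proof -
    have "(\<integral>\<^sup>+\<Omega>. H (compose {1..N} (?T i) \<Omega>) \<partial>?M)
        = (\<integral>\<^sup>+\<Omega>. H \<Omega> * (\<Prod>k\<in>{1..N}. ennreal (scale_lr i (1 + \<alpha>) (\<Omega> k))) \<partial>?M)"
    proof (rule nn_integral_PiM_compose)
      show "(\<integral>\<^sup>+\<omega>. F (?T i \<omega>) \<partial>std_gauss n) = (\<integral>\<^sup>+\<omega>. F \<omega> * ennreal (scale_lr i (1 + \<alpha>) \<omega>) \<partial>std_gauss n)"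
        if "F \<in> borel_measurable (std_gauss n)" for F
        by (rule nn_integral_tilt_scale[OF i \<alpha>(1) that])
    qed (use H i prob_space_std_gauss in auto)
    then show ?thesis unfolding \<Lambda>_def using \<alpha> by (simp add: prod_ennreal scale_lr_nonneg)
  qed
  have \<Lambda>1: "(\<integral>\<^sup>+\<Omega>. ennreal (\<Lambda> i \<Omega>) \<partial>?M) = 1" if "i < n" for i
    using change[OF that, of "\<lambda>_. 1"] by (simp add: M.emeasure_space_1)
  have scale1: "(\<integral>\<^sup>+\<omega>. ennreal (scale_lr i (1 + \<alpha>) \<omega>) \<partial>std_gauss n) = 1" if "i < n" for i
    using nn_integral_tilt_scale[OF that \<alpha>(1), of "\<lambda>_. 1"] prob_space.emeasure_space_1[OF prob_space_std_gauss]
    by simp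
  \<comment> \<open>Ratios of different cells depend on different coordinates and have mean 1; only
    the diagonal terms carry exp(N a^2).\<close>
  have \<Lambda>2: "(\<integral>\<^sup>+\<Omega>. ennreal (\<Lambda> i \<Omega> * \<Lambda> j \<Omega>) \<partial>?M) \<le> (if i = j then ennreal (exp (real N * a\<^sup>2)) else 1)"
    if ij: "i < n" "j < n" for i j
  proof -
    let ?l = "\<lambda>\<omega>. scale_lr i (1 + \<alpha>) \<omega> * scale_lr j (1 + \<alpha>) \<omega>"
    have "(\<integral>\<^sup>+\<Omega>. ennreal (\<Lambda> i \<Omega> * \<Lambda> j \<Omega>) \<partial>?M) = (\<integral>\<^sup>+\<Omega>. (\<Prod>k\<in>{1..N}. ennreal (?l (\<Omega> k))) \<partial>?M)"
      unfolding \<Lambda>_def prod.distrib[symmetric] using \<alpha> by (simp add: prod_ennreal scale_lr_nonneg)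
    also have "\<dots> = (\<integral>\<^sup>+\<omega>. ennreal (?l \<omega>) \<partial>std_gauss n) ^ N"
      using ij by (intro nn_integral_gauss_samples_prod) measurable
    also have "\<dots> \<le> (if i = j then ennreal (exp (real N * a\<^sup>2)) else 1)"
    proof (cases "i = j")
      case True
      have "(\<integral>\<^sup>+\<omega>. ennreal (?l \<omega>) \<partial>std_gauss n) ^ N \<le> ennreal (exp (a\<^sup>2)) ^ N"
        using nn_integral_scale_lr_square[OF ij(1) a(1,2)]
        by (intro power_mono) (auto simp: True power2_eq_square \<alpha>(2))
      also have "\<dots> = ennreal (exp (real N * a\<^sup>2))" by (simp add: ennreal_power exp_of_nat_mult)
      finally show ?thesis using True by simp
    next
      case False
      have "scale_lr j (1 + \<alpha>) (?T i \<omega>) = scale_lr j (1 + \<alpha>) \<omega>" for \<omega>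
        using False ij by (simp add: scale_lr_def tilt_def spike_def)
      then have "(\<integral>\<^sup>+\<omega>. ennreal (?l \<omega>) \<partial>std_gauss n) = 1"
        using nn_integral_tilt_scale[OF ij(1) \<alpha>(1), of "\<lambda>\<omega>. ennreal (scale_lr j (1 + \<alpha>) \<omega>)"] scale1[OF ij(2)] \<alpha> ij
        by (simp add: ennreal_mult scale_lr_nonneg mult.commute)
      then show ?thesis using False by simp
    qed
    finally show ?thesis .
  qed
  define L where "L \<Omega> = (\<Sum>i<n. \<Lambda> i \<Omega>) / real n" for \<Omega>
  \<comment> \<open>The mixture needs losses that do not depend on the alternative. \<open>A\<close>
    dominates the null error at every cell, so \<open>E\<close> is at most the error under
    alternative \<open>i\<close>, for every \<open>i\<close>; one pair with \<open>A + E\<close> at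
    least \<open>a\<close> serves all components.\<close>
  define A where "A \<Omega> = Max ((\<lambda>i. \<bar>h i (?D \<Omega>) - 1\<bar>) ` {..<n})" for \<Omega>
  define E where "E \<Omega> = max 0 (a - A \<Omega>)" for \<Omega>
  have ne: "{..<n} \<noteq> {}" using n by auto
  have A_ge: "\<bar>h i (?D \<Omega>) - 1\<bar> \<le> A \<Omega>" if "i < n" for i \<Omega>
    unfolding A_def using that by (intro Max_ge) auto
  have Am: "A \<in> borel_measurable ?M" unfolding A_def[abs_def] by measurable
  have Em: "E \<in> borel_measurable ?M" unfolding E_def[abs_def] using Am by measurable
  have Lm: "L \<in> borel_measurable ?M" unfolding L_def[abs_def] by measurable
  have L0: "0 \<le> L \<Omega>" for \<Omega> unfolding L_def by (intro divide_nonneg_nonneg sum_nonneg \<Lambda>0) auto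
  have "(\<integral>\<^sup>+\<Omega>. ennreal (L \<Omega>) \<partial>?M) = (\<integral>\<^sup>+\<Omega>. ennreal (1 / real n) * (\<Sum>i<n. ennreal (\<Lambda> i \<Omega>)) \<partial>?M)"
    unfolding L_def using \<Lambda>0 by (simp add: sum_ennreal sum_nonneg flip: ennreal_mult)
  also have "\<dots> = ennreal (1 / real n) * (\<Sum>i<n. (\<integral>\<^sup>+\<Omega>. ennreal (\<Lambda> i \<Omega>) \<partial>?M))"
    by (subst nn_integral_cmult, simp, subst nn_integral_sum) (auto intro: \<Lambda>e)
  also have "\<dots> = 1" using n by (simp add: \<Lambda>1 ennreal_of_nat_eq_real_of_nat flip: ennreal_mult)
  finally have L1: "(\<integral>\<^sup>+\<Omega>. ennreal (L \<Omega>) \<partial>?M) = 1" .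
  have "(\<integral>\<^sup>+\<Omega>. ennreal ((L \<Omega>)\<^sup>2) \<partial>?M) = (\<integral>\<^sup>+\<Omega>. ennreal (1 / (real n)\<^sup>2) * (\<Sum>i<n. \<Sum>j<n. ennreal (\<Lambda> i \<Omega> * \<Lambda> j \<Omega>)) \<partial>?M)"
    unfolding L_def using \<Lambda>0
    by (simp add: sum_ennreal sum_nonneg power_divide power2_eq_square sum_product flip: ennreal_mult)
  also have "\<dots> = ennreal (1 / (real n)\<^sup>2) * (\<Sum>i<n. \<Sum>j<n. (\<integral>\<^sup>+\<Omega>. ennreal (\<Lambda> i \<Omega> * \<Lambda> j \<Omega>) \<partial>?M))"
    by (subst nn_integral_cmult, simp, subst nn_integral_sum, simp)
      (auto intro!: arg_cong2[where f = "(*)"] sum.cong nn_integral_sum \<Lambda>\<Lambda>e)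
  also have "\<dots> \<le> ennreal (1 / (real n)\<^sup>2) * (\<Sum>i<n. \<Sum>j<n. (if i = j then ennreal (exp (real N * a\<^sup>2)) else 0) + 1)"
  proof (intro mult_left_mono sum_mono)
    fix i j assume "i \<in> {..<n}" "j \<in> {..<n}"
    then show "(\<integral>\<^sup>+\<Omega>. ennreal (\<Lambda> i \<Omega> * \<Lambda> j \<Omega>) \<partial>?M) \<le> (if i = j then ennreal (exp (real N * a\<^sup>2)) else 0) + 1"
      using \<Lambda>2[of i j] by (auto simp: add_increasing2 split: if_splits)
  qed simp
  also have "(\<Sum>i<n. \<Sum>j<n. (if i = j then ennreal (exp (real N * a\<^sup>2)) else 0) + 1)
     = ennreal (real n * exp (real N * a\<^sup>2) + (real n)\<^sup>2)"
    by (simp add: sum.distrib distrib_left ennreal_of_nat_eq_real_of_nat power2_eq_square flip: ennreal_mult ennreal_plus)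
  also have "ennreal (1 / (real n)\<^sup>2) * \<dots> = ennreal (exp (real N * a\<^sup>2) / real n + 1)"
  proof -
    have "1 / (real n)\<^sup>2 * (real n * exp (real N * a\<^sup>2) + (real n)\<^sup>2) = exp (real N * a\<^sup>2) / real n + 1"
      using n by (simp add: field_simps power2_eq_square)
    then show ?thesis by (subst ennreal_mult[symmetric]) (simp, simp, simp only:)
  qed
  \<comment> \<open>The assumption on \<open>a\<close> gives exp(N a^2) / n <= 2, so the mixture
    meets the threshold of \<open>two_point_bound\<close>.\<close>
  also have "\<dots> \<le> ennreal 3" using a(3) n by (intro ennreal_leI) (simp add: field_simps)
  finally have L2: "(\<integral>\<^sup>+\<Omega>. ennreal ((L \<Omega>)\<^sup>2) \<partial>?M) \<le> 3" by simp
  have sum1: "(\<Sum>j<n. (spike i 1 j)\<^sup>2) = 1" if "i < n" for i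
    using sum_spike_mult[OF that, of 1 "spike i 1"] by (simp add: power2_eq_square) (simp add: spike_def)
  have err: "\<bar>h i u - (1 + b)\<^sup>2\<bar> \<le> op_norm (\<lambda>\<psi> x. integral_op (\<kappa> u) \<psi> x - integral_op (cell_kernel (tilt_cov (spike j b) (spike j 1))) \<psi> x)"
    if "u \<in> space (data_space N)" "i < n" "i = j \<or> b = 0" for u i j b
  proof -
    have "(\<Sum>l<n. tilt_cov (spike j b) (spike j 1) i l * spike i 1 l) = (1 + b)\<^sup>2"
      unfolding sum_mult_spike[OF that(2)] using that(3)
      by (auto simp: tilt_cov_def spike_def power2_eq_square algebra_simps)
    then show ?thesis
      using coeff_error_le_op_norm[OF \<kappa> that(1), of "tilt_cov (spike j b) (spike j 1)" "spike i 1" "{i}"] that sum1[OF that(2)]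
        tilt_cov_commute[of "spike j b" "spike j 1"]
      by (simp add: h_def)
  qed
  have R0: "(\<integral>\<^sup>+\<Omega>. ennreal (A \<Omega>) \<partial>?M) \<le> ennreal 2 * ?S"
    unfolding A_def
  proof (rule nn_integral_data_le_risk[where G = "\<lambda>u. Max ((\<lambda>i. \<bar>h i u - 1\<bar>) ` {..<n})"])
    show "(\<lambda>u. Max ((\<lambda>i. \<bar>h i u - 1\<bar>) ` {..<n})) \<in> borel_measurable (data_space N)" by measurable
    show "Max ((\<lambda>i. \<bar>h i u - 1\<bar>) ` {..<n}) \<le> op_norm (\<lambda>\<psi> x. integral_op (\<kappa> u) \<psi> x -
        integral_op (cell_kernel (tilt_cov (spike 0 0) (spike 0 1))) \<psi> x)" if "u \<in> space (data_space N)" for u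
      using err[OF that, of _ 0 0] ne by (intro Max.boundedI) auto
  qed (use sum1 n norm F in auto)
  have Ri: "(\<integral>\<^sup>+\<Omega>. ennreal (E \<Omega>) * ennreal (\<Lambda> i \<Omega>) \<partial>?M) \<le> ennreal 2 * ?S" if i: "i < n" for i
  proof -
    have "(\<integral>\<^sup>+\<Omega>. ennreal (E \<Omega>) * ennreal (\<Lambda> i \<Omega>) \<partial>?M) \<le> (\<integral>\<^sup>+\<Omega>. ennreal \<bar>h i (?D \<Omega>) - (1 + a)\<bar> * ennreal (\<Lambda> i \<Omega>) \<partial>?M)"
    proof (intro nn_integral_mono mult_right_mono ennreal_leI)
      show "E \<Omega> \<le> \<bar>h i (?D \<Omega>) - (1 + a)\<bar>" for \<Omega>
        using A_ge[OF i, of \<Omega>] by (simp add: E_def)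
    qed simp
    also have "\<dots> = (\<integral>\<^sup>+\<Omega>. ennreal \<bar>h i (?D (compose {1..N} (?T i) \<Omega>)) - (1 + a)\<bar> \<partial>?M)"
      by (rule change[OF i, symmetric]) measurable
    also have "\<dots> = (\<integral>\<^sup>+\<Omega>. ennreal \<bar>h i (data_of N (spike i \<alpha>) (spike i 1) \<Omega>) - (1 + a)\<bar> \<partial>?M)"
      by (subst data_of_compose_tilt[of "spike i \<alpha>" "spike i 1" "spike 0 0" "spike 0 1" "?T i"])
        (simp_all add: tilt_spike_zero)
    also have "\<dots> \<le> ennreal 2 * ?S"
    proof (rule nn_integral_data_le_risk[where G = "\<lambda>u. \<bar>h i u - (1 + a)\<bar>"])
      show "\<bar>h i u - (1 + a)\<bar> \<le> op_norm (\<lambda>\<psi> x. integral_op (\<kappa> u) \<psi> x -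
          integral_op (cell_kernel (tilt_cov (spike i \<alpha>) (spike i 1))) \<psi> x)" if "u \<in> space (data_space N)" for u
        using err[OF that i, of i \<alpha>] a by (simp add: \<alpha>(2))
    qed (use sum1[OF i] i norm F in \<open>auto simp: \<alpha>_def\<close>)
    finally show ?thesis .
  qed
  have "(\<integral>\<^sup>+\<Omega>. ennreal (E \<Omega>) * ennreal (L \<Omega>) \<partial>?M)
      = (\<integral>\<^sup>+\<Omega>. ennreal (1 / real n) * (\<Sum>i<n. ennreal (E \<Omega>) * ennreal (\<Lambda> i \<Omega>)) \<partial>?M)"
    unfolding L_def using \<Lambda>0
    by (intro nn_integral_cong)
      (simp add: sum_ennreal sum_nonneg mult.left_commute flip: ennreal_mult sum_distrib_left)
  also have "\<dots> = ennreal (1 / real n) * (\<Sum>i<n. (\<integral>\<^sup>+\<Omega>. ennreal (E \<Omega>) * ennreal (\<Lambda> i \<Omega>) \<partial>?M))"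
    using Em by (subst nn_integral_cmult, simp, subst nn_integral_sum) (auto intro: \<Lambda>e)
  also have "\<dots> \<le> ennreal (1 / real n) * (\<Sum>i<n. ennreal 2 * ?S)"
    using Ri by (intro mult_left_mono sum_mono) auto
  also have "\<dots> = (ennreal (1 / real n) * of_nat n) * (ennreal 2 * ?S)" by (simp add: mult.assoc)
  also have "ennreal (1 / real n) * of_nat n = 1"
    using n by (simp add: ennreal_of_nat_eq_real_of_nat flip: ennreal_mult)
  finally have RL: "(\<integral>\<^sup>+\<Omega>. ennreal (E \<Omega>) * ennreal (L \<Omega>) \<partial>?M) \<le> ennreal 2 * ?S" by simp
  have "ennreal (a / 4) \<le> (\<integral>\<^sup>+\<Omega>. ennreal (A \<Omega>) \<partial>?M) + (\<integral>\<^sup>+\<Omega>. ennreal (E \<Omega>) * ennreal (L \<Omega>) \<partial>?M)"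
  proof (rule two_point_bound[OF Lm Am Em L0 _ _ a(1) _ L1 L2])
    show "0 \<le> A \<Omega>" for \<Omega> using A_ge[OF n, of \<Omega>] by linarith
    show "0 \<le> E \<Omega>" "a \<le> A \<Omega> + E \<Omega>" for \<Omega> by (simp_all add: E_def)
  qed
  also have "\<dots> \<le> ennreal 2 * ?S + ennreal 2 * ?S" by (intro add_mono R0 RL)
  finally have le: "ennreal (a / 4) \<le> ennreal 2 * ?S + ennreal 2 * ?S" .
  show ?thesis
  proof (cases ?S)
    case (real s)
    have "ennreal 2 * ennreal s = ennreal (2 * s)" by (rule ennreal_mult'[symmetric]) simp
    then have "ennreal (a / 4) \<le> ennreal (2 * s + 2 * s)"
      using le real(1) unfolding real(2) by (simp only: ennreal_plus mult_nonneg_nonneg zero_le_numeral)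
    then have "a / 16 \<le> s" using real(1) by (simp add: ennreal_le_iff)
    then show ?thesis unfolding real(2) by (rule ennreal_leI)
  next
    case top
    show ?thesis unfolding top by simp
  qed
qed

end

section \<open>Assouad's argument on the hypercube\<close>

text \<open>Groups the vertices of the hypercube into its edges in direction
  \<open>i\<close>.\<close>

lemma sum_Pow_insert_pairs:
  fixes f :: "'a set \<Rightarrow> 'b :: comm_monoid_add"
  assumes "finite A" "i \<in> A"
  shows "(\<Sum>\<theta>\<in>Pow A. f \<theta>) = (\<Sum>\<theta>\<in>Pow (A - {i}). f \<theta> + f (insert i \<theta>))"
proof -
  have A: "A = insert i (A - {i})" using assms by auto
  have inj: "inj_on (insert i) (Pow (A - {i}))"
    by (rule inj_onI) (auto simp: Pow_def dest: insert_ident[THEN iffD1, rotated 2])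
  have "(\<Sum>\<theta>\<in>Pow A. f \<theta>) = (\<Sum>\<theta>\<in>Pow (A - {i}) \<union> insert i ` Pow (A - {i}). f \<theta>)"
    using Pow_insert[of i "A - {i}"] A by simp
  also have "\<dots> = (\<Sum>\<theta>\<in>Pow (A - {i}). f \<theta>) + (\<Sum>\<theta>\<in>insert i ` Pow (A - {i}). f \<theta>)"
    using assms by (intro sum.union_disjoint) auto
  also have "\<dots> = (\<Sum>\<theta>\<in>Pow (A - {i}). f \<theta> + f (insert i \<theta>))"
    by (simp add: sum.reindex[OF inj] sum.distrib)
  finally show ?thesis .
qed

definition on_set :: "nat set \<Rightarrow> real \<Rightarrow> nat \<Rightarrow> real" where
  "on_set I b j = (if j \<in> I then b else 0)"

lemma sum_on_set_mult: "I \<subseteq> {..<n} \<Longrightarrow> (\<Sum>j<n. on_set I b j * f j) = b * (\<Sum>j\<in>I. f j)"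
proof -
  assume "I \<subseteq> {..<n}"
  then have "(\<Sum>j\<in>I. b * f j) = (\<Sum>j<n. on_set I b j * f j)"
    by (intro sum.mono_neutral_cong_left) (auto simp: on_set_def)
  then show ?thesis by (simp add: sum_distrib_left)
qed

lemma sum_on_set_square: "I \<subseteq> {..<n} \<Longrightarrow> (\<Sum>j<n. (on_set I b j)\<^sup>2) = real (card I) * b\<^sup>2"
proof -
  assume "I \<subseteq> {..<n}"
  then have "(\<Sum>j<n. on_set I b j * on_set I b j) = b * (\<Sum>j\<in>I. on_set I b j)"
    by (rule sum_on_set_mult)
  also have "(\<Sum>j\<in>I. on_set I b j) = real (card I) * b" by (simp add: on_set_def)
  finally show ?thesis by (simp add: power2_eq_square mult_ac)
qed

context cell_family
begin

text \<open>
  Assouad's lemma over the subsets \<open>\<theta> \<subseteq> {..<k}\<close>: neighbours differ by a shear of one coordinate.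
\<close>

lemma minimax_shear_bound:
  fixes k N :: nat
  defines "w \<equiv> on_set {k..<2 * k} (1 / sqrt (real k))"
    and "\<beta> \<equiv> \<lambda>\<theta>. on_set \<theta> (1 / (2 * sqrt (real N)))"
  assumes k: "0 < k" "n = 2 * k" and N: "0 < N" and \<kappa>: "\<kappa> \<in> estimators N" and R: "0 < R"
    and F: "\<And>\<theta>. \<theta> \<subseteq> {..<k} \<Longrightarrow> cell_kernel (tilt_cov (\<beta> \<theta>) w) \<in> F"
    and norm: "\<And>\<theta>. \<theta> \<subseteq> {..<k} \<Longrightarrow> 0 < op_norm (integral_op (cell_kernel (tilt_cov (\<beta> \<theta>) w)))"
      "\<And>\<theta>. \<theta> \<subseteq> {..<k} \<Longrightarrow> op_norm (integral_op (cell_kernel (tilt_cov (\<beta> \<theta>) w))) \<le> R"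
  shows "ennreal (sqrt (real k / real N) / (16 * R)) \<le>
    worst_risk N \<kappa> F" (is "_ \<le> ?S")
proof -
  let ?M = "gauss_samples N n"
  interpret M: prob_space ?M by (rule prob_space_gauss_samples)
  \<comment> \<open>Chosen so that the second moment over N samples is at most exp(N * 2 b^2) =
    exp(1/2) <= 3.\<close>
  define b where "b = 1 / (2 * sqrt (real N))"
  have b: "0 < b" "b\<^sup>2 = 1 / (4 * real N)" using N by (auto simp: b_def power_mult_distrib power_divide)
  have b4: "2 * b\<^sup>2 \<le> 1 / 2" using N by (simp add: b)
  have \<beta>_eq: "\<beta> \<theta> j = (if j \<in> \<theta> then b else 0)" for \<theta> j by (simp add: \<beta>_def on_set_def b_def)
  have w1: "(\<Sum>j<n. (w j)\<^sup>2) = 1"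
    unfolding w_def using k by (subst sum_on_set_square) (auto simp: power_divide)
  have w0: "w i = 0" if "i < k" for i using that by (simp add: w_def on_set_def)
  have \<beta>w: "(\<Sum>j<n. \<beta> \<theta> j * w j) = 0" if "\<theta> \<subseteq> {..<k}" for \<theta>
    using that w0 by (intro sum.neutral) (auto simp: \<beta>_eq)
  define h where "h i u = coeff_est \<kappa> w (spike i 1) u" for i u
  have hm[measurable]: "h i \<in> borel_measurable (data_space N)" for i
    unfolding h_def[abs_def] using \<kappa> by measurable
  define D where "D i \<theta> = (\<integral>\<^sup>+\<Omega>. ennreal \<bar>h i (data_of N (\<beta> \<theta>) w \<Omega>) - \<beta> \<theta> i\<bar> \<partial>?M)" for i \<theta>
  \<comment> \<open>Row \<open>i\<close> applied to \<open>w\<close> returns exactly the unknown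
    entry: \<open>w\<close> is a unit vector, orthogonal to \<beta>, and vanishes at
    \<open>i\<close>.\<close>
  have row: "(\<Sum>j<n. tilt_cov (\<beta> \<theta>) w i j * w j) = \<beta> \<theta> i" if "i < k" "\<theta> \<subseteq> {..<k}" for i \<theta>
  proof -
    have "(\<Sum>j<n. tilt_cov (\<beta> \<theta>) w i j * w j)
        = (\<Sum>j<n. (if i = j then w i else 0)) + \<beta> \<theta> i * (\<Sum>j<n. (w j)\<^sup>2) + \<beta> \<theta> i * (\<Sum>j<n. \<beta> \<theta> j * w j)"
      using w0[OF that(1)] unfolding sum_distrib_left sum.distrib[symmetric] tilt_cov_def
      by (intro sum.cong) (auto simp: algebra_simps power2_eq_square)
    then show ?thesis using that k w0[OF that(1)] w1 \<beta>w[OF that(2)] by simp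
  qed
  have total: "(\<Sum>i<k. D i \<theta>) \<le> ennreal (sqrt (real k) * R) * ?S" if \<theta>: "\<theta> \<subseteq> {..<k}" for \<theta>
  proof -
    let ?G = "\<lambda>u. (\<Sum>i<k. \<bar>h i u - \<beta> \<theta> i\<bar>) / sqrt (real k)"
    have "(\<Sum>i<k. D i \<theta>) = (\<integral>\<^sup>+\<Omega>. (\<Sum>i<k. ennreal \<bar>h i (data_of N (\<beta> \<theta>) w \<Omega>) - \<beta> \<theta> i\<bar>) \<partial>?M)"
      unfolding D_def by (rule nn_integral_sum[symmetric]) measurable
    also have "\<dots> = (\<integral>\<^sup>+\<Omega>. ennreal (sqrt (real k)) * ennreal (?G (data_of N (\<beta> \<theta>) w \<Omega>)) \<partial>?M)"
      using k by (intro nn_integral_cong) (simp add: sum_ennreal sum_nonneg flip: ennreal_mult)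
    also have "\<dots> = ennreal (sqrt (real k)) * (\<integral>\<^sup>+\<Omega>. ennreal (?G (data_of N (\<beta> \<theta>) w \<Omega>)) \<partial>?M)"
      by (rule nn_integral_cmult) measurable
    also have "\<dots> \<le> ennreal (sqrt (real k)) * (ennreal R * ?S)"
    proof (intro mult_left_mono nn_integral_data_le_risk[where G = ?G])
      show "?G u \<le> op_norm (\<lambda>\<psi> x. integral_op (\<kappa> u) \<psi> x - integral_op (cell_kernel (tilt_cov (\<beta> \<theta>) w)) \<psi> x)"
        if "u \<in> space (data_space N)" for u
      proof -
        have "{..<k} \<subseteq> {..<n}" "{..<k} \<noteq> {}" using k by auto
        then have "(\<Sum>i<k. \<bar>coeff_est \<kappa> w (spike i 1) u - (\<Sum>j<n. tilt_cov (\<beta> \<theta>) w i j * w j)\<bar>) / sqrt (card {..<k})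
          \<le> op_norm (\<lambda>\<psi> x. integral_op (\<kappa> u) \<psi> x - integral_op (cell_kernel (tilt_cov (\<beta> \<theta>) w)) \<psi> x)"
          using tilt_cov_commute[of "\<beta> \<theta>" w] w1 by (intro coeff_error_le_op_norm[OF \<kappa> that]) auto
        moreover have "(\<Sum>i<k. \<bar>coeff_est \<kappa> w (spike i 1) u - (\<Sum>j<n. tilt_cov (\<beta> \<theta>) w i j * w j)\<bar>)
          = (\<Sum>i<k. \<bar>h i u - \<beta> \<theta> i\<bar>)"
          using row \<theta> by (intro sum.cong) (auto simp: h_def)
        ultimately show ?thesis by simp
      qed
      show "?G \<in> borel_measurable (data_space N)" by measurable
    qed (use w1 norm[OF \<theta>] F[OF \<theta>] in auto)
    also have "\<dots> = ennreal (sqrt (real k) * R) * ?S"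
      using R by (simp add: ennreal_mult mult.assoc)
    finally show ?thesis .
  qed
  have pair: "ennreal (b / 4) \<le> D i \<theta> + D i (insert i \<theta>)" if i: "i < k" and \<theta>: "\<theta> \<subseteq> {..<k} - {i}" for i \<theta>
  proof -
    have "i < n" using i k by simp
    let ?X = "data_of N (\<beta> \<theta>) w" and ?T = "tilt n (spike i b) w"
    define L where "L \<Omega> = (\<Prod>k\<in>{1..N}. shift_lr n i b w (\<Omega> k))" for \<Omega> :: "nat \<Rightarrow> nat \<Rightarrow> real"
    have L0: "0 \<le> L \<Omega>" for \<Omega> unfolding L_def by (intro prod_nonneg shift_lr_nonneg ballI)
    have Lm: "L \<in> borel_measurable ?M" unfolding L_def[abs_def] using \<open>i < n\<close> by measurable
    have change: "(\<integral>\<^sup>+\<Omega>. H (compose {1..N} ?T \<Omega>) \<partial>?M) = (\<integral>\<^sup>+\<Omega>. H \<Omega> * ennreal (L \<Omega>) \<partial>?M)"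
      if H: "H \<in> borel_measurable ?M" for H
    proof -
      have "(\<integral>\<^sup>+\<Omega>. H (compose {1..N} ?T \<Omega>) \<partial>?M)
          = (\<integral>\<^sup>+\<Omega>. H \<Omega> * (\<Prod>k\<in>{1..N}. ennreal (shift_lr n i b w (\<Omega> k))) \<partial>?M)"
      proof (rule nn_integral_PiM_compose)
        show "(\<integral>\<^sup>+\<omega>. F (?T \<omega>) \<partial>std_gauss n) = (\<integral>\<^sup>+\<omega>. F \<omega> * ennreal (shift_lr n i b w \<omega>) \<partial>std_gauss n)"
          if "F \<in> borel_measurable (std_gauss n)" for F
          using \<open>i < n\<close> w0[OF i] that by (rule nn_integral_tilt_shift)
      qed (use H \<open>i < n\<close> prob_space_std_gauss in auto)
      then show ?thesis unfolding L_def by (simp add: prod_ennreal shift_lr_nonneg)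
    qed
    have L1: "(\<integral>\<^sup>+\<Omega>. ennreal (L \<Omega>) \<partial>?M) = 1"
      using change[of "\<lambda>_. 1"] by (simp add: M.emeasure_space_1)
    have "(\<integral>\<^sup>+\<Omega>. ennreal ((L \<Omega>)\<^sup>2) \<partial>?M) = (\<integral>\<^sup>+\<Omega>. (\<Prod>k\<in>{1..N}. ennreal ((shift_lr n i b w (\<Omega> k))\<^sup>2)) \<partial>?M)"
      unfolding L_def by (simp add: prod_ennreal prod_power_distrib)
    also have "\<dots> = (\<integral>\<^sup>+\<omega>. ennreal ((shift_lr n i b w \<omega>)\<^sup>2) \<partial>std_gauss n) ^ N"
      using \<open>i < n\<close> by (intro nn_integral_gauss_samples_prod) measurable
    also have "\<dots> \<le> ennreal (exp (2 * b\<^sup>2)) ^ N"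
      by (intro power_mono nn_integral_shift_lr_square \<open>i < n\<close> w0 i w1 b4) simp
    also have "\<dots> = ennreal (exp (real N * (2 * b\<^sup>2)))"
      by (simp add: ennreal_power exp_of_nat_mult)
    also have "real N * (2 * b\<^sup>2) = 1 / 2" using N by (simp add: b)
    also have "ennreal (exp (1 / 2)) \<le> ennreal 3"
    proof (rule ennreal_leI)
      have "exp (1 / 2 :: real) \<le> exp 1" by simp
      then show "exp (1 / 2 :: real) \<le> 3" using exp_le by (rule order_trans)
    qed
    finally have L2: "(\<integral>\<^sup>+\<Omega>. ennreal ((L \<Omega>)\<^sup>2) \<partial>?M) \<le> 3" by simp
    \<comment> \<open>Shears along the same \<open>w\<close> compose additively, because w .
      \<omega> does not change when coordinate \<open>i\<close>, where \<open>w\<close> vanishes, is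
      moved.\<close>
    have X: "data_of N (\<beta> (insert i \<theta>)) w \<Omega> = ?X (compose {1..N} ?T \<Omega>)" for \<Omega>
    proof (rule data_of_compose_tilt)
      fix \<omega> j assume "j < n"
      have "(\<Sum>l<n. w l * ?T \<omega> l) = (\<Sum>l<n. w l * \<omega> l)"
        by (subst sum_tilt) (simp add: tilt_adjoint_def sum_mult_spike[OF \<open>i < n\<close>] w0[OF i])
      then have "tilt n (\<beta> \<theta>) w (?T \<omega>) j = ?T \<omega> j + \<beta> \<theta> j * (\<Sum>l<n. w l * \<omega> l)"
        using \<open>j < n\<close> by (subst tilt_def) simp
      also have "?T \<omega> j = \<omega> j + spike i b j * (\<Sum>l<n. w l * \<omega> l)"
        using \<open>j < n\<close> by (simp add: tilt_def)
      moreover have "\<beta> (insert i \<theta>) j = spike i b j + \<beta> \<theta> j" using \<theta> by (auto simp: \<beta>_eq spike_def)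
      ultimately show "tilt n (\<beta> (insert i \<theta>)) w \<omega> j = tilt n (\<beta> \<theta>) w (?T \<omega>) j"
        using \<open>j < n\<close> by (simp add: tilt_def[of n "\<beta> (insert i \<theta>)"] distrib_right)
    qed
    have "\<beta> (insert i \<theta>) i = b" "\<beta> \<theta> i = 0" using \<theta> by (auto simp: \<beta>_eq)
    then have D1: "D i \<theta> = (\<integral>\<^sup>+\<Omega>. ennreal \<bar>h i (?X \<Omega>)\<bar> \<partial>?M)"
      and "D i (insert i \<theta>) = (\<integral>\<^sup>+\<Omega>. ennreal \<bar>h i (?X (compose {1..N} ?T \<Omega>)) - b\<bar> \<partial>?M)"
      by (simp_all add: D_def X)
    note this(2)
    also have "(\<integral>\<^sup>+\<Omega>. ennreal \<bar>h i (?X (compose {1..N} ?T \<Omega>)) - b\<bar> \<partial>?M)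
        = (\<integral>\<^sup>+\<Omega>. ennreal \<bar>h i (?X \<Omega>) - b\<bar> * ennreal (L \<Omega>) \<partial>?M)"
      by (rule change) measurable
    finally have D2: "D i (insert i \<theta>) = (\<integral>\<^sup>+\<Omega>. ennreal \<bar>h i (?X \<Omega>) - b\<bar> * ennreal (L \<Omega>) \<partial>?M)" .
    show ?thesis
      unfolding D1 D2
    proof (rule two_point_bound[OF Lm _ _ L0 _ _ _ _ L1 L2])
      show "(\<lambda>\<Omega>. \<bar>h i (?X \<Omega>)\<bar>) \<in> borel_measurable ?M" by measurable
      show "(\<lambda>\<Omega>. \<bar>h i (?X \<Omega>) - b\<bar>) \<in> borel_measurable ?M" by measurable
    qed (use b in auto)
  qed
  \<comment> \<open>Each of the \<open>k\<close> directions has \<open>2 ^ (k - 1)\<close> edges,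
    each worth b / 4, while the \<open>2 ^ k\<close> vertices cost at most sqrt k * R * S each.
    Comparison gives S >= b sqrt k / (8 R).\<close>
  have "(\<Sum>i<k. \<Sum>\<theta>\<in>Pow ({..<k} - {i}). ennreal (b / 4)) \<le> (\<Sum>i<k. \<Sum>\<theta>\<in>Pow ({..<k} - {i}). D i \<theta> + D i (insert i \<theta>))"
    using pair by (intro sum_mono) auto
  also have "\<dots> = (\<Sum>i<k. \<Sum>\<theta>\<in>Pow {..<k}. D i \<theta>)"
    by (intro sum.cong refl sum_Pow_insert_pairs[symmetric]) auto
  also have "\<dots> = (\<Sum>\<theta>\<in>Pow {..<k}. \<Sum>i<k. D i \<theta>)" by (rule sum.swap)
  also have "\<dots> \<le> (\<Sum>\<theta>\<in>Pow {..<k}. ennreal (sqrt (real k) * R) * ?S)"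
    using total by (intro sum_mono) auto
  also have "\<dots> = 2 ^ k * (ennreal (sqrt (real k) * R) * ?S)"
    by (simp add: card_Pow)
  finally have le: "(\<Sum>i<k. \<Sum>\<theta>\<in>Pow ({..<k} - {i}). ennreal (b / 4)) \<le> 2 ^ k * (ennreal (sqrt (real k) * R) * ?S)" .
  have "(\<Sum>i<k. \<Sum>\<theta>\<in>Pow ({..<k} - {i}). ennreal (b / 4)) = ennreal (real k * (2 ^ (k - 1) * (b / 4)))"
  proof -
    have "(\<Sum>i<k. \<Sum>\<theta>\<in>Pow ({..<k} - {i}). ennreal (b / 4)) = ennreal (\<Sum>i<k. \<Sum>\<theta>\<in>Pow ({..<k} - {i}). b / 4)"
      using b by (simp add: sum_ennreal sum_nonneg del: sum_constant)
    also have "(\<Sum>i<k. \<Sum>\<theta>\<in>Pow ({..<k} - {i}). b / 4) = real k * (2 ^ (k - 1) * (b / 4))"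
      by (simp add: card_Pow)
    finally show ?thesis .
  qed
  with le have le': "ennreal (real k * (2 ^ (k - 1) * (b / 4))) \<le> 2 ^ k * (ennreal (sqrt (real k) * R) * ?S)" by simp
  show ?thesis
  proof (cases ?S)
    case (real s)
    have "(2 :: ennreal) ^ k = ennreal (2 ^ k)"
      by (metis ennreal_numeral ennreal_power zero_le_numeral)
    then have "(2 :: ennreal) ^ k * (ennreal (sqrt (real k) * R) * ennreal s) = ennreal (2 ^ k * (sqrt (real k) * R * s))"
      using R real(1) by (simp add: ennreal_mult)
    then have "real k * (2 ^ (k - 1) * (b / 4)) \<le> 2 ^ k * (sqrt (real k) * R * s)"
      using le' R real by (simp add: ennreal_le_iff)
    also have "(2 :: real) ^ k = 2 * 2 ^ (k - 1)" using k by (cases k) auto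
    finally have "2 ^ (k - 1) * (real k * (b / 4)) \<le> 2 ^ (k - 1) * (2 * (sqrt (real k) * R * s))"
      by (simp add: mult_ac)
    then have "real k * (b / 4) \<le> 2 * (sqrt (real k) * R * s)" by simp
    moreover have "sqrt (real k) * (sqrt (real k) * (b / 4)) = real k * (b / 4)"
      by (simp flip: mult.assoc)
    moreover have "sqrt (real k) * (2 * (R * s)) = 2 * (sqrt (real k) * R * s)" by simp
    ultimately have "sqrt (real k) * (sqrt (real k) * (b / 4)) \<le> sqrt (real k) * (2 * (R * s))" by linarith
    then have "sqrt (real k) * (b / 4) \<le> 2 * (R * s)" using k by simp
    then have "sqrt (real k / real N) / (16 * R) \<le> s"
      using R N by (simp add: b_def real_sqrt_divide field_simps)
    then show ?thesis unfolding real(2) by (rule ennreal_leI)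
  next
    case top
    show ?thesis unfolding top by simp
  qed
qed

end

subsection \<open>The least favourable covariances\<close>

lemma tilt_cov_spike:
  "tilt_cov (spike i b) (spike i 1) k l = (if k = l then if k = i then (1 + b)\<^sup>2 else 1 else 0)"
  by (auto simp: tilt_cov_def spike_def power2_eq_square algebra_simps)

lemma one_le_CARD: "1 \<le> CARD('a::finite)"
  by (simp add: Suc_le_eq One_nat_def)

lemma one_le_real_CARD: "1 \<le> real CARD('a::finite)"
  using one_le_CARD[where 'a = 'a] by simp

text \<open>The integer part of the root is at least 1, so rounding down costs a factor below 2 per
  axis.\<close>

lemma ex_nat_root:
  fixes r :: real and d :: nat
  assumes "1 \<le> r" "0 < d"
  obtains q :: nat where "1 \<le> q" "real q ^ d \<le> r" "r < (2 * real q) ^ d"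
proof -
  define q where "q = nat \<lfloor>root d r\<rfloor>"
  have r1: "1 \<le> root d r" using assms by simp
  then have q1: "1 \<le> q" unfolding q_def by (metis le_nat_floor of_nat_1)
  have q: "real q \<le> root d r" "root d r < real q + 1" using r1 unfolding q_def by linarith+
  have rd: "root d r ^ d = r" using assms by simp
  have "real q ^ d \<le> root d r ^ d" using q by (intro power_mono) auto
  moreover have "root d r ^ d < (2 * real q) ^ d" proof (rule power_strict_mono)
    have "1 \<le> real q" using q1 by simp
    then show "root d r < 2 * real q" using q by linarith
  qed (use r1 assms in auto)
  ultimately show ?thesis using that q1 rd by simp
qed

context cell_family
begin

lemma op_norm_scale:
  assumes i: "i < n" and b: "0 \<le> b"
  shows "op_norm (integral_op (cell_kernel (tilt_cov (spike i b) (spike i 1)))) = (1 + b)\<^sup>2"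
proof (rule antisym)
  have sym: "\<forall>k<n. \<forall>l<n. tilt_cov (spike i b) (spike i 1) k l = tilt_cov (spike i b) (spike i 1) l k"
    by (simp add: tilt_cov_commute)
  have "1\<^sup>2 \<le> (1 + b)\<^sup>2" using b by (intro power_mono) auto
  then show "op_norm (integral_op (cell_kernel (tilt_cov (spike i b) (spike i 1)))) \<le> (1 + b)\<^sup>2"
    by (intro op_norm_cell_kernel_le sym)
      (simp_all add: tilt_cov_spike if_distrib[of abs] sum.delta cong: if_cong)
  show "(1 + b)\<^sup>2 \<le> op_norm (integral_op (cell_kernel (tilt_cov (spike i b) (spike i 1))))"
  proof -
    have "tilt_cov (spike i b) (spike i 1) i i = (1 + b)\<^sup>2" by (simp add: tilt_cov_spike)
    then show ?thesis using op_norm_cell_kernel_ge[OF sym i] by simp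
  qed
qed

text \<open>The covariance is diagonal, so the decay condition holds with row sum 0. The cells lie
  in a corner of volume (4 d)^(-d); the diagonal of the kernel may therefore exceed the trace by
  twice the inverse of that volume, which \<open>K1\<close> absorbs.\<close>

lemma scale_in_covariance_class:
  fixes q :: nat
  assumes i: "i < n" and b: "0 \<le> b" "(1 + b)\<^sup>2 \<le> 2" and q: "1 \<le> q" "n = q ^ CARD('d)" "real n \<le> r"
    and v: "v = (1 / (4 * real CARD('d) * real q)) ^ CARD('d)"
    and diam: "\<And>j x y. j < n \<Longrightarrow> x \<in> B j \<Longrightarrow> y \<in> B j \<Longrightarrow> norm (x - y) \<le> 1 / (4 * real q)"
    and total: "\<And>j l x y. j < n \<Longrightarrow> l < n \<Longrightarrow> x \<in> B j \<Longrightarrow> y \<in> B l \<Longrightarrow> norm (x - y) \<le> 1 / 4"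
    and K: "2 * (4 * real CARD('d)) ^ CARD('d) \<le> K1" "0 \<le> K2" and \<nu>: "\<And>m. 1 \<le> m \<Longrightarrow> 0 < \<nu> m"
  shows "cell_kernel (tilt_cov (spike i b) (spike i 1)) \<in> covariance_class K1 K2 r \<nu>"
proof -
  let ?A = "tilt_cov (spike i b) (spike i 1)" and ?c = "(1 + b)\<^sup>2"
  have c1: "1 \<le> ?c" using b power_mono[of 1 "1 + b" 2] by simp
  have w: "(\<Sum>j<n. (spike i 1 j)\<^sup>2) = 1"
    using sum_spike_mult[OF i, of 1 "spike i 1"] by (simp add: power2_eq_square) (simp add: spike_def)
  have "(\<Sum>j<n. ?A j j) = (\<Sum>j<n. 1 + (if j = i then ?c - 1 else 0))"
    by (intro sum.cong) (auto simp: tilt_cov_spike)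
  also have "\<dots> = real n + (?c - 1)" using i by (simp add: sum.distrib)
  finally have tr: "(\<Sum>j<n. ?A j j) = real n + (?c - 1)" .
  have n1: "1 \<le> real n" using i by simp
  show ?thesis
  proof (rule cell_kernel_in_covariance_class[where s = 0 and \<delta> = "1 / (4 * real q)" and \<Delta> = "1 / 4"])
    show "covariance_function (cell_kernel ?A)"
      unfolding covariance_function_def using gp_law_cell_path[OF w] by blast
    show "\<forall>j<n. \<forall>l<n. ?A j l = ?A l j" by (simp add: tilt_cov_commute)
    show "1 \<le> op_norm (integral_op (cell_kernel ?A))" unfolding op_norm_scale[OF i b(1)] by (rule c1)
    have "(1 :: real) \<le> (4 * real CARD('d)) ^ CARD('d)" using one_le_real_CARD[where 'a = 'd] by (intro one_le_power) simp
    then show K1: "0 \<le> K1" using K by linarith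
    show "0 < (\<Sum>j<n. ?A j j)" unfolding tr using n1 c1 by linarith
    show "?A j j / v \<le> K1 * (\<Sum>j<n. ?A j j)" for j
    proof -
      have "?A j j / v \<le> 2 / v" using b c1 v_pos by (intro divide_right_mono) (auto simp: tilt_cov_spike)
      also have "\<dots> = 2 * (4 * real CARD('d)) ^ CARD('d) * real n"
        by (simp add: v q power_mult_distrib power_divide)
      also have "\<dots> \<le> K1 * (\<Sum>j<n. ?A j j)"
        unfolding tr using K K1 c1 by (intro mult_mono) auto
      finally show ?thesis .
    qed
    show "(\<Sum>j<n. ?A j j) \<le> r * op_norm (integral_op (cell_kernel ?A))"
    proof -
      \<comment> \<open>Inflating one variance multiplies the norm by c but the trace by less, so
        the effective dimension stays at most n.\<close>
      have "real n + (?c - 1) \<le> real n * ?c"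
        using mult_nonneg_nonneg[of "real n - 1" "?c - 1"] n1 c1 by (simp add: algebra_simps)
      also have "\<dots> \<le> r * ?c" using q c1 by (intro mult_right_mono) auto
      finally show ?thesis unfolding tr op_norm_scale[OF i b(1)] .
    qed
    show "(1 / (4 * real q)) ^ CARD('d) * (\<Sum>j<n. ?A j j) \<le> 1"
    proof -
      have "(1 / (4 * real q)) ^ CARD('d) * (\<Sum>j<n. ?A j j) \<le> (1 / (4 * real q)) ^ CARD('d) * (2 * real n)"
        unfolding tr using b n1 by (intro mult_left_mono) auto
      also have "\<dots> = 2 / 4 ^ CARD('d)" using q by (simp add: power_mult_distrib power_divide)
      also have "\<dots> \<le> 1" using power_increasing[of 1 "CARD('d)" "4 :: real"] one_le_CARD[where 'a = 'd] by simp
      finally show ?thesis .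
    qed
    show "(\<Sum>l\<in>{..<n} - {j}. \<bar>?A j l\<bar>) \<le> 0" for j by (simp add: tilt_cov_spike)
    show "0 \<le> K2 * \<nu> m \<or> (1 / 4 / real m) ^ CARD('d) * (\<Sum>j<n. ?A j j) \<le> 1" if "1 \<le> m" for m
      using K \<nu>[OF that] by simp
  qed (use K \<nu> diam total in auto)
qed

text \<open>The off-diagonal row sums are at most 2 sqrt(k / N), so for indices up to
  \<open>m\<close> the decay condition follows from the lower bound on \<nu> and K2 >= 2; for an
  index l > m >= q the support, of diameter at most 1/4, lies within l bandwidths. The diagonal lies
  between 1 and 5/4, which leads to the bounds 4 for the norm and 3 k for the trace.\<close>

lemma shear_in_covariance_class:
  fixes q k N m :: nat
  defines "w \<equiv> on_set {k..<2 * k} (1 / sqrt (real k))"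
  assumes \<theta>: "\<theta> \<subseteq> {..<k}" and q: "1 \<le> q" "k = q ^ CARD('d)" "n = 2 * k" "3 * real k \<le> r"
    and kN: "k \<le> N" and qm: "q \<le> m"
    and v: "v = (1 / (4 * real CARD('d) * real (2 * q))) ^ CARD('d)"
    and diam: "\<And>j x y. j < n \<Longrightarrow> x \<in> B j \<Longrightarrow> y \<in> B j \<Longrightarrow> norm (x - y) \<le> 1 / (4 * real (2 * q))"
    and total: "\<And>j l x y. j < n \<Longrightarrow> l < n \<Longrightarrow> x \<in> B j \<Longrightarrow> y \<in> B l \<Longrightarrow> norm (x - y) \<le> 1 / 4"
    and K: "2 * (8 * real CARD('d)) ^ CARD('d) \<le> K1" "2 \<le> K2" and \<nu>: "\<And>m. 1 \<le> m \<Longrightarrow> 0 < \<nu> m"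
    and decay: "\<And>l. 1 \<le> l \<Longrightarrow> l \<le> m \<Longrightarrow> sqrt (real k / real N) \<le> \<nu> l"
  defines "A \<equiv> tilt_cov (on_set \<theta> (1 / (2 * sqrt (real N)))) w"
  shows "1 \<le> op_norm (integral_op (cell_kernel A))" "op_norm (integral_op (cell_kernel A)) \<le> 4"
    "cell_kernel A \<in> covariance_class K1 K2 r \<nu>"
proof -
  define b where "b = 1 / (2 * sqrt (real N))"
  define \<beta> where "\<beta> = on_set \<theta> b"
  have A: "A = tilt_cov \<beta> w" by (simp add: A_def \<beta>_def b_def)
  have k0: "0 < k" using q by simp
  then have N0: "0 < N" using kN by simp
  have b: "0 < b" "b\<^sup>2 = 1 / (4 * real N)" using N0 by (auto simp: b_def power_mult_distrib power_divide)
  have b4: "b\<^sup>2 \<le> 1 / 4" using N0 by (simp add: b)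
  have \<beta>b: "0 \<le> \<beta> j" "\<beta> j \<le> b" for j using b by (auto simp: \<beta>_def on_set_def)
  have w_le: "0 \<le> w j" "w j \<le> 1 / sqrt (real k)" for j by (auto simp: w_def on_set_def)
  have disj: "\<beta> j * w j = 0" for j using \<theta> by (auto simp: \<beta>_def w_def on_set_def)
  have w1: "(\<Sum>j<n. (w j)\<^sup>2) = 1"
    unfolding w_def using q k0 by (subst sum_on_set_square) (auto simp: power_divide)
  have sum_w: "(\<Sum>j<n. w j) = sqrt (real k)"
  proof -
    have "(\<Sum>j<n. w j * 1) = 1 / sqrt (real k) * (\<Sum>j\<in>{k..<2 * k}. 1)"
      unfolding w_def q(3) by (intro sum_on_set_mult) auto
    then show ?thesis using k0 by (simp add: real_div_sqrt)
  qed
  have sum_\<beta>: "(\<Sum>j<n. \<beta> j) \<le> real k * b"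
  proof -
    have "\<theta> \<subseteq> {..<n}" using \<theta> q(3) by auto
    then have "(\<Sum>j<n. \<beta> j * 1) = b * (\<Sum>j\<in>\<theta>. 1)" unfolding \<beta>_def by (rule sum_on_set_mult)
    then have "(\<Sum>j<n. \<beta> j) = b * real (card \<theta>)" by simp
    also have "\<dots> \<le> b * real k" using card_mono[OF _ \<theta>] b by (intro mult_left_mono) auto
    finally show ?thesis by (simp add: mult.commute)
  qed
  define s where "s = 2 * sqrt (real k / real N)"
  have kN1: "real k / real N \<le> 1" using kN N0 by simp
  have s2: "s \<le> 2" using kN1 by (simp add: s_def)
  have diagA: "A j j = 1 + (\<beta> j)\<^sup>2" for j
    using disj[of j] by (simp add: A tilt_cov_def power2_eq_square mult.commute)
  have diag1: "1 \<le> A j j" "A j j \<le> 5 / 4" for j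
  proof -
    have "(\<beta> j)\<^sup>2 \<le> b\<^sup>2" using \<beta>b[of j] by (intro power_mono)
    then show "1 \<le> A j j" "A j j \<le> 5 / 4" using b4 by (simp_all add: diagA)
  qed
  have sym: "\<forall>j<n. \<forall>l<n. A j l = A l j" unfolding A by (simp add: tilt_cov_commute)
  \<comment> \<open>The two mixed products contribute at most b sqrt k each, the product of two
    entries of \<beta> at most k b^2. As b = 1 / (2 sqrt N) and k <= N, both parts are at most
    sqrt(k / N).\<close>
  have off: "(\<Sum>l\<in>{..<n} - {j}. \<bar>A j l\<bar>) \<le> s" for j
  proof -
    have "(\<Sum>l\<in>{..<n} - {j}. \<bar>A j l\<bar>) = (\<Sum>l\<in>{..<n} - {j}. \<beta> j * w l + w j * \<beta> l + \<beta> j * \<beta> l)"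
      using \<beta>b w_le by (intro sum.cong) (auto simp: A tilt_cov_def)
    also have "\<dots> \<le> (\<Sum>l<n. \<beta> j * w l + w j * \<beta> l + \<beta> j * \<beta> l)"
      using \<beta>b w_le by (intro sum_mono2) auto
    also have "\<dots> = \<beta> j * (\<Sum>l<n. w l) + w j * (\<Sum>l<n. \<beta> l) + \<beta> j * (\<Sum>l<n. \<beta> l)"
      by (simp add: sum.distrib sum_distrib_left)
    also have "\<dots> \<le> b * sqrt (real k) + 1 / sqrt (real k) * (real k * b) + b * (real k * b)"
      unfolding sum_w using \<beta>b w_le sum_\<beta> b
      by (intro add_mono mult_mono) (auto intro: sum_nonneg)
    also have "\<dots> = 2 * b * sqrt (real k) + real k * b\<^sup>2"
      using k0 by (simp add: power2_eq_square real_div_sqrt field_simps)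
    also have "2 * b * sqrt (real k) = sqrt (real k / real N)"
      by (simp add: b_def real_sqrt_divide)
    also have "real k * b\<^sup>2 \<le> sqrt (real k / real N)"
    proof -
      have "real k * b\<^sup>2 \<le> real k / real N" using N0 by (simp add: b field_simps)
      also have "\<dots> = sqrt (real k / real N) * sqrt (real k / real N)" by simp
      also have "\<dots> \<le> sqrt (real k / real N) * 1" using kN1 by (intro mult_left_mono) auto
      finally show ?thesis by simp
    qed
    finally show ?thesis by (simp add: s_def)
  qed
  show norm4: "op_norm (integral_op (cell_kernel A)) \<le> 4"
  proof (rule op_norm_cell_kernel_le[OF sym])
    fix j assume j: "j < n"
    have "(\<Sum>l<n. \<bar>A j l\<bar>) = \<bar>A j j\<bar> + (\<Sum>l\<in>{..<n} - {j}. \<bar>A j l\<bar>)"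
      using j by (intro sum.remove) auto
    then show "(\<Sum>l<n. \<bar>A j l\<bar>) \<le> 4" using off[of j] s2 diag1[of j] by linarith
  qed simp
  have n0: "0 < n" using q k0 by simp
  show norm1: "1 \<le> op_norm (integral_op (cell_kernel A))"
    using op_norm_cell_kernel_ge[OF sym n0] diag1[of 0] by linarith
  have tr_ge: "2 * real k \<le> (\<Sum>j<n. A j j)"
    using sum_mono[of "{..<n}" "\<lambda>_. 1" "\<lambda>j. A j j"] diag1 q by simp
  have tr_le: "(\<Sum>j<n. A j j) \<le> 3 * real k"
  proof -
    have "(\<Sum>j<n. A j j) \<le> (\<Sum>j<n. 5 / 4)" using diag1 by (intro sum_mono)
    also have "\<dots> = 5 / 2 * real k" by (simp add: q(3))
    finally show ?thesis by simp
  qed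
  have pow: "(3 :: real) / 4 ^ CARD('d) \<le> 1"
    using power_increasing[of 1 "CARD('d)" "4 :: real"] one_le_CARD[where 'a = 'd] by simp
  have bound: "z ^ CARD('d) * (\<Sum>j<n. A j j) \<le> 1" if z: "0 \<le> z" "z \<le> 1 / (4 * real q)" for z
  proof -
    have "z ^ CARD('d) * (\<Sum>j<n. A j j) \<le> (1 / (4 * real q)) ^ CARD('d) * (3 * real k)"
      using z tr_le tr_ge by (intro mult_mono power_mono) auto
    also have "\<dots> = 3 / 4 ^ CARD('d)" using q by (simp add: power_mult_distrib power_divide)
    finally show ?thesis using pow by linarith
  qed
  show "cell_kernel A \<in> covariance_class K1 K2 r \<nu>"
  proof (rule cell_kernel_in_covariance_class[OF _ sym norm1, where s = s and \<delta> = "1 / (4 * real (2 * q))" and \<Delta> = "1 / 4"])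
    show "covariance_function (cell_kernel A)"
      unfolding covariance_function_def A using gp_law_cell_path[OF w1] by blast
    have "(1 :: real) \<le> (8 * real CARD('d)) ^ CARD('d)" using one_le_real_CARD[where 'a = 'd] by (intro one_le_power) simp
    then show K1: "0 \<le> K1" using K by linarith
    show "0 < (\<Sum>j<n. A j j)" using tr_ge k0 by linarith
    show "A j j / v \<le> K1 * (\<Sum>j<n. A j j)" for j
    proof -
      have "A j j / v \<le> 2 / v" using diag1[of j] v_pos by (intro divide_right_mono) auto
      also have "\<dots> = 2 * (8 * real CARD('d)) ^ CARD('d) * real k"
      proof -
        have "4 * real CARD('d) * real (2 * q) = (8 * real CARD('d)) * real q" by simp
        then have "v = (1 / ((8 * real CARD('d)) * real q)) ^ CARD('d)" by (simp only: v)
        also have "\<dots> = 1 / ((8 * real CARD('d)) ^ CARD('d) * real k)"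
          by (simp only: q(2) of_nat_power power_one_over power_mult_distrib)
        finally show ?thesis by simp
      qed
      also have "\<dots> \<le> K1 * (\<Sum>j<n. A j j)" using K K1 tr_ge by (intro mult_mono) auto
      finally show ?thesis .
    qed
    show "(\<Sum>j<n. A j j) \<le> r * op_norm (integral_op (cell_kernel A))"
    proof -
      have "r * 1 \<le> r * op_norm (integral_op (cell_kernel A))"
        using norm1 q k0 by (intro mult_left_mono) linarith+
      then show ?thesis using tr_le q by linarith
    qed
    show "(1 / (4 * real (2 * q))) ^ CARD('d) * (\<Sum>j<n. A j j) \<le> 1"
      using q by (intro bound) (auto simp: field_simps)
    show "s \<le> K2 * \<nu> l \<or> (1 / 4 / real l) ^ CARD('d) * (\<Sum>j<n. A j j) \<le> 1" if l: "1 \<le> l" for l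
    proof (cases "l \<le> m")
      case True
      have "2 * sqrt (real k / real N) \<le> K2 * \<nu> l"
        using decay[OF l True] K \<nu>[OF l] by (intro mult_mono) auto
      then show ?thesis by (simp add: s_def)
    next
      case False
      then have "real q \<le> real l" using qm by simp
      then have "1 / 4 / real l \<le> 1 / (4 * real q)" using q by (simp add: frac_le)
      then have "(1 / 4 / real l) ^ CARD('d) * (\<Sum>j<n. A j j) \<le> 1" by (intro bound) auto
      then show ?thesis ..
    qed
    show "(\<Sum>l\<in>{..<n} - {j}. \<bar>A j l\<bar>) \<le> s" for j by (rule off)
  qed (use K \<nu> diam total in auto)
qed

end

section \<open>The individual rates and their combination\<close>

text \<open>One construction gives both rates: about r cells and a separation a with a^2 = ln(2 n) /
  (4 N), which is at least of order 1 / N and, up to constants depending on d, at least ln r /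
  N.\<close>

lemma minimax_lower_log:
  fixes \<nu> :: "nat \<Rightarrow> real"
  assumes \<nu>: "\<And>m. 1 \<le> m \<Longrightarrow> 0 < \<nu> m" and r: "1 < r" "ln r < real N"
    and K: "2 * (4 * real CARD('d::finite)) ^ CARD('d) \<le> K1" "0 \<le> K2"
    and \<kappa>: "\<kappa> \<in> (estimators N :: ((nat \<Rightarrow> real ^ 'd \<Rightarrow> real) \<Rightarrow> 'd kernel) set)"
  defines "S \<equiv> worst_risk N \<kappa> (covariance_class K1 K2 r \<nu>)"
  shows "ennreal (sqrt (1 / real N) / 48) \<le> S" "ennreal (sqrt (ln r / real N) / (32 * real CARD('d))) \<le> S"
proof -
  let ?d = "CARD('d)" and ?F = "covariance_class K1 K2 r \<nu> :: 'd kernel set"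
  have "0 < ln r" using r by simp
  then have N: "0 < N" using r by (intro Nat.gr0I) auto
  obtain q :: nat where q: "1 \<le> q" "real q ^ ?d \<le> r" "r < (2 * real q) ^ ?d"
    using ex_nat_root[of r ?d] r by auto
  define n where "n = q ^ ?d"
  have n: "0 < n" "real n \<le> r" using q by (auto simp: n_def)
  obtain B :: "nat \<Rightarrow> (real ^ 'd) set" where
    B: "cell_family B n ((1 / (real (4 * ?d) * real q)) ^ ?d)"
    and diam: "\<And>i x y. i < n \<Longrightarrow> x \<in> B i \<Longrightarrow> y \<in> B i \<Longrightarrow> norm (x - y) \<le> real ?d / (real (4 * ?d) * real q)"
    and total: "\<And>i j x y. i < n \<Longrightarrow> j < n \<Longrightarrow> x \<in> B i \<Longrightarrow> y \<in> B j \<Longrightarrow> norm (x - y) \<le> real ?d / real (4 * ?d)"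
    using ex_grid_cells[where 'd = 'd, of q "4 * ?d" n] q by (metis n_def order_refl one_le_mult_iff one_le_numeral zero_less_card_finite Suc_leI One_nat_def)
  interpret cell_family B n "(1 / (real (4 * ?d) * real q)) ^ ?d" by (rule B)
  have inF: "cell_kernel (tilt_cov (spike i b) (spike i 1)) \<in> ?F" if "i < n" "0 \<le> b" "(1 + b)\<^sup>2 \<le> 2" for i b
  proof (rule scale_in_covariance_class[OF that q(1) n_def n(2) _ _ _ K \<nu>])
    show "norm (x - y) \<le> 1 / (4 * real q)" if "j < n" "x \<in> B j" "y \<in> B j" for j x y
      using diam[OF that] by simp
    show "norm (x - y) \<le> 1 / 4" if "j < n" "l < n" "x \<in> B j" "y \<in> B l" for j l x y
      using total[OF that] by simp
  qed simp_all
  \<comment> \<open>The 2 inside the logarithm keeps a of order 1 / sqrt N even when n = 1, which is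
    the parametric rate. The 4 ensures a^2 <= 1/2, because ln(2 n) <= 1 + ln r < 1 + N <= 2
    N.\<close>
  define a where "a = sqrt (ln (2 * real n) / (4 * real N))"
  have n1: "1 \<le> real n" using n by simp
  have ln2: "1 / 2 \<le> ln (2 :: real)" using ln2_ge_two_thirds by linarith
  have ln2n: "ln (2 * real n) = ln 2 + ln (real n)" using n by (simp add: ln_mult)
  have lnn: "0 \<le> ln (real n)" using n1 by simp
  have pos: "0 \<le> ln (2 * real n) / (4 * real N)" using ln2 ln2n lnn by simp
  have a2: "a\<^sup>2 = ln (2 * real n) / (4 * real N)" unfolding a_def using pos by simp
  have a0: "0 \<le> a" unfolding a_def using pos by simp
  have "ln (real n) \<le> ln r" using n r by simp
  moreover have "ln (2 :: real) \<le> 1" using ln_le_minus_one[of 2] by simp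
  ultimately have "ln (2 * real n) \<le> 2 * real N" using ln2n r N by simp
  then have a_half: "a\<^sup>2 \<le> 1 / 2" using N by (simp add: a2 field_simps)
  have "exp (real N * a\<^sup>2) \<le> exp (ln (2 * real n))"
    using N ln2 ln2n lnn by (simp add: a2)
  also have "\<dots> = 2 * real n" using n by simp
  finally have ae: "exp (real N * a\<^sup>2) \<le> 2 * real n" .
  have a1: "a \<le> 1" using a_half by (intro power2_le_imp_le[of a 1]) auto
  define \<alpha> where "\<alpha> = sqrt (1 + a) - 1"
  have \<alpha>: "0 \<le> \<alpha>" "(1 + \<alpha>)\<^sup>2 = 1 + a" using a0 by (auto simp: \<alpha>_def)
  have S: "ennreal (a / 16) \<le> S"
    unfolding S_def
  proof (rule minimax_scale_bound[OF n(1) N \<kappa> a0 a_half ae])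
    show "cell_kernel (tilt_cov (spike 0 0) (spike 0 1)) \<in> ?F" using n by (intro inF) auto
    show "cell_kernel (tilt_cov (spike i (sqrt (1 + a) - 1)) (spike i 1)) \<in> ?F" if "i < n" for i
      using inF[OF that \<alpha>(1)] \<alpha>(2) a1 by (simp add: \<alpha>_def)
    show "0 < op_norm (integral_op (cell_kernel (tilt_cov (spike 0 0) (spike 0 1))))"
      "op_norm (integral_op (cell_kernel (tilt_cov (spike 0 0) (spike 0 1)))) \<le> 2"
      using op_norm_scale[OF n(1), of 0] by simp_all
    show "0 < op_norm (integral_op (cell_kernel (tilt_cov (spike i (sqrt (1 + a) - 1)) (spike i 1))))"
      "op_norm (integral_op (cell_kernel (tilt_cov (spike i (sqrt (1 + a) - 1)) (spike i 1)))) \<le> 2" if "i < n" for i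
      using op_norm_scale[OF that \<alpha>(1)] \<alpha>(2) a0 a1 by (simp_all add: \<alpha>_def)
  qed
  have "sqrt (1 / real N) / 48 \<le> a / 16"
  proof -
    have "(1 / 3)\<^sup>2 * (1 / real N) \<le> ln (2 * real n) / (4 * real N)"
      using ln2 ln2n lnn N by (simp add: field_simps power2_eq_square)
    then have "sqrt ((1 / 3)\<^sup>2 * (1 / real N)) \<le> a" unfolding a_def by (rule real_sqrt_le_mono)
    then have "1 / 3 * sqrt (1 / real N) \<le> a" unfolding real_sqrt_mult by simp
    then show ?thesis by simp
  qed
  with S show "ennreal (sqrt (1 / real N) / 48) \<le> S" by (meson ennreal_leI order_trans)
  have "sqrt (ln r / real N) / (32 * real ?d) \<le> a / 16"
  proof -
    have "ln r \<le> ln ((2 * real q) ^ ?d)" using q r by (intro ln_mono) auto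
    also have "\<dots> = real ?d * ln (2 * real q)" by (rule ln_realpow)
    also have "ln (2 * real q) \<le> ln (2 * real n)"
    proof -
      have "q \<le> n" unfolding n_def using q by (intro self_le_power) auto
      then show ?thesis using q by (intro ln_mono) auto
    qed
    \<comment> \<open>The extra factor d makes the constant a perfect square.\<close>
    also have "real ?d * ln (2 * real n) \<le> real ?d * real ?d * ln (2 * real n)"
      using ln2 ln2n lnn one_le_real_CARD[where 'a = 'd] by (intro mult_right_mono) auto
    finally have "ln r \<le> (real ?d)\<^sup>2 * ln (2 * real n)" by (simp add: power2_eq_square)
    then have "ln r / real N \<le> (real ?d)\<^sup>2 * ln (2 * real n) / real N" by (intro divide_right_mono) auto
    also have "\<dots> = (2 * real ?d)\<^sup>2 * (ln (2 * real n) / (4 * real N))" by (simp add: power_mult_distrib)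
    finally have "sqrt (ln r / real N) \<le> sqrt ((2 * real ?d)\<^sup>2 * (ln (2 * real n) / (4 * real N)))"
      by (rule real_sqrt_le_mono)
    also have "\<dots> = 2 * real ?d * a"
      unfolding a_def real_sqrt_mult[of "(2 * real ?d)\<^sup>2"] real_sqrt_abs by simp
    finally show ?thesis by (simp add: field_simps)
  qed
  with S show "ennreal (sqrt (ln r / real N) / (32 * real ?d)) \<le> S" by (meson ennreal_leI order_trans)
qed

text \<open>All shear covariances have norm at most 4, which turns the 16 of
  \<open>minimax_shear_bound\<close> into 64.\<close>

lemma minimax_lower_bandwidth:
  fixes \<nu> :: "nat \<Rightarrow> real" and q m N :: nat
  assumes \<nu>: "\<And>m. 1 \<le> m \<Longrightarrow> 0 < \<nu> m" and N: "0 < N"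
    and q: "1 \<le> q" "3 * real q ^ CARD('d::finite) \<le> r" "q \<le> m" "q ^ CARD('d) \<le> N"
    and decay: "\<And>l. 1 \<le> l \<Longrightarrow> l \<le> m \<Longrightarrow> sqrt (real q ^ CARD('d) / real N) \<le> \<nu> l"
    and K: "2 * (8 * real CARD('d)) ^ CARD('d) \<le> K1" "2 \<le> K2"
    and \<kappa>: "\<kappa> \<in> (estimators N :: ((nat \<Rightarrow> real ^ 'd \<Rightarrow> real) \<Rightarrow> 'd kernel) set)"
  defines "S \<equiv> worst_risk N \<kappa> (covariance_class K1 K2 r \<nu>)"
  shows "ennreal (sqrt (real q ^ CARD('d) / real N) / 64) \<le> S"
proof -
  let ?d = "CARD('d)" and ?F = "covariance_class K1 K2 r \<nu> :: 'd kernel set"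
  define k where "k = q ^ ?d"
  have k: "0 < k" "real k = real q ^ ?d" using q by (auto simp: k_def)
  \<comment> \<open>Two halves of \<open>q ^ d\<close> cells fit into a grid with
    \<open>2 * q\<close> cells per axis, because d >= 1.\<close>
  have "2 * k \<le> 2 ^ ?d * k" using power_increasing[of 1 ?d "2 :: nat"] one_le_CARD[where 'a = 'd]
    by (intro mult_right_mono) auto
  then have nq: "2 * k \<le> (2 * q) ^ ?d" by (simp add: k_def power_mult_distrib)
  have "1 \<le> 2 * q" "1 \<le> 4 * ?d" using q one_le_CARD[where 'a = 'd] by auto
  then obtain B :: "nat \<Rightarrow> (real ^ 'd) set" where
    B: "cell_family B (2 * k) ((1 / (real (4 * ?d) * real (2 * q))) ^ ?d)"
    and diam: "\<And>i x y. i < 2 * k \<Longrightarrow> x \<in> B i \<Longrightarrow> y \<in> B i \<Longrightarrow> norm (x - y) \<le> real ?d / (real (4 * ?d) * real (2 * q))"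
    and total: "\<And>i j x y. i < 2 * k \<Longrightarrow> j < 2 * k \<Longrightarrow> x \<in> B i \<Longrightarrow> y \<in> B j \<Longrightarrow> norm (x - y) \<le> real ?d / real (4 * ?d)"
    using ex_grid_cells[where 'd = 'd, OF _ _ nq, of "4 * ?d"] by metis
  interpret cell_family B "2 * k" "(1 / (real (4 * ?d) * real (2 * q))) ^ ?d" by (rule B)
  have diam': "norm (x - y) \<le> 1 / (4 * real (2 * q))" if "j < 2 * k" "x \<in> B j" "y \<in> B j" for j x y
    using diam[OF that] by simp
  have total': "norm (x - y) \<le> 1 / 4" if "j < 2 * k" "l < 2 * k" "x \<in> B j" "y \<in> B l" for j l x y
    using total[OF that] by simp
  have kN: "k \<le> N" and rk: "3 * real k \<le> r" using q by (simp_all add: k_def)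
  have decay': "sqrt (real k / real N) \<le> \<nu> l" if "1 \<le> l" "l \<le> m" for l using decay[OF that] k by simp
  note shear = shear_in_covariance_class[OF _ q(1) k_def refl rk kN q(3) _ diam' total' K \<nu> decay']
  have "ennreal (sqrt (real k / real N) / (16 * 4)) \<le> S"
    unfolding S_def
  proof (rule minimax_shear_bound[OF k(1) refl N \<kappa>])
    fix \<theta> assume \<theta>: "\<theta> \<subseteq> {..<k}"
    let ?T = "cell_kernel (tilt_cov (on_set \<theta> (1 / (2 * sqrt (real N)))) (on_set {k..<2 * k} (1 / sqrt (real k))))"
    have "1 \<le> op_norm (integral_op ?T)" by (rule shear(1)[OF \<theta>]) simp_all
    then show "0 < op_norm (integral_op ?T)" by linarith
    show "op_norm (integral_op ?T) \<le> 4" by (rule shear(2)[OF \<theta>]) simp_all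
    show "?T \<in> ?F" by (rule shear(3)[OF \<theta>]) simp_all
  qed simp
  then show ?thesis using k by simp
qed

text \<open>Applied with \<open>m\<close> one below \<open>m_star\<close>: up to \<open>m\<close>
  the second argument of the minimum is increasing, and beyond \<open>m\<close> monotonicity of
  \<nu> reduces everything to \<open>m + 1\<close>, which is within a factor 2 of
  \<open>m\<close>.\<close>

lemma eps_star_le:
  fixes \<nu> :: "nat \<Rightarrow> real" and N d m :: nat
  assumes \<nu>: "\<And>m n. 1 \<le> m \<Longrightarrow> m \<le> n \<Longrightarrow> \<nu> n \<le> \<nu> m"
    and m: "1 \<le> m" and Suc: "\<nu> (m + 1) \<le> sqrt (real (m + 1) ^ d / real N)"
  shows "eps_star \<nu> N d \<le> 2 ^ d * sqrt (real m ^ d / real N)"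
  unfolding eps_star_def
proof (rule cSUP_least)
  fix j :: nat assume "j \<in> {1..}"
  then have j: "1 \<le> j" by simp
  have one: "(1 :: real) \<le> 2 ^ d" by (rule one_le_power) simp
  show "min (\<nu> j) (sqrt (real j ^ d / real N)) \<le> 2 ^ d * sqrt (real m ^ d / real N)"
  proof (cases "j \<le> m")
    case True
    have "sqrt (real j ^ d / real N) \<le> sqrt (real m ^ d / real N)"
      using True by (intro real_sqrt_le_mono divide_right_mono power_mono) auto
    also have "\<dots> \<le> 2 ^ d * sqrt (real m ^ d / real N)"
      using mult_right_mono[OF one, of "sqrt (real m ^ d / real N)"] by simp
    finally show ?thesis by simp
  next
    case False
    have "\<nu> j \<le> \<nu> (m + 1)" using \<nu>[of "m + 1" j] False by simp
    also have "\<dots> \<le> sqrt (real (m + 1) ^ d / real N)" by (rule Suc)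
    also have "\<dots> \<le> sqrt ((2 ^ d)\<^sup>2 * (real m ^ d / real N))"
    proof (rule real_sqrt_le_mono)
      \<comment> \<open>The factor \<open>2 ^ d\<close> is spent twice, so that the root of the
        constant is again \<open>2 ^ d\<close> and no exponent d/2 arises.\<close>
      have "real (m + 1) ^ d \<le> (2 * real m) ^ d" using m by (intro power_mono) auto
      also have "\<dots> \<le> 2 ^ d * (2 ^ d * real m ^ d)"
        unfolding power_mult_distrib using mult_right_mono[OF one, of "2 ^ d * real m ^ d"] by simp
      finally have "real (m + 1) ^ d / real N \<le> 2 ^ d * (2 ^ d * real m ^ d) / real N"
        by (intro divide_right_mono) auto
      then show "real (m + 1) ^ d / real N \<le> (2 ^ d)\<^sup>2 * (real m ^ d / real N)"
        by (simp add: power2_eq_square mult.assoc)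
    qed
    also have "\<dots> = 2 ^ d * sqrt (real m ^ d / real N)" unfolding real_sqrt_mult by simp
    finally show ?thesis by simp
  qed
qed auto

theorem theorem2p8:
  shows "\<exists>K0>0. \<exists>c>0. \<forall>K1\<ge>K0. \<forall>K2\<ge>K0.
    \<forall>(\<nu> :: nat \<Rightarrow> real) (r :: real) (N :: nat).
      (\<forall>m\<ge>1. 0 < \<nu> m) \<and> (\<forall>m\<ge>1. \<forall>n\<ge>m. \<nu> n \<le> \<nu> m) \<and> \<nu> 1 = 1 \<and>
      0 < r \<and> 0 < ln r \<and> ln r < real N \<and>
      2 \<le> m_star \<nu> N CARD('d::finite) \<longrightarrow>
      minimax_risk N (covariance_class K1 K2 r \<nu> :: 'd kernel set) \<ge>
        ennreal (c * min (eps_star \<nu> N CARD('d) + sqrt (ln r / real N)) (sqrt (r / real N)))"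
proof -
  let ?d = "CARD('d)"
  \<comment> \<open>The diagonal bound of the shear family is the most demanding one; the value is
    also at least 2, as the decay bound asks of \<open>K2\<close>.\<close>
  define K0 where "K0 = 2 * (8 * real ?d) ^ ?d"
  \<comment> \<open>The shear bound contributes \<open>2 ^ d * 2 * 64\<close>, the logarithmic bound
    \<open>32 * d\<close>, and the case of small \<open>r\<close> needs
    \<open>2 * 48\<close>.\<close>
  define C where "C = 2 ^ ?d * 128 + 32 * real ?d + 96"
  have "(1 :: real) \<le> (8 * real ?d) ^ ?d" using one_le_real_CARD[where 'a = 'd] by (intro one_le_power) simp
  then have K0: "2 \<le> K0" by (simp add: K0_def)
  have C: "0 < C" by (simp add: C_def add_pos_nonneg)
  have bound: "ennreal (1 / C * min (eps_star \<nu> N ?d + sqrt (ln r / real N)) (sqrt (r / real N)))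
      \<le> minimax_risk N (covariance_class K1 K2 r \<nu> :: 'd kernel set)"
    if K1: "K0 \<le> K1" and K2: "K0 \<le> K2" and pos: "\<forall>m\<ge>1. 0 < \<nu> m" and dec: "\<forall>m\<ge>1. \<forall>n\<ge>m. \<nu> n \<le> \<nu> m"
      and one: "\<nu> 1 = 1" and r: "0 < r" "0 < ln r" "ln r < real N" and ms: "2 \<le> m_star \<nu> N ?d"
    for K1 K2 \<nu> r N
    unfolding minimax_risk_def
  proof (rule INF_greatest)
    fix \<kappa> :: "(nat \<Rightarrow> real ^ 'd \<Rightarrow> real) \<Rightarrow> 'd kernel" assume \<kappa>: "\<kappa> \<in> estimators N"
    let ?F = "covariance_class K1 K2 r \<nu> :: 'd kernel set"
    define S where "S = worst_risk N \<kappa> ?F"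
    let ?t = "min (eps_star \<nu> N ?d + sqrt (ln r / real N)) (sqrt (r / real N))"
    have r1: "1 < r" using r by (metis ln_gt_zero_iff)
    have N: "0 < N" using r by (intro Nat.gr0I) auto
    define m where "m = m_star \<nu> N ?d - 1"
    have m: "1 \<le> m" "m_star \<nu> N ?d = m + 1" using ms by (auto simp: m_def)
    let ?P = "\<lambda>m. m \<ge> 1 \<and> \<nu> m \<le> sqrt (real m ^ ?d / real N)"
    \<comment> \<open>\<open>N\<close> is a candidate in the definition of \<open>m_star\<close>, so
      the least one exists: \<nu> is at most 1, and N^d / N is at least 1.\<close>
    have "?P N"
    proof -
      have "real N \<le> real N ^ ?d" using N by (intro self_le_power) auto
      then have "1 \<le> real N ^ ?d / real N" using N by (simp only: pos_le_divide_eq of_nat_0_less_iff mult_1)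
      then have "1 \<le> sqrt (real N ^ ?d / real N)" by (rule real_sqrt_ge_one)
      moreover have "\<nu> N \<le> 1" using dec one N by (metis One_nat_def Suc_leI order_refl)
      ultimately have "\<nu> N \<le> sqrt (real N ^ ?d / real N)" by linarith
      then show ?thesis using N by simp
    qed
    then have "?P (m_star \<nu> N ?d)" unfolding m_star_def by (rule LeastI)
    then have Suc_m: "\<nu> (m + 1) \<le> sqrt (real (m + 1) ^ ?d / real N)" using m by simp
    have "\<not> ?P m" using m(2) unfolding m_star_def by (intro not_less_Least) simp
    then have \<nu>m: "sqrt (real m ^ ?d / real N) < \<nu> m" using m by simp
    have \<nu>l: "sqrt (real m ^ ?d / real N) \<le> \<nu> l" if "1 \<le> l" "l \<le> m" for l
      using \<nu>m dec that by (meson less_imp_le order_trans)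
    \<comment> \<open>Since \<nu> is at most 1, the failure of the defining inequality at
      \<open>m\<close> forces m^d < N, which later gives \<open>k \<le> N\<close> and bounded row
      sums.\<close>
    have "\<nu> m \<le> 1" using dec[rule_format, of 1 m] one m(1) by simp
    then have "sqrt (real m ^ ?d / real N) < 1" using \<nu>m by linarith
    then have mN: "real m ^ ?d < real N" using N by simp
    have eps: "eps_star \<nu> N ?d \<le> 2 ^ ?d * sqrt (real m ^ ?d / real N)"
      using dec m Suc_m by (intro eps_star_le) auto
    have "2 * (4 * real ?d) ^ ?d \<le> 2 * (8 * real ?d) ^ ?d" by (intro mult_left_mono power_mono) auto
    then have K1': "2 * (4 * real ?d) ^ ?d \<le> K1" "2 * (8 * real ?d) ^ ?d \<le> K1" "0 \<le> K2" "2 \<le> K2"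
      using K1 K2 K0 unfolding K0_def by linarith+
    have log: "ennreal (sqrt (1 / real N) / 48) \<le> S" "ennreal (sqrt (ln r / real N) / (32 * real ?d)) \<le> S"
      unfolding S_def using minimax_lower_log[OF _ r1 r(3) K1'(1,3) \<kappa>] pos by blast+
    have "ennreal (1 / C * ?t) \<le> S"
    proof (cases S)
      case top
      then show ?thesis by simp
    next
      case (real s)
      have s1: "sqrt (1 / real N) \<le> 48 * s"
        using log(1) real by (simp add: ennreal_le_iff)
      have s2: "sqrt (ln r / real N) \<le> 32 * real ?d * s"
        using log(2) real by (simp add: ennreal_le_iff field_simps)
      have "?t \<le> C * s"
      \<comment> \<open>The shear bound asks for 3 q^d <= r, which is impossible below 3. There
        sqrt(r / N) is at most 2 / sqrt N, so the parametric rate suffices; 4 replaces 3 to have a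
        perfect square.\<close>
      proof (cases "r < 3")
        case True
        have "?t \<le> sqrt (2\<^sup>2 * (1 / real N))"
          using True N by (intro min.coboundedI2 real_sqrt_le_mono) (auto simp: divide_right_mono)
        also have "\<dots> = 2 * sqrt (1 / real N)" unfolding real_sqrt_mult by simp
        also have "\<dots> \<le> 96 * s" using s1 by simp
        also have "\<dots> \<le> C * s" using real(1) by (intro mult_right_mono) (auto simp: C_def)
        finally show ?thesis .
      next
        case False
        then obtain q0 :: nat where q0: "1 \<le> q0" "real q0 ^ ?d \<le> r / 3" "r / 3 < (2 * real q0) ^ ?d"
          using ex_nat_root[of "r / 3" ?d] by auto
        \<comment> \<open>\<open>q0\<close> is the scale allowed by the effective dimension,
          \<open>m\<close> the one allowed by the decay.\<close>
        define q where "q = min q0 m"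
        have q: "1 \<le> q" "q \<le> m" using q0 m by (auto simp: q_def)
        have "real q ^ ?d \<le> real q0 ^ ?d" by (intro power_mono) (auto simp: q_def)
        then have q3: "3 * real q ^ ?d \<le> r" using q0(2) by linarith
        have qm: "real q ^ ?d \<le> real m ^ ?d" using q by (intro power_mono) auto
        then have "real (q ^ ?d) \<le> real N" using mN unfolding of_nat_power by linarith
        then have qN: "q ^ ?d \<le> N" by (simp only: of_nat_le_iff)
        have "ennreal (sqrt (real q ^ ?d / real N) / 64) \<le> S"
          unfolding S_def
        proof (rule minimax_lower_bandwidth[OF _ N q(1) q3 q(2) qN _ K1'(2,4) \<kappa>])
          show "sqrt (real q ^ ?d / real N) \<le> \<nu> l" if "1 \<le> l" "l \<le> m" for l
          proof -
            have "sqrt (real q ^ ?d / real N) \<le> sqrt (real m ^ ?d / real N)"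
              using qm by (intro real_sqrt_le_mono divide_right_mono) auto
            then show ?thesis using \<nu>l[OF that] by linarith
          qed
        qed (use pos in auto)
        then have s3: "sqrt (real q ^ ?d / real N) \<le> 64 * s"
          using real by (simp add: ennreal_le_iff)
        \<comment> \<open>The smaller scale decides which term of the minimum is controlled:
          \<open>eps_star\<close> if q = m, and sqrt(r / N) if q = q0, by r < 3 (2 q)^d.\<close>
        have key: "min (eps_star \<nu> N ?d) (sqrt (r / real N)) \<le> 2 ^ ?d * 2 * sqrt (real q ^ ?d / real N)"
        proof (cases "m \<le> q0")
          case True
          then have "q = m" by (simp add: q_def)
          then have "eps_star \<nu> N ?d \<le> 2 ^ ?d * sqrt (real q ^ ?d / real N)" using eps by simp
          also have "\<dots> \<le> 2 ^ ?d * 2 * sqrt (real q ^ ?d / real N)" by simp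
          finally show ?thesis by simp
        next
          case False
          then have "q = q0" by (simp add: q_def)
          have p1: "(1 :: real) \<le> 2 ^ ?d" by (rule one_le_power) simp
          have "r \<le> 3 * (2 ^ ?d * real q ^ ?d)"
            using q0(3) by (simp add: \<open>q = q0\<close> power_mult_distrib)
          also have "\<dots> \<le> 4 * (2 ^ ?d * 2 ^ ?d * real q ^ ?d)"
            using p1 by (intro mult_mono) (auto simp: mult_le_cancel_right1)
          finally have "r / real N \<le> (2 ^ ?d * 2)\<^sup>2 * (real q ^ ?d / real N)"
            using N by (simp add: power2_eq_square field_simps)
          then have "sqrt (r / real N) \<le> sqrt ((2 ^ ?d * 2)\<^sup>2 * (real q ^ ?d / real N))"
            by (rule real_sqrt_le_mono)
          also have "\<dots> = 2 ^ ?d * 2 * sqrt (real q ^ ?d / real N)"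
            unfolding real_sqrt_mult[of "(2 ^ ?d * 2)\<^sup>2"] real_sqrt_abs by simp
          finally show ?thesis by simp
        qed
        have min_add: "min (x + z) y \<le> min x y + z" if "0 \<le> z" for x y z :: real
          using that by (auto simp: min_def)
        have "0 \<le> sqrt (ln r / real N)" using r by simp
        then have "?t \<le> min (eps_star \<nu> N ?d) (sqrt (r / real N)) + sqrt (ln r / real N)" by (rule min_add)
        also have "\<dots> \<le> 2 ^ ?d * 2 * sqrt (real q ^ ?d / real N) + sqrt (ln r / real N)" using key by simp
        also have "\<dots> \<le> 2 ^ ?d * 2 * (64 * s) + 32 * real ?d * s"
          using s2 s3 by (intro add_mono mult_left_mono) auto
        also have "\<dots> \<le> C * s" using real(1) by (simp add: C_def algebra_simps)
        finally show ?thesis .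
      qed
      then have "1 / C * ?t \<le> s" using C by (simp add: field_simps)
      then show ?thesis unfolding real(2) by (rule ennreal_leI)
    qed
    then show "ennreal (1 / C * ?t) \<le> worst_risk N \<kappa> ?F"
      by (simp only: S_def)
  qed
  show ?thesis
  proof (rule exI[of _ K0], intro conjI)
    show "0 < K0" using K0 by simp
    show "\<exists>c>0. \<forall>K1\<ge>K0. \<forall>K2\<ge>K0. \<forall>(\<nu> :: nat \<Rightarrow> real) (r :: real) (N :: nat).
      (\<forall>m\<ge>1. 0 < \<nu> m) \<and> (\<forall>m\<ge>1. \<forall>n\<ge>m. \<nu> n \<le> \<nu> m) \<and> \<nu> 1 = 1 \<and>
      0 < r \<and> 0 < ln r \<and> ln r < real N \<and> 2 \<le> m_star \<nu> N ?d \<longrightarrow>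
      minimax_risk N (covariance_class K1 K2 r \<nu> :: 'd kernel set) \<ge>
        ennreal (c * min (eps_star \<nu> N ?d + sqrt (ln r / real N)) (sqrt (r / real N)))"
    proof (rule exI[of _ "1 / C"], intro conjI allI impI)
      show "0 < 1 / C" using C by simp
    qed (rule bound, auto)
  qed
qed

end
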